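(* Let $\mu$ be a probability distribution on $\mathbb{R}^d$, let $T > 0$ and $m \in \mathbb{N}$. For $t \ge 0$ and $y\in\mathbb{R}^d$ let $P(\cdot\mid y,t)$ be the conditional distribution of $X$ given $Y(t) = y$, where $Y(t) = tX + \sqrt{t}N$ with $X\sim\mu$ and $N\sim\mathsf{N}(0,\mathrm{I})$ independent (i.e. $P(dx\mid y,t) \propto e^{\langle x,y\rangle - t\|x\|^2/2}\mu(dx)$). Let $Q(\cdot\mid z,t)$ be a Markov kernel from $\mathbb{R}^d\times[0,\infty)$ to $\mathbb{R}^d$. Assume: (1) (sub-Gaussian tails) there is $L>0$ with $\int e^{\|x\|^2/L^2}\mu(dx) \le 2$ and $\mathbb{E}\big[\int e^{\|x\|^2/L^2} Q(dx\mid Y(t),t)\big] \le 2$ for all $t\in[0,T]$; (2) (matched moments) for all multi-indices $\alpha\in\mathbb{N}_0^d$ with $\alpha_1+\cdots+\alpha_d \le m$ and all $(y,t)\in\mathbb{R}^d\times[0,T]$, $\int x^\alpha P(dx\mid y,t) = \int x^\alpha Q(dx\mid y,t)$, where $x^\alpha = \prod_i x_i^{\alpha_i}$. Let $\delta_1,\dots,\delta_n > 0$, $t_k = \delta_1+\cdots+\delta_k$ ($t_0=0$), and assume $t_{n-1} \le T$. Let $Y_0 = 0$, $Y_k = Y_{k-1} + \delta_k X + \sqrt{\delta_k}N_k$ with $N_k$ i.i.d. standard Gaussian independent of $X\sim\mu$. Let $Z_0 = 0$ and $Z_k = Z_{k-1} + \delta_k\hat X_k + \sqrt{\delta_k}\tilde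 N_k$, where, conditionally on the past, $\hat X_k$ is drawn from $Q(\cdot\mid Z_{k-1}, t_{k-1})$ and $\tilde N_k$ is a standard Gaussian vector independent of everything else (so $(Z_k)$ is a Markov chain). Let $\Delta_n = D(\mathrm{Law}(Y_1,\dots,Y_n)\,\|\,\mathrm{Law}(Z_1,\dots,Z_n))$. Then there is a constant $c_{d,m}>0$ depending only on $(d,m)$ such that $$\Delta_n \le c_{d,m}\,L^{2(m+1)}\sum_{k=1}^n \delta_k^{m+1}.$$ In particular, if $\delta_k = T/n$ for all $k$, then $\Delta_n \le c_{d,m,T,L}\, n^{-m}$ for a constant $c_{d,m,T,L}$ depending only on $(d,m,T,L)$.
   Context: $D(\cdot\|\cdot)$ is the Kullback–Leibler divergence. $\mathsf{N}(0,\mathrm{I})$ is the standard Gaussian on $\mathbb{R}^d$. *)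

theory Defs
  imports "HOL-Probability.Probability"
begin

definition std_gaussian :: "(real^'d) measure" where
  "std_gaussian = density lborel
     (\<lambda>x. ennreal ((2*pi) powr (-(real CARD('d)) / 2) * exp (-((norm x)^2) / 2)))"

definition posterior :: "(real^'d) measure \<Rightarrow> real^'d \<Rightarrow> real \<Rightarrow> (real^'d) measure" where
  "posterior \<mu> y t = density \<mu>
     (\<lambda>x. ennreal (exp (x \<bullet> y - t * (norm x)^2 / 2)
        / (\<integral>x'. exp (x' \<bullet> y - t * (norm x')^2 / 2) \<partial>\<mu>)))"

definition mono_pow :: "('d::finite \<Rightarrow> nat) \<Rightarrow> real^'d \<Rightarrow> real" where
  "mono_pow \<alpha> x = (\<Prod>i\<in>UNIV. (x $ i) ^ (\<alpha> i))"

definition KL_div :: "'a measure \<Rightarrow> 'a measure \<Rightarrow> ereal" where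
  "KL_div P Q = (if absolutely_continuous Q P \<and>
        integrable P (\<lambda>x. ln (enn2real (RN_deriv Q P x)))
     then ereal (\<integral>x. ln (enn2real (RN_deriv Q P x)) \<partial>P) else \<infinity>)"

definition law_Y :: "(real^'d) measure \<Rightarrow> (nat \<Rightarrow> real) \<Rightarrow> nat \<Rightarrow> (nat \<Rightarrow> real^'d) measure" where
  "law_Y \<mu> \<delta> n = distr (\<mu> \<Otimes>\<^sub>M (\<Pi>\<^sub>M j\<in>{1..n}. std_gaussian)) (\<Pi>\<^sub>M j\<in>{1..n}. borel)
     (\<lambda>(x, N). \<lambda>k\<in>{1..n}. (\<Sum>j=1..k. \<delta> j) *\<^sub>R x + (\<Sum>j=1..k. sqrt (\<delta> j) *\<^sub>R N j))"

definition z_step :: "(real^'d \<Rightarrow> real \<Rightarrow> (real^'d) measure) \<Rightarrow> (nat \<Rightarrow> real) \<Rightarrow> nat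
    \<Rightarrow> real^'d \<Rightarrow> (real^'d) measure" where
  "z_step Q \<delta> k z = distr (Q z (\<Sum>j=1..k-1. \<delta> j) \<Otimes>\<^sub>M std_gaussian) borel
     (\<lambda>(x, g). z + \<delta> k *\<^sub>R x + sqrt (\<delta> k) *\<^sub>R g)"

fun law_Z :: "(real^'d \<Rightarrow> real \<Rightarrow> (real^'d) measure) \<Rightarrow> (nat \<Rightarrow> real) \<Rightarrow> nat
    \<Rightarrow> (nat \<Rightarrow> real^'d) measure" where
  "law_Z Q \<delta> 0 = return (\<Pi>\<^sub>M j\<in>{1..(0::nat)}. borel) (\<lambda>_. undefined)"
| "law_Z Q \<delta> (Suc k) = law_Z Q \<delta> k \<bind> (\<lambda>z.
     distr (z_step Q \<delta> (Suc k) (if k = 0 then 0 else z k)) (\<Pi>\<^sub>M j\<in>{1..Suc k}. borel)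
       (\<lambda>w. z(Suc k := w)))"

definition thm3_hyps :: "(real^'d::finite) measure \<Rightarrow> (real^'d \<Rightarrow> real \<Rightarrow> (real^'d) measure)
    \<Rightarrow> real \<Rightarrow> real \<Rightarrow> nat \<Rightarrow> bool" where
  "thm3_hyps \<mu> Q T L m \<longleftrightarrow>
     prob_space \<mu> \<and> sets \<mu> = sets borel \<and>
     (\<lambda>(z, t). Q z t) \<in> measurable (borel \<Otimes>\<^sub>M restrict_space borel {0..}) (prob_algebra borel) \<and>
     (\<integral>\<^sup>+x. ennreal (exp ((norm x)^2 / L^2)) \<partial>\<mu>) \<le> 2 \<and>
     (\<forall>t\<in>{0..T}. (\<integral>\<^sup>+p. (\<integral>\<^sup>+x'. ennreal (exp ((norm x')^2 / L^2))
          \<partial>(Q (t *\<^sub>R fst p + sqrt t *\<^sub>R snd p) t)) \<partial>(\<mu> \<Otimes>\<^sub>M std_gaussian)) \<le> 2) \<and>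
     (\<forall>\<alpha>::'d \<Rightarrow> nat. (\<Sum>i\<in>UNIV. \<alpha> i) \<le> m \<longrightarrow>
        (\<forall>y. \<forall>t\<in>{0..T}. integrable (Q y t) (mono_pow \<alpha>) \<and>
           (\<integral>x. mono_pow \<alpha> x \<partial>(posterior \<mu> y t)) = (\<integral>x. mono_pow \<alpha> x \<partial>(Q y t))))"

end

theory Submission
  imports Defs
begin

text \<open>
  By the chain rule the divergence is the sum over \<open>k\<close> of the expected divergence between the
  transition laws of \<open>Y\<close> and \<open>Z\<close> started at \<open>Y\<^sub>k\<close>. After rescaling by \<open>s = sqrt \<delta>\<close> these are \<open>s X + N\<close>
  with \<open>X\<close> drawn from \<open>P = P(. | Y\<^sub>k)\<close> or from \<open>Q = Q(. | Y\<^sub>k)\<close>; let \<open>p\<close>, \<open>q\<close> be their densities with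
  respect to the law of \<open>N\<close>. If \<open>s L\<close> is small, the divergence is at most \<open>E (p - q)^2 / q\<close>, and Jensen's
  inequality gives \<open>q \<ge> exp (s <a, N> - s^2 M / 2)\<close> with \<open>a = E\<^sub>Q X\<close> and \<open>M = E\<^sub>Q |X|^2\<close>. With this weight
  the Gaussian expectation becomes the double integral of \<open>exp (s^2 <x - a, x' - a>)\<close> against
  \<open>(P - Q) \<otimes> (P - Q)\<close>, up to a factor. The Taylor polynomial of degree \<open>m\<close> of the exponential is a polynomial
  of degree at most \<open>m\<close> in \<open>x\<close> and integrates to zero by moment matching; the remainder is of order
  \<open>(s L)^(2 (m + 1))\<close> by the sub-Gaussian bounds. If \<open>s L\<close> is bounded below, the crude bounds
  \<open>ln p \<le> |N|^2 / 2\<close> and Jensen suffice.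
\<close>

section \<open>The standard Gaussian measure\<close>

text \<open>The sub-Gaussian bounds for the posterior and for \<open>Q\<close> hold only on average
  over \<open>Y_k\<close>; at a single starting point the exponential moments have no numerical
  bound and may be infinite. Each estimate for one transition is therefore kept linear in
  \<open>E_P exp (|x|^2 / L^2) + E_Q exp (|x|^2 / L^2)\<close>, a form that survives averaging. This
  is why the half exponent \<open>|x|^2 / (2 L^2)\<close> appears: a product of two such integrals
  is still bounded linearly by the full ones. The threshold \<open>1/8\<close> for
  \<open>s^2 L^2\<close> leaves room for this after the Taylor remainder and the shift by
  \<open>a\<close> have used their shares of the exponent. \<open>KL_div\<close> is infinite unless
  the logarithm of the density is integrable, so the induction over \<open>k\<close> carries a
  concrete positive density with integrable logarithm. Integrability is obtained from the
  nonnegative integrand \<open>p ln (p / q) - p + q\<close>, whose two extra terms cancel after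
  integration.\<close>

definition gauss_dens :: "real^'d \<Rightarrow> real" where
  "gauss_dens x = (2*pi) powr (-(real CARD('d)) / 2) * exp (-((norm x)^2) / 2)"

lemma std_gaussian_eq: "std_gaussian = density lborel (\<lambda>x. ennreal (gauss_dens x))"
  by (simp add: std_gaussian_def gauss_dens_def)

lemma gauss_dens_nonneg [simp]: "0 \<le> gauss_dens x"
  by (simp add: gauss_dens_def)

lemma measurable_gauss_dens [measurable]: "gauss_dens \<in> borel_measurable borel"
  unfolding gauss_dens_def[abs_def] by measurable

lemma sets_std_gaussian [simp, measurable_cong]: "sets std_gaussian = sets borel"
  by (simp add: std_gaussian_def)

lemma space_std_gaussian [simp]: "space std_gaussian = UNIV"
  by (simp add: std_gaussian_def)

lemma nn_integral_std_gaussian: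
  assumes [measurable]: "F \<in> borel_measurable borel"
  shows "(\<integral>\<^sup>+g. F g \<partial>std_gaussian) = (\<integral>\<^sup>+g. ennreal (gauss_dens g) * F g \<partial>lborel)"
  unfolding std_gaussian_eq by (subst nn_integral_density) auto

text \<open>The squared norm is a sum of squared coordinates, so the density is a product of
  one-dimensional normal densities and the integral factors along \<open>Basis\<close>.\<close>

lemma nn_integral_gauss_dens: "(\<integral>\<^sup>+g. ennreal (gauss_dens (g::real^'d)) \<partial>lborel) = 1"
proof -
  have eq: "ennreal (gauss_dens g) = (\<Prod>b\<in>Basis. ennreal (std_normal_density (g \<bullet> b)))" for g :: "real^'d"
  proof -
    have "(norm g)^2 = (\<Sum>b\<in>Basis. (g \<bullet> b)^2)"
      unfolding norm_eq_sqrt_inner euclidean_inner[of g g]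
      by (simp add: sum_nonneg power2_eq_square)
    then have "exp (-((norm g)^2) / 2) = (\<Prod>b\<in>Basis. exp (-((g \<bullet> b)^2) / 2))"
      by (simp add: exp_sum[symmetric] sum_divide_distrib sum_negf)
    moreover have "(2*pi) powr (-(real CARD('d)) / 2) = (\<Prod>b\<in>(Basis::(real^'d) set). 1 / sqrt (2*pi))"
    proof -
      have **: "1 / sqrt r = r powr (-1/2)" if "r > 0" for r :: real
        using powr_minus[of r "1/2"] powr_half_sqrt[of r] that by (simp add: field_simps)
      have *: "1 / sqrt (2*pi) = (2*pi) powr (-1/2)"
        by (rule **) simp
      have "(\<Prod>b\<in>(Basis::(real^'d) set). 1 / sqrt (2*pi)) = (1 / sqrt (2*pi)) ^ CARD('d)"
        by (subst prod_constant) simp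
      also have "\<dots> = ((2*pi) powr (-1/2)) ^ CARD('d)"
        by (simp only: *)
      also have "\<dots> = (2*pi) powr (-(real CARD('d)) / 2)"
        by (subst powr_power) auto
      finally show ?thesis by simp
    qed
    ultimately have "gauss_dens g = (\<Prod>b\<in>Basis. std_normal_density (g \<bullet> b))"
      by (simp only: gauss_dens_def std_normal_density_def prod.distrib)
    then show ?thesis by (simp add: prod_ennreal)
  qed
  have 1: "(\<integral>\<^sup>+x. ennreal (std_normal_density x) \<partial>lborel) = 1"
    using prob_space.emeasure_space_1[OF prob_space_normal_density[of 1 0]]
    by (simp add: emeasure_density)
  show ?thesis
    unfolding eq by (subst nn_integral_lborel_prod) (auto simp: 1)
qed

lemma prob_space_std_gaussian: "prob_space (std_gaussian :: (real^'d) measure)"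
proof
  show "emeasure (std_gaussian :: (real^'d) measure) (space std_gaussian) = 1"
    using nn_integral_gauss_dens by (simp add: std_gaussian_eq emeasure_density)
qed

interpretation std_gaussian: prob_space "std_gaussian :: (real^'d) measure"
  by (rule prob_space_std_gaussian)

lemma emeasure_std_gaussian_UNIV [simp]: "emeasure (std_gaussian :: (real^'d) measure) UNIV = 1"
  using std_gaussian.emeasure_space_1[where 'd='d] by simp

lemma nn_integral_lborel_affine:
  fixes t :: "real^'d"
  assumes [measurable]: "F \<in> borel_measurable borel" and "c > 0"
  shows "(\<integral>\<^sup>+x. F x \<partial>lborel) = ennreal (c ^ CARD('d)) * (\<integral>\<^sup>+x. F (t + c *\<^sub>R x) \<partial>lborel)"
proof -
  have "lborel = density (distr lborel borel (\<lambda>x. t + c *\<^sub>R x)) (\<lambda>_. ennreal (\<bar>c\<bar> ^ DIM(real^'d)))"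
    using assms(2) by (intro lborel_affine) simp
  then have "(\<integral>\<^sup>+x. F x \<partial>lborel) =
      (\<integral>\<^sup>+x. F x \<partial>density (distr lborel borel (\<lambda>x. t + c *\<^sub>R x)) (\<lambda>_. ennreal (\<bar>c\<bar> ^ DIM(real^'d))))"
    by (rule arg_cong)
  also have "\<dots> = ennreal (c ^ CARD('d)) * (\<integral>\<^sup>+x. F (t + c *\<^sub>R x) \<partial>lborel)"
    using assms(2) by (subst nn_integral_density) (auto simp: nn_integral_distr nn_integral_cmult simp del: lborel_distr_plus)
  finally show ?thesis .
qed

text \<open>Cameron-Martin for one Gaussian vector: expanding \<open>|g - v|^2\<close> turns a
  translation by \<open>v\<close> into an exponential weight. The changes of measure below all go
  back to this identity.\<close>

lemma nn_integral_std_gaussian_shift: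
  fixes v :: "real^'d"
  assumes [measurable]: "F \<in> borel_measurable borel"
  shows "(\<integral>\<^sup>+g. F (g + v) \<partial>std_gaussian)
    = (\<integral>\<^sup>+g. ennreal (exp (v \<bullet> g - (norm v)^2 / 2)) * F g \<partial>std_gaussian)"
proof -
  have "(\<integral>\<^sup>+g. F (g + v) \<partial>std_gaussian) = (\<integral>\<^sup>+g. ennreal (gauss_dens g) * F (g + v) \<partial>lborel)"
    by (subst nn_integral_std_gaussian) auto
  also have "\<dots> = (\<integral>\<^sup>+g. ennreal (gauss_dens (g - v)) * F g \<partial>lborel)"
    by (subst nn_integral_lborel_affine[where c=1 and t="-v"]) (auto simp: algebra_simps)
  also have "\<dots> = (\<integral>\<^sup>+g. ennreal (gauss_dens g) * (ennreal (exp (v \<bullet> g - (norm v)^2 / 2)) * F g) \<partial>lborel)"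
  proof (intro nn_integral_cong)
    fix g :: "real^'d"
    have "- ((norm (g - v))\<^sup>2) / 2 = - ((norm g)^2) / 2 + (v \<bullet> g - (norm v)^2 / 2)"
      by (simp add: power2_norm_eq_inner inner_diff inner_commute field_simps)
    then have "gauss_dens (g - v) = gauss_dens g * exp (v \<bullet> g - (norm v)^2 / 2)"
      by (simp only: gauss_dens_def exp_add mult.assoc)
    then show "ennreal (gauss_dens (g - v)) * F g
        = ennreal (gauss_dens g) * (ennreal (exp (v \<bullet> g - (norm v)^2 / 2)) * F g)"
      by (simp add: ennreal_mult mult.assoc)
  qed
  also have "\<dots> = (\<integral>\<^sup>+g. ennreal (exp (v \<bullet> g - (norm v)^2 / 2)) * F g \<partial>std_gaussian)"
    by (subst nn_integral_std_gaussian) auto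
  finally show ?thesis .
qed

lemma nn_integral_std_gaussian_exp:
  fixes v :: "real^'d"
  shows "(\<integral>\<^sup>+g. ennreal (exp (v \<bullet> g)) \<partial>std_gaussian) = ennreal (exp ((norm v)^2 / 2))"
proof -
  have "1 = (\<integral>\<^sup>+g. ennreal (exp (v \<bullet> g - (norm v)^2 / 2)) \<partial>std_gaussian)"
    using nn_integral_std_gaussian_shift[of "\<lambda>_. 1" v] by simp
  then have "ennreal (exp ((norm v)^2 / 2)) =
      ennreal (exp ((norm v)^2 / 2)) * (\<integral>\<^sup>+g. ennreal (exp (v \<bullet> g - (norm v)^2 / 2)) \<partial>std_gaussian)"
    by simp
  also have "\<dots> = (\<integral>\<^sup>+g. ennreal (exp (v \<bullet> g)) \<partial>std_gaussian)"
    by (subst nn_integral_cmult[symmetric]) (auto simp: ennreal_mult[symmetric] exp_add[symmetric])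
  finally show ?thesis by simp
qed

text \<open>The substitution \<open>u = t + c g\<close> expresses a Gaussian of mean
  \<open>t\<close> and scale \<open>c\<close> by a Lebesgue density; this serves to convolve two
  Gaussians and to compare Gaussians of different scale.\<close>

lemma nn_integral_std_gaussian_scaled:
  assumes [measurable]: "F \<in> borel_measurable borel" and "c > 0"
  shows "(\<integral>\<^sup>+g. F (t + c *\<^sub>R g) \<partial>std_gaussian)
    = ennreal (inverse c ^ CARD('d)) * (\<integral>\<^sup>+u. ennreal (gauss_dens ((u - t) /\<^sub>R c)) * F u \<partial>(lborel :: (real^'d) measure))"
proof -
  have [simp]: "c \<noteq> 0" using assms(2) by simp
  have "(\<integral>\<^sup>+g. F (t + c *\<^sub>R g) \<partial>std_gaussian) = (\<integral>\<^sup>+g. ennreal (gauss_dens g) * F (t + c *\<^sub>R g) \<partial>lborel)"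
    by (subst nn_integral_std_gaussian) auto
  also have "\<dots> = ennreal (inverse c ^ CARD('d)) *
      (\<integral>\<^sup>+u. ennreal (gauss_dens (- (t /\<^sub>R c) + u /\<^sub>R c)) * F (t + c *\<^sub>R (- (t /\<^sub>R c) + u /\<^sub>R c)) \<partial>lborel)"
    using assms(2) by (subst nn_integral_lborel_affine[where c="inverse c" and t="- (t /\<^sub>R c)"]) auto
  also have "\<dots> = ennreal (inverse c ^ CARD('d)) * (\<integral>\<^sup>+u. ennreal (gauss_dens ((u - t) /\<^sub>R c)) * F u \<partial>lborel)"
    by (simp add: scaleR_diff_right scaleR_add_right)
  finally show ?thesis .
qed

text \<open>The inner integral over \<open>g\<close> is evaluated by completing the square in
  \<open>|g|^2 + |u - a g|^2 / b^2\<close>.\<close>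

lemma nn_integral_std_gaussian_add:
  fixes F :: "real^'d \<Rightarrow> ennreal"
  assumes F [measurable]: "F \<in> borel_measurable borel" and b: "b > 0"
  shows "(\<integral>\<^sup>+g. \<integral>\<^sup>+h. F (v + a *\<^sub>R g + b *\<^sub>R h) \<partial>std_gaussian \<partial>std_gaussian)
    = (\<integral>\<^sup>+g. F (v + sqrt (a^2 + b^2) *\<^sub>R g) \<partial>std_gaussian)"
proof -
  define c where "c = sqrt (a^2 + b^2)"
  have c2: "c^2 = a^2 + b^2" by (simp add: c_def)
  have c: "c > 0" using b by (simp add: c_def add_nonneg_pos)
  \<comment> \<open>Up to normalising factors this is Bayes' rule for the pair \<open>g\<close>,
    \<open>u = a g + b h\<close>: the vector \<open>u\<close> has scale \<open>c\<close>, and given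
    \<open>u\<close> the vector \<open>g\<close> is Gaussian with mean \<open>(a / c^2) u\<close>
    and scale \<open>b / c\<close>.\<close>
  have sq: "gauss_dens g * gauss_dens ((u - a *\<^sub>R g) /\<^sub>R b)
      = gauss_dens (u /\<^sub>R c) * gauss_dens ((g - (a / c^2) *\<^sub>R u) /\<^sub>R (b / c))" for g u :: "real^'d"
  proof -
    have n: "(norm (x /\<^sub>R r))^2 = (x \<bullet> x) / r^2" for x :: "real^'d" and r :: real
      unfolding power2_norm_eq_inner by (simp add: power2_eq_square divide_inverse)
    have q: "(u - r *\<^sub>R g) \<bullet> (u - r *\<^sub>R g) = u \<bullet> u - 2 * r * (u \<bullet> g) + r^2 * (g \<bullet> g)" for r and u g :: "real^'d"
      by (simp add: inner_diff inner_commute power2_eq_square algebra_simps)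
    have "(norm g)^2 + (norm ((u - a *\<^sub>R g) /\<^sub>R b))^2 =
      (norm (u /\<^sub>R c))^2 + (norm ((g - (a / c^2) *\<^sub>R u) /\<^sub>R (b / c)))^2"
    proof -
      have "(c^2 * b^2) * (g \<bullet> g + (u \<bullet> u - 2 * a * (u \<bullet> g) + a^2 * (g \<bullet> g)) / b^2)
        = (c^2 * b^2) * ((u \<bullet> u) / c^2 + (g \<bullet> g - 2 * (a / c^2) * (g \<bullet> u) + (a / c^2)^2 * (u \<bullet> u)) / (b / c)^2)"
      proof -
        have l: "(c^2 * b^2) * (g \<bullet> g + (u \<bullet> u - 2 * a * (u \<bullet> g) + a^2 * (g \<bullet> g)) / b^2)
          = c^2 * b^2 * (g \<bullet> g) + c^2 * (u \<bullet> u - 2 * a * (u \<bullet> g) + a^2 * (g \<bullet> g))"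
          using b c by (simp add: field_simps)
        have r: "(c^2 * b^2) * ((u \<bullet> u) / c^2 + (g \<bullet> g - 2 * (a / c^2) * (g \<bullet> u) + (a / c^2)^2 * (u \<bullet> u)) / (b / c)^2)
          = b^2 * (u \<bullet> u) + c^2 * c^2 * (g \<bullet> g) - 2 * a * c^2 * (g \<bullet> u) + a^2 * (u \<bullet> u)"
          using b c by (simp add: field_simps power2_eq_square)
        show ?thesis unfolding l r unfolding c2 by (simp add: inner_commute algebra_simps)
      qed
      then have "g \<bullet> g + (u \<bullet> u - 2 * a * (u \<bullet> g) + a^2 * (g \<bullet> g)) / b^2
        = (u \<bullet> u) / c^2 + (g \<bullet> g - 2 * (a / c^2) * (g \<bullet> u) + (a / c^2)^2 * (u \<bullet> u)) / (b / c)^2"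
        using b c by (subst (asm) mult_cancel_left) auto
      then show ?thesis unfolding n q by (simp add: power2_norm_eq_inner)
    qed
    then have "exp (-((norm g)^2)/2) * exp (-((norm ((u - a *\<^sub>R g) /\<^sub>R b))^2)/2)
      = exp (-((norm (u /\<^sub>R c))^2)/2) * exp (-((norm ((g - (a / c^2) *\<^sub>R u) /\<^sub>R (b / c)))^2)/2)"
      by (simp add: exp_add[symmetric] add_divide_distrib[symmetric] diff_divide_distrib[symmetric] del: norm_scaleR)
    moreover have "(k * e1) * (k * e2) = (k * e3) * (k * e4)" if "e1 * e2 = e3 * e4" for k e1 e2 e3 e4 :: real
      using that by algebra
    ultimately show ?thesis unfolding gauss_dens_def by blast
  qed
  have inner: "(\<integral>\<^sup>+g. ennreal (gauss_dens ((g - w) /\<^sub>R (b / c))) \<partial>lborel) = ennreal ((b / c) ^ CARD('d))" for w :: "real^'d"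
  proof -
    have "ennreal ((b / c) ^ CARD('d)) * 1 = ennreal ((b / c) ^ CARD('d)) * (\<integral>\<^sup>+g. 1 \<partial>(std_gaussian :: (real^'d) measure))"
      by simp
    also have "\<dots> = ennreal ((b / c) ^ CARD('d)) * (ennreal (inverse (b / c) ^ CARD('d)) * (\<integral>\<^sup>+g. ennreal (gauss_dens ((g - w) /\<^sub>R (b / c))) \<partial>lborel))"
      using nn_integral_std_gaussian_scaled[of "\<lambda>_. 1" "b / c" w] b c by simp
    also have "\<dots> = ennreal ((b / c) ^ CARD('d) * inverse (b / c) ^ CARD('d)) * (\<integral>\<^sup>+g. ennreal (gauss_dens ((g - w) /\<^sub>R (b / c))) \<partial>lborel)"
      using b c by (simp add: ennreal_mult mult.assoc)
    also have "(b / c) ^ CARD('d) * inverse (b / c) ^ CARD('d) = 1"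
      using b c by (simp add: power_mult_distrib[symmetric])
    finally show ?thesis by simp
  qed
  let ?G = "\<lambda>u. F (v + u)"
  have "(\<integral>\<^sup>+g. \<integral>\<^sup>+h. F (v + a *\<^sub>R g + b *\<^sub>R h) \<partial>std_gaussian \<partial>std_gaussian)
    = (\<integral>\<^sup>+g. ennreal (inverse b ^ CARD('d)) * (\<integral>\<^sup>+u. ennreal (gauss_dens ((u - a *\<^sub>R g) /\<^sub>R b)) * ?G u \<partial>lborel) \<partial>std_gaussian)"
    by (subst nn_integral_std_gaussian_scaled[OF _ b, symmetric]) (auto simp: add.assoc)
  also have "\<dots> = (\<integral>\<^sup>+g. \<integral>\<^sup>+u. ennreal (inverse b ^ CARD('d)) * (ennreal (gauss_dens g * gauss_dens ((u - a *\<^sub>R g) /\<^sub>R b)) * ?G u) \<partial>lborel \<partial>lborel)"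
    by (subst nn_integral_std_gaussian)
       (auto simp: nn_integral_cmult[symmetric] ennreal_mult mult_ac)
  also have "\<dots> = (\<integral>\<^sup>+u. \<integral>\<^sup>+g. ennreal (inverse b ^ CARD('d)) * (ennreal (gauss_dens g * gauss_dens ((u - a *\<^sub>R g) /\<^sub>R b)) * ?G u) \<partial>lborel \<partial>lborel)"
    by (rule lborel_pair.Fubini') measurable
  also have "\<dots> = (\<integral>\<^sup>+u. \<integral>\<^sup>+g. (ennreal (inverse b ^ CARD('d)) * ennreal (gauss_dens (u /\<^sub>R c)) * ?G u) * ennreal (gauss_dens ((g - (a / c^2) *\<^sub>R u) /\<^sub>R (b / c))) \<partial>lborel \<partial>lborel)"
    unfolding sq by (simp add: ennreal_mult mult_ac del: norm_scaleR)
  also have "\<dots> = (\<integral>\<^sup>+u. (ennreal (inverse b ^ CARD('d)) * ennreal (gauss_dens (u /\<^sub>R c)) * ?G u) * ennreal ((b / c) ^ CARD('d)) \<partial>lborel)"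
    by (intro nn_integral_cong, subst nn_integral_cmult, measurable, simp only: inner)
  also have "\<dots> = (\<integral>\<^sup>+u. ennreal (inverse c ^ CARD('d)) * (ennreal (gauss_dens (u /\<^sub>R c)) * ?G u) \<partial>lborel)"
  proof -
    have "inverse b ^ CARD('d) * (b / c) ^ CARD('d) = inverse c ^ CARD('d)"
      using b c by (simp add: power_mult_distrib[symmetric] field_simps)
    then have "ennreal (inverse b ^ CARD('d)) * ennreal ((b / c) ^ CARD('d)) = ennreal (inverse c ^ CARD('d))"
      using b c by (subst ennreal_mult[symmetric]) auto
    then show ?thesis by (intro nn_integral_cong) (metis mult.assoc mult.commute)
  qed
  also have "\<dots> = (\<integral>\<^sup>+g. ?G (c *\<^sub>R g) \<partial>std_gaussian)"
    using nn_integral_std_gaussian_scaled[of ?G c 0] c by (simp add: nn_integral_cmult)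
  finally show ?thesis by (simp add: c_def)
qed

section \<open>Gaussian mixtures and sub-Gaussian laws\<close>

text \<open>The density at \<open>g\<close> of the Gaussian with mean \<open>s x\<close> relative to
  the standard Gaussian.\<close>

definition gtilt :: "real \<Rightarrow> real^'d \<Rightarrow> real^'d \<Rightarrow> real" where
  "gtilt s x g = exp (s * (x \<bullet> g) - s^2 * (norm x)^2 / 2)"

text \<open>Density of the law of \<open>s X + N\<close>, \<open>X \<sim> P\<close>, with respect to the law of \<open>N\<close>.\<close>

definition glr :: "(real^'d) measure \<Rightarrow> real \<Rightarrow> real^'d \<Rightarrow> real" where
  "glr P s g = (\<integral>x. gtilt s x g \<partial>P)"

lemma gtilt_pos [simp]: "0 < gtilt s x g" and gtilt_nonneg [simp]: "0 \<le> gtilt s x g"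
  by (simp_all add: gtilt_def)

lemma gtilt_not_le [simp]: "\<not> gtilt s x g \<le> 0"
  using gtilt_pos[of s x g] by linarith

lemma measurable_gtilt [measurable]:
  assumes [measurable]: "f \<in> borel_measurable M" "g \<in> borel_measurable M"
  shows "(\<lambda>x. gtilt s (f x) (g x)) \<in> borel_measurable M"
  unfolding gtilt_def by measurable

text \<open>This is \<open>|g - s x|^2 >= 0\<close>. The bound does not involve \<open>x\<close>, so
  the tilt is integrable against every probability measure, and it yields the crude upper bound on
  \<open>ln p\<close> used for large steps.\<close>

lemma gtilt_le: "gtilt s x g \<le> exp ((norm g)^2 / 2)"
proof -
  have "0 \<le> (norm (g - s *\<^sub>R x))^2" by simp
  also have "\<dots> = (norm g)^2 - 2 * s * (x \<bullet> g) + s^2 * (norm x)^2"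
    unfolding power2_norm_eq_inner by (simp add: inner_diff inner_commute power2_eq_square algebra_simps)
  finally show ?thesis by (simp add: gtilt_def field_simps)
qed

locale borel_prob = prob_space P for P :: "(real^'d::finite) measure" +
  assumes sets_eq_borel [simp, measurable_cong]: "sets P = sets borel"
begin

lemma space_eq_UNIV [simp]: "space P = UNIV"
  using sets_eq_imp_space_eq[OF sets_eq_borel] by simp

lemma emeasure_UNIV [simp]: "emeasure P UNIV = 1" and measure_UNIV [simp]: "measure P UNIV = 1"
  using emeasure_space_1 prob_space by auto

lemma integrable_gtilt: "integrable P (\<lambda>x. gtilt s x g)"
proof (rule integrable_const_bound[where B="exp ((norm g)^2 / 2)"])
  show "AE x in P. norm (gtilt s x g) \<le> exp ((norm g)^2 / 2)"
    using gtilt_le[of s _ g] by (simp add: abs_of_pos)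
qed measurable

lemma nn_integral_gtilt: "(\<integral>\<^sup>+x. ennreal (gtilt s x g) \<partial>P) = ennreal (glr P s g)"
  unfolding glr_def by (intro nn_integral_eq_integral integrable_gtilt) auto

lemma glr_le: "glr P s g \<le> exp ((norm g)^2 / 2)"
proof -
  have "glr P s g \<le> (\<integral>x. exp ((norm g)^2 / 2) \<partial>P)"
    unfolding glr_def by (intro integral_mono integrable_gtilt) (auto simp: gtilt_le)
  then show ?thesis by simp
qed

lemma glr_pos: "0 < glr P s g"
proof -
  have "(\<integral>\<^sup>+x. ennreal (gtilt s x g) \<partial>P) \<noteq> 0"
  proof
    assume "(\<integral>\<^sup>+x. ennreal (gtilt s x g) \<partial>P) = 0"
    then have "AE x in P. ennreal (gtilt s x g) = 0"
      by (subst (asm) nn_integral_0_iff_AE) auto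
    then have "AE x in P. False" by (simp add: ennreal_eq_0_iff gtilt_not_le)
    then show False by simp
  qed
  then show ?thesis unfolding nn_integral_gtilt by (simp add: ennreal_eq_0_iff not_le)
qed

lemma measurable_glr [measurable]: "glr P s \<in> borel_measurable borel"
  unfolding glr_def[abs_def] by measurable

text \<open>With step size \<open>s^2\<close> an increment is \<open>s (s x + g)\<close>; shifting
  \<open>g\<close> by \<open>s x\<close> moves the drift into the weight \<open>gtilt\<close>, and
  averaging over \<open>x\<close> leaves \<open>glr\<close>. Relative to the pure noise
  \<open>s g\<close>, the increment thus has density \<open>glr\<close>.\<close>

lemma nn_integral_gaussian_mixture:
  assumes [measurable]: "H \<in> borel_measurable borel"
  shows "(\<integral>\<^sup>+x. \<integral>\<^sup>+g. H (s^2 *\<^sub>R x + s *\<^sub>R g) \<partial>std_gaussian \<partial>P)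
    = (\<integral>\<^sup>+g. ennreal (glr P s g) * H (s *\<^sub>R g) \<partial>std_gaussian)"
proof -
  interpret pair_sigma_finite P "std_gaussian :: (real^'d) measure" ..
  have "(\<integral>\<^sup>+g. H (s^2 *\<^sub>R x + s *\<^sub>R g) \<partial>std_gaussian)
      = (\<integral>\<^sup>+g. ennreal (gtilt s x g) * H (s *\<^sub>R g) \<partial>std_gaussian)" for x
    using nn_integral_std_gaussian_shift[of "\<lambda>g. H (s *\<^sub>R g)" "s *\<^sub>R x"]
    by (simp add: scaleR_add_right add.commute gtilt_def power_mult_distrib flip: power2_eq_square)
  then have "(\<integral>\<^sup>+x. \<integral>\<^sup>+g. H (s^2 *\<^sub>R x + s *\<^sub>R g) \<partial>std_gaussian \<partial>P)
      = (\<integral>\<^sup>+x. \<integral>\<^sup>+g. ennreal (gtilt s x g) * H (s *\<^sub>R g) \<partial>std_gaussian \<partial>P)"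
    by simp
  also have "\<dots> = (\<integral>\<^sup>+g. \<integral>\<^sup>+x. ennreal (gtilt s x g) * H (s *\<^sub>R g) \<partial>P \<partial>std_gaussian)"
    by (rule Fubini'[symmetric]) measurable
  also have "\<dots> = (\<integral>\<^sup>+g. ennreal (glr P s g) * H (s *\<^sub>R g) \<partial>std_gaussian)"
    by (simp add: nn_integral_multc nn_integral_gtilt)
  finally show ?thesis .
qed

lemma nn_integral_glr: "(\<integral>\<^sup>+g. ennreal (glr P s g) \<partial>std_gaussian) = 1"
proof -
  interpret pair_sigma_finite P "std_gaussian :: (real^'d) measure" ..
  have "(\<integral>\<^sup>+g. ennreal (glr P s g) \<partial>std_gaussian) = (\<integral>\<^sup>+g. \<integral>\<^sup>+x. ennreal (gtilt s x g) \<partial>P \<partial>std_gaussian)"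
    by (simp add: nn_integral_gtilt)
  also have "\<dots> = (\<integral>\<^sup>+x. \<integral>\<^sup>+g. ennreal (gtilt s x g) \<partial>std_gaussian \<partial>P)"
    by (rule Fubini') measurable
  also have "\<dots> = (\<integral>\<^sup>+x. 1 \<partial>P)"
  proof (rule nn_integral_cong)
    fix x
    show "(\<integral>\<^sup>+g. ennreal (gtilt s x g) \<partial>std_gaussian) = 1"
      using nn_integral_std_gaussian_shift[of "\<lambda>_. 1" "s *\<^sub>R x"]
      by (simp add: gtilt_def power_mult_distrib)
  qed
  finally show ?thesis by simp
qed

text \<open>Jensen's inequality, from the tangent of the exponential at the mean of
  \<open>u\<close>.\<close>

lemma exp_integral_le:
  fixes u :: "real^'d \<Rightarrow> real"
  assumes "integrable P u" "integrable P (\<lambda>x. exp (u x))"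
  shows "exp (\<integral>x. u x \<partial>P) \<le> (\<integral>x. exp (u x) \<partial>P)"
proof -
  let ?c = "\<integral>x. u x \<partial>P"
  have "exp ?c = (\<integral>x. exp ?c * (1 + (u x - ?c)) \<partial>P)"
    using assms(1) by simp
  also have "\<dots> \<le> (\<integral>x. exp (u x) \<partial>P)"
  proof (intro integral_mono assms(2))
    show "integrable P (\<lambda>x. exp ?c * (1 + (u x - ?c)))" using assms(1) by simp
    show "exp ?c * (1 + (u x - ?c)) \<le> exp (u x)" for x
    proof -
      have "1 + (u x - ?c) \<le> exp (u x - ?c)" by (rule exp_ge_add_one_self)
      then have "exp ?c * (1 + (u x - ?c)) \<le> exp ?c * exp (u x - ?c)" by (intro mult_left_mono) auto
      then show ?thesis by (simp add: exp_add[symmetric])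
    qed
  qed
  finally show ?thesis .
qed

end

section \<open>Moments of sub-Gaussian probability measures\<close>

lemma power_le_fact_exp:
  assumes "0 \<le> (r::real)"
  shows "r ^ k \<le> fact k * exp r"
proof -
  have "(\<Sum>n\<in>{k}. r ^ n /\<^sub>R fact n) \<le> (\<Sum>n. r ^ n /\<^sub>R fact n)"
    using assms summable_exp_generic[of r] by (intro sum_le_suminf) auto
  then have "r ^ k / fact k \<le> exp r" by (simp add: exp_def divide_inverse mult.commute)
  then show ?thesis by (simp add: field_simps)
qed

text \<open>Only finiteness of the exponential moment is assumed: for the posterior and for
  \<open>Q\<close>, the bound \<open>2\<close> of the theorem is available only after averaging over
  the starting point.\<close>

locale subgaussian_prob = borel_prob P for P :: "(real^'d::finite) measure" +
  fixes L :: real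
  assumes L_pos: "L > 0" and integrable_exp: "integrable P (\<lambda>x. exp ((norm x)^2 / L^2))"
begin

lemma integrable_exp_half: "integrable P (\<lambda>x. exp ((norm x)^2 / (2 * L^2)))"
proof (rule Bochner_Integration.integrable_bound[OF integrable_exp])
  show "AE x in P. norm (exp ((norm x)^2 / (2 * L^2))) \<le> norm (exp ((norm x)^2 / L^2))"
    using L_pos by (auto simp: field_simps)
qed measurable

lemma integrable_norm_power: "integrable P (\<lambda>x. norm x ^ k)"
proof (rule Bochner_Integration.integrable_bound)
  show "integrable P (\<lambda>x. 1 + L^(2*k) * fact k * exp ((norm x)^2 / L^2))"
    using integrable_exp by simp
  show "AE x in P. norm (norm x ^ k) \<le> norm (1 + L^(2*k) * fact k * exp ((norm x)^2 / L^2))"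
  proof (intro always_eventually allI)
    fix x :: "real^'d"
    \<comment> \<open>Passing from \<open>r\<close> to \<open>1 + r^2\<close> makes the exponent
      even, so that the power becomes a power of \<open>|x|^2 / L^2\<close>.\<close>
    have "norm x ^ k \<le> 1 + (norm x ^ k)^2"
      using zero_le_power2[of "norm x ^ k - 1"] by (simp add: power2_diff) (smt (verit) zero_le_power2)
    also have "(norm x ^ k)^2 = L^(2*k) * ((norm x)^2 / L^2) ^ k"
      using L_pos by (simp add: power_divide power_mult[symmetric] mult.commute)
    also have "((norm x)^2 / L^2) ^ k \<le> fact k * exp ((norm x)^2 / L^2)"
      by (rule power_le_fact_exp) simp
    finally show "norm (norm x ^ k) \<le> norm (1 + L^(2*k) * fact k * exp ((norm x)^2 / L^2))"
      using L_pos by (simp add: mult.assoc)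
  qed
qed measurable

lemma integrable_ident: "integrable P (\<lambda>x. x)"
proof (rule Bochner_Integration.integrable_bound[OF integrable_norm_power[of 1]])
  show "(\<lambda>x. x) \<in> borel_measurable P" by measurable
qed auto

lemma mean_norm_le: "(norm (\<integral>x. x \<partial>P))^2 \<le> (\<integral>x. (norm x)^2 \<partial>P)"
proof -
  let ?a = "\<integral>x. x \<partial>P"
  have "0 \<le> (\<integral>x. (norm (x - ?a))^2 \<partial>P)" by simp
  also have "\<dots> = (\<integral>x. (norm x)^2 - 2 * (x \<bullet> ?a) + ?a \<bullet> ?a \<partial>P)"
    by (simp add: power2_norm_eq_inner inner_diff inner_commute algebra_simps)
  also have "\<dots> = (\<integral>x. (norm x)^2 \<partial>P) - 2 * (?a \<bullet> ?a) + ?a \<bullet> ?a"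
    using integrable_norm_power[of 2] integrable_ident by simp
  finally show ?thesis by (simp add: power2_norm_eq_inner)
qed

text \<open>Jensen in the exponent of \<open>gtilt\<close>. What matters is that the bound is the
  exponential of an affine function of \<open>g\<close>, so dividing by it keeps Gaussian integrals
  explicit.\<close>

lemma glr_ge: "exp (s * ((\<integral>x. x \<partial>P) \<bullet> g) - s^2 * (\<integral>x. (norm x)^2 \<partial>P) / 2) \<le> glr P s g"
proof -
  have i: "integrable P (\<lambda>x. s * (x \<bullet> g) - s^2 * (norm x)^2 / 2)"
    using integrable_norm_power[of 2] integrable_ident by simp
  have "exp (\<integral>x. s * (x \<bullet> g) - s^2 * (norm x)^2 / 2 \<partial>P) \<le> glr P s g"
    unfolding glr_def gtilt_def
    by (rule exp_integral_le[OF i]) (use integrable_gtilt[of s g] in \<open>simp add: gtilt_def\<close>)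
  then show ?thesis using integrable_norm_power[of 2] integrable_ident by simp
qed

lemma exp_second_moment_le:
  "exp ((\<integral>x. (norm x)^2 \<partial>P) / (2 * L^2)) \<le> (\<integral>x. exp ((norm x)^2 / (2 * L^2)) \<partial>P)"
  using exp_integral_le[OF _ integrable_exp_half] integrable_norm_power[of 2] by simp

text \<open>The variance of \<open>exp (|x|^2 / (2 L^2))\<close> is nonnegative. This brings
  products of two half-exponent integrals back to a linear bound in the full exponential
  moments.\<close>

lemma exp_half_square_le:
  "(\<integral>x. exp ((norm x)^2 / (2 * L^2)) \<partial>P)^2 \<le> (\<integral>x. exp ((norm x)^2 / L^2) \<partial>P)"
proof -
  have eq: "(exp ((norm x)^2 / (2 * L^2)))^2 = exp ((norm x)^2 / L^2)" for x :: "real^'d"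
    by (simp add: exp_double[symmetric])
  show ?thesis
    using variance_eq[OF integrable_exp_half] integrable_exp variance_positive[of "\<lambda>x. exp ((norm x)^2 / (2 * L^2))"]
    by (simp add: eq)
qed

lemma second_moment_le: "(\<integral>x. (norm x)^2 \<partial>P) \<le> L^2 * (\<integral>x. exp ((norm x)^2 / L^2) \<partial>P)"
proof -
  have "(\<integral>x. (norm x)^2 \<partial>P) \<le> (\<integral>x. L^2 * exp ((norm x)^2 / L^2) \<partial>P)"
  proof (intro integral_mono integrable_norm_power)
    fix x :: "real^'d"
    have "(norm x)^2 / L^2 \<le> exp ((norm x)^2 / L^2)"
      using power_le_fact_exp[of "(norm x)^2 / L^2" 1] by simp
    then show "(norm x)^2 \<le> L^2 * exp ((norm x)^2 / L^2)"
      using L_pos by (simp add: field_simps)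
  qed (use integrable_exp in simp)
  then show ?thesis by simp
qed

end

section \<open>Polynomials and tilted pairings\<close>

text \<open>The span of the monomials of degree at most \<open>k\<close>, generated inductively so
  that equality of moments extends to all of it by rule induction
  (\<open>poly_le_matched\<close>).\<close>

inductive poly_le :: "nat \<Rightarrow> (real^'d \<Rightarrow> real) \<Rightarrow> bool" for k where
  poly_le_mono_pow: "(\<Sum>i\<in>UNIV. \<alpha> i) \<le> k \<Longrightarrow> poly_le k (mono_pow \<alpha>)"
| poly_le_add: "poly_le k f \<Longrightarrow> poly_le k h \<Longrightarrow> poly_le k (\<lambda>x. f x + h x)"
| poly_le_scale: "poly_le k f \<Longrightarrow> poly_le k (\<lambda>x. c * f x)"

lemma poly_le_trans: "poly_le k f \<Longrightarrow> k \<le> l \<Longrightarrow> poly_le l f"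
  by (induction rule: poly_le.induct) (auto intro: poly_le.intros)

lemma poly_le_const: "poly_le k (\<lambda>x. c)"
proof -
  have "poly_le k (\<lambda>x. c * mono_pow (\<lambda>_. 0) x)"
    by (intro poly_le.intros) auto
  then show ?thesis by (simp add: mono_pow_def)
qed

lemma poly_le_sum: "finite A \<Longrightarrow> (\<And>i. i \<in> A \<Longrightarrow> poly_le k (f i)) \<Longrightarrow> poly_le k (\<lambda>x. \<Sum>i\<in>A. f i x)"
  by (induction rule: finite_induct) (auto intro: poly_le_const poly_le_add)

lemma poly_le_mult_coord: "poly_le k f \<Longrightarrow> poly_le (Suc k) (\<lambda>x. x $ j * f x)"
proof (induction rule: poly_le.induct)
  case (poly_le_mono_pow \<alpha>)
  have "(\<lambda>x. x $ j * mono_pow \<alpha> x) = mono_pow (\<alpha>(j := Suc (\<alpha> j)))"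
    unfolding mono_pow_def by (simp add: fun_eq_iff prod.remove[of UNIV j] mult.assoc)
  moreover have "(\<Sum>i\<in>UNIV. (\<alpha>(j := Suc (\<alpha> j))) i) \<le> Suc k"
    using poly_le_mono_pow by (simp add: sum.remove[of UNIV j])
  ultimately show ?case by (simp only: poly_le.poly_le_mono_pow)
next
  case (poly_le_add f h)
  then show ?case using poly_le.poly_le_add by (fastforce simp: distrib_left)
next
  case (poly_le_scale f c)
  then have "poly_le (Suc k) (\<lambda>x. c * (x $ j * f x))" by (intro poly_le.poly_le_scale)
  then show ?case by (simp add: mult.left_commute)
qed

text \<open>For fixed \<open>y\<close>, the Taylor terms of \<open>exp (s^2 <x - a, y - a>)\<close>
  are multiples of such powers as functions of \<open>x\<close>. One factor at a time is expanded
  into coordinates, each raising the degree by one.\<close>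

lemma poly_le_affine_power: "poly_le k (\<lambda>x. ((x - a) \<bullet> b) ^ k)"
proof (induction k)
  case 0
  then show ?case by (simp add: poly_le_const)
next
  case (Suc k)
  have eq: "((x - a) \<bullet> b) ^ Suc k = (\<Sum>i\<in>UNIV. b $ i * (x $ i * ((x - a) \<bullet> b) ^ k)) + (- (a \<bullet> b)) * ((x - a) \<bullet> b) ^ k"
    for x
  proof -
    have "(x - a) \<bullet> b = (\<Sum>i\<in>UNIV. b $ i * x $ i) + (- (a \<bullet> b))"
      by (simp add: inner_diff_left) (simp add: inner_vec_def mult.commute)
    then have "((x - a) \<bullet> b) ^ Suc k = ((\<Sum>i\<in>UNIV. b $ i * x $ i) + (- (a \<bullet> b))) * ((x - a) \<bullet> b) ^ k"
      by simp
    then show ?thesis by (simp only: distrib_right sum_distrib_right mult.assoc)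
  qed
  show ?case unfolding eq
    by (intro poly_le_add poly_le_sum poly_le_scale poly_le_mult_coord Suc poly_le_trans[OF Suc]) auto
qed

lemma abs_mono_pow_le: "\<bar>mono_pow \<alpha> x\<bar> \<le> norm x ^ (\<Sum>i\<in>UNIV. \<alpha> i)"
proof -
  have "\<bar>mono_pow \<alpha> x\<bar> = (\<Prod>i\<in>UNIV. \<bar>x $ i\<bar> ^ \<alpha> i)"
    by (simp add: mono_pow_def abs_prod power_abs)
  also have "\<dots> \<le> (\<Prod>i\<in>UNIV. norm x ^ \<alpha> i)"
    by (intro prod_mono) (auto intro!: power_mono component_le_norm_cart)
  finally show ?thesis by (simp add: power_sum)
qed

lemma measurable_mono_pow [measurable]: "mono_pow \<alpha> \<in> borel_measurable borel"
  unfolding mono_pow_def[abs_def] by measurable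

lemma (in subgaussian_prob) integrable_mono_pow: "integrable P (mono_pow \<alpha>)"
proof (rule Bochner_Integration.integrable_bound[OF integrable_norm_power[of "\<Sum>i\<in>UNIV. \<alpha> i"]])
  show "AE x in P. norm (mono_pow \<alpha> x) \<le> norm (norm x ^ (\<Sum>i\<in>UNIV. \<alpha> i))"
    using abs_mono_pow_le[of \<alpha>] by simp
qed measurable

section \<open>Integrals over products of two probability measures\<close>

lemma integrable_pair_fst:
  fixes f :: "'a \<Rightarrow> real"
  assumes "prob_space N" "integrable M f"
  shows "integrable (M \<Otimes>\<^sub>M N) (\<lambda>z. f (fst z))"
  by (rule integrable_distr[of fst _ M]) (use assms in \<open>auto simp: prob_space.distr_pair_fst\<close>)

lemma integral_pair_fst:
  fixes f :: "'a \<Rightarrow> real"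
  assumes "prob_space N" "f \<in> borel_measurable M"
  shows "(\<integral>z. f (fst z) \<partial>(M \<Otimes>\<^sub>M N)) = (\<integral>x. f x \<partial>M)"
  using integral_distr[of fst "M \<Otimes>\<^sub>M N" M f] assms by (simp add: prob_space.distr_pair_fst)

lemma pair_snd_prob:
  fixes f :: "'a \<Rightarrow> real"
  assumes "prob_space M" "prob_space N" "integrable N f"
  shows "integrable (M \<Otimes>\<^sub>M N) (\<lambda>z. f (snd z))" "(\<integral>z. f (snd z) \<partial>(M \<Otimes>\<^sub>M N)) = (\<integral>x. f x \<partial>N)"
proof -
  interpret M: prob_space M by fact
  interpret N: prob_space N by fact
  interpret NM: pair_sigma_finite N M ..
  note i = integrable_pair_fst[OF assms(1,3)]
  show "integrable (M \<Otimes>\<^sub>M N) (\<lambda>z. f (snd z))"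
    using NM.integrable_product_swap[OF i] by (simp add: case_prod_unfold)
  show "(\<integral>z. f (snd z) \<partial>(M \<Otimes>\<^sub>M N)) = (\<integral>x. f x \<partial>N)"
    using NM.integral_product_swap[OF borel_measurable_integrable[OF i]] integral_pair_fst[OF assms(1), of f N] assms(3)
    by (simp add: case_prod_unfold)
qed

text \<open>Puts the Taylor polynomials of \<open>exp w\<close> under the same dominating function
  \<open>exp |w|\<close> as \<open>exp w\<close> itself.\<close>

lemma abs_exp_partial_sum_le: "\<bar>\<Sum>i\<le>m. w ^ i / fact i\<bar> \<le> exp \<bar>w\<bar>" for w :: real
proof -
  have "\<bar>\<Sum>i\<le>m. w ^ i / fact i\<bar> \<le> (\<Sum>i\<le>m. \<bar>w ^ i / fact i\<bar>)"
    by (rule sum_abs)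
  also have "\<dots> = (\<Sum>i\<le>m. \<bar>w\<bar> ^ i /\<^sub>R fact i)"
    by (simp add: power_abs abs_mult divide_inverse mult.commute)
  also have "\<dots> \<le> (\<Sum>i. \<bar>w\<bar> ^ i /\<^sub>R fact i)"
    using summable_exp_generic[of "\<bar>w\<bar>"] by (intro sum_le_suminf) auto
  finally show ?thesis by (simp add: exp_def)
qed

text \<open>Expanding \<open>(p - q)^2\<close> produces the pairs \<open>(P, P)\<close>,
  \<open>(P, Q)\<close> and \<open>(Q, Q)\<close>, which are the intended instances of
  \<open>(R, S)\<close>; the centre \<open>a\<close> will be the mean of \<open>Q\<close>.\<close>

locale tilted_pair = R: subgaussian_prob R L + S: subgaussian_prob S L
  for R S :: "(real^'d::finite) measure" and L :: real +
  fixes s :: real and a :: "real^'d"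
  assumes s_nonneg: "0 \<le> s" and small: "s^2 * L^2 \<le> 1 / 8"
begin

text \<open>The exponent that remains when two tilts, weighted by \<open>exp (- s <a, g>)\<close>,
  are integrated over \<open>g\<close>; the linear weight is what centres both points at
  \<open>a\<close> (\<open>nn_integral_gtilt_gtilt\<close>).\<close>

definition "u x y = s^2 * ((x - a) \<bullet> (y - a))"

sublocale RS: pair_sigma_finite R S ..

lemma measurable_u [measurable]:
  assumes [measurable]: "f \<in> borel_measurable M" "g \<in> borel_measurable M"
  shows "(\<lambda>x. u (f x) (g x)) \<in> borel_measurable M"
  unfolding u_def by measurable

lemma s2_le: "s^2 \<le> 1 / (8 * L^2)"
  using small R.L_pos by (simp add: field_simps)

lemma norm_diff_sq_le: "(norm (x - a))^2 \<le> 2 * (norm x)^2 + 2 * (norm a)^2"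
proof -
  have "0 \<le> (norm (x + a))^2" by simp
  then show ?thesis unfolding power2_norm_eq_inner by (simp add: inner_diff inner_add inner_commute)
qed

lemma abs_u_le: "\<bar>u x y\<bar> \<le> s^2 * (norm (x - a) * norm (y - a))"
  unfolding u_def abs_mult by (intro mult_mono Cauchy_Schwarz_ineq2) auto

lemma norm_mult_le: "norm (x - a) * norm (y - a) \<le> ((norm (x - a))^2 + (norm (y - a))^2) / 2"
  using sum_squares_bound[of "norm (x - a)" "norm (y - a)"] by simp

text \<open>Cauchy-Schwarz and AM-GM split \<open>|u|\<close> into a part for \<open>x\<close> and a
  part for \<open>y\<close>; the product of the two exponentials is then bounded by the sum of their
  squares. A sum needs only the exponential moment of each marginal.\<close>

lemma exp_abs_u_le:
  "exp \<bar>u x y\<bar> \<le> exp (2 * s^2 * (norm a)^2) * (exp ((norm x)^2 / L^2) + exp ((norm y)^2 / L^2))"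
proof -
  have "\<bar>u x y\<bar> \<le> s^2 * ((norm x)^2 + (norm y)^2 + 2 * (norm a)^2)"
    using norm_mult_le[of x y] norm_diff_sq_le[of x] norm_diff_sq_le[of y]
    by (intro order_trans[OF abs_u_le] mult_left_mono) auto
  then have "exp \<bar>u x y\<bar> \<le> exp (s^2 * ((norm x)^2 + (norm y)^2 + 2 * (norm a)^2))" by simp
  also have "\<dots> = exp (2 * s^2 * (norm a)^2) * (exp (s^2 * (norm x)^2) * exp (s^2 * (norm y)^2))"
    by (simp add: exp_add[symmetric] algebra_simps)
  also have "exp (s^2 * (norm x)^2) * exp (s^2 * (norm y)^2) \<le> exp ((norm x)^2 / L^2) + exp ((norm y)^2 / L^2)"
  proof -
    have *: "exp (s^2 * (norm z)^2)^2 \<le> exp ((norm z)^2 / L^2)" for z :: "real^'d"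
    proof -
      have "2 * (s^2 * (norm z)^2) \<le> 2 * (1 / (8 * L^2) * (norm z)^2)"
        by (intro mult_left_mono mult_right_mono s2_le) auto
      also have "\<dots> \<le> (norm z)^2 / L^2" using R.L_pos by (simp add: field_simps)
      finally show ?thesis by (simp add: exp_double[symmetric])
    qed
    have "exp (s^2 * (norm x)^2) * exp (s^2 * (norm y)^2) \<le> exp (s^2 * (norm x)^2)^2 + exp (s^2 * (norm y)^2)^2"
      using sum_squares_bound[of "exp (s^2 * (norm x)^2)" "exp (s^2 * (norm y)^2)"]
        zero_le_power2[of "exp (s^2 * (norm x)^2)"] zero_le_power2[of "exp (s^2 * (norm y)^2)"] by linarith
    also note add_mono[OF * *]
    finally show ?thesis .
  qed
  finally show ?thesis by simp
qed

lemma integrable_dominated: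
  fixes f :: "(real^'d) \<times> (real^'d) \<Rightarrow> real"
  assumes [measurable]: "f \<in> borel_measurable (borel \<Otimes>\<^sub>M borel)"
    and le: "\<And>x y. \<bar>f (x, y)\<bar> \<le> exp \<bar>u x y\<bar>"
  shows "integrable (R \<Otimes>\<^sub>M S) f"
proof (rule Bochner_Integration.integrable_bound)
  show "integrable (R \<Otimes>\<^sub>M S) (\<lambda>z. exp (2 * s^2 * (norm a)^2) * (exp ((norm (fst z))^2 / L^2) + exp ((norm (snd z))^2 / L^2)))"
    using integrable_pair_fst[OF S.prob_space_axioms R.integrable_exp]
      pair_snd_prob(1)[OF R.prob_space_axioms S.prob_space_axioms S.integrable_exp] by simp
  show "AE z in R \<Otimes>\<^sub>M S. norm (f z) \<le> norm (exp (2 * s^2 * (norm a)^2) * (exp ((norm (fst z))^2 / L^2) + exp ((norm (snd z))^2 / L^2)))"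
    using order_trans[OF le exp_abs_u_le] by (auto simp: abs_mult)
qed measurable

definition "taylor_rem m w = exp w - (\<Sum>i\<le>m. w ^ i / fact i)" for w :: real

definition "rem_bound m = (s * L) ^ (2 * (m + 1)) * fact (m + 1) * 8 ^ (m + 1) * exp ((norm a)^2 / (2 * L^2))"

text \<open>The Lagrange form gives \<open>|u|^(m+1) exp |u|\<close>, which is bounded by
  \<open>s^(2(m+1)) h(x) h(y)\<close> with separate variables. Replacing the product by half the sum
  of squares leaves half exponents in single variables.\<close>

lemma taylor_rem_le:
  "\<bar>taylor_rem m (u x y)\<bar> \<le> rem_bound m * ((exp ((norm x)^2 / (2 * L^2)) + exp ((norm y)^2 / (2 * L^2))) / 2)"
proof -
  let ?h = "\<lambda>x. norm (x - a) ^ (m + 1) * exp (s^2 * (norm (x - a))^2 / 2)"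
  \<comment> \<open>The power of \<open>|x - a|^2\<close> is traded for
    \<open>8^(m+1) (m+1)! exp (|x - a|^2 / (8 L^2))\<close>. The factor with \<open>s^2\<close>
    costs the same exponent again, because \<open>s^2 L^2 <= 1/8\<close>. Together this is
    \<open>|x - a|^2 / (4 L^2)\<close>, and \<open>|x - a|^2 <= 2 |x|^2 + 2 |a|^2\<close> doubles it
    to the half exponent.\<close>
  have h2: "(?h x)^2 \<le> L ^ (2 * (m + 1)) * fact (m + 1) * 8 ^ (m + 1) * exp ((norm a)^2 / (2 * L^2)) * exp ((norm x)^2 / (2 * L^2))"
    for x
  proof -
    let ?r = "(norm (x - a))^2 / (8 * L^2)"
    have "(?h x)^2 = ((norm (x - a))^2) ^ (m + 1) * exp (s^2 * (norm (x - a))^2)"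
      by (simp add: power_mult_distrib exp_double[symmetric] power_mult[symmetric] mult.commute)
    also have "\<dots> \<le> (L ^ (2 * (m + 1)) * 8 ^ (m + 1) * (fact (m + 1) * exp ?r)) * exp ?r"
    proof (intro mult_mono)
      have "((norm (x - a))^2) ^ (m + 1) = L ^ (2 * (m + 1)) * 8 ^ (m + 1) * ?r ^ (m + 1)"
        using R.L_pos by (simp only: power_mult power_mult_distrib[symmetric]) simp
      also have "\<dots> \<le> L ^ (2 * (m + 1)) * 8 ^ (m + 1) * (fact (m + 1) * exp ?r)"
        using R.L_pos by (intro mult_left_mono power_le_fact_exp) auto
      finally show "((norm (x - a))^2) ^ (m + 1) \<le> \<dots>" .
      have "s^2 * (norm (x - a))^2 \<le> 1 / (8 * L^2) * (norm (x - a))^2"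
        by (intro mult_right_mono s2_le) simp
      then show "exp (s^2 * (norm (x - a))^2) \<le> exp ?r" by simp
    qed (use R.L_pos in auto)
    also have "\<dots> = L ^ (2 * (m + 1)) * fact (m + 1) * 8 ^ (m + 1) * exp ((norm (x - a))^2 / (4 * L^2))"
    proof -
      have "exp ?r * exp ?r = exp ((norm (x - a))^2 / (4 * L^2))" by (simp add: exp_add[symmetric])
      then show ?thesis by (simp only: mult_ac)
    qed
    also have "\<dots> \<le> L ^ (2 * (m + 1)) * fact (m + 1) * 8 ^ (m + 1) * exp ((norm a)^2 / (2 * L^2) + (norm x)^2 / (2 * L^2))"
    proof -
      have "(norm (x - a))^2 / (4 * L^2) \<le> (2 * (norm x)^2 + 2 * (norm a)^2) / (4 * L^2)"
        using norm_diff_sq_le R.L_pos by (intro divide_right_mono) auto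
      also have "\<dots> = (norm a)^2 / (2 * L^2) + (norm x)^2 / (2 * L^2)"
        using R.L_pos by (simp add: field_simps)
      finally show ?thesis using R.L_pos by (intro mult_left_mono) auto
    qed
    finally show ?thesis by (simp only: exp_add mult.assoc)
  qed
  have arrange: "c * ((l * f * e * n * v + l * f * e * n * w) / 2) = c * l * f * e * n * ((v + w) / 2)"
    for c l f e n v w :: real by (simp add: algebra_simps)
  have amgm: "v * w \<le> (v^2 + w^2) / 2" for v w :: real
    using sum_squares_bound[of v w] by simp
  have "\<bar>taylor_rem m (u x y)\<bar> \<le> exp \<bar>u x y\<bar> * \<bar>u x y\<bar> ^ Suc m / fact m"
    using Taylor_exp_field[of "u x y" m] by (simp add: taylor_rem_def)
  also have "\<dots> \<le> exp \<bar>u x y\<bar> * \<bar>u x y\<bar> ^ Suc m / 1"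
    by (intro divide_left_mono) (auto simp: fact_ge_1)
  \<comment> \<open>Two bounds for the same \<open>|u|\<close>: AM-GM in the exponent, where a sum
    separates the variables, and Cauchy-Schwarz in the power, where a product does.\<close>
  also have "\<dots> \<le> exp (s^2 * (((norm (x - a))^2 + (norm (y - a))^2) / 2)) * (s^2 * (norm (x - a) * norm (y - a))) ^ Suc m"
    using order_trans[OF abs_u_le[of x y] mult_left_mono[OF norm_mult_le[of x y], of "s^2"]] abs_u_le[of x y]
    by (simp only: div_by_1) (intro mult_mono power_mono, auto)
  also have "\<dots> = s ^ (2 * (m + 1)) * (?h x * ?h y)"
  proof -
    have "exp (s^2 * (((norm (x - a))^2 + (norm (y - a))^2) / 2)) = exp (s^2 * (norm (x - a))^2 / 2) * exp (s^2 * (norm (y - a))^2 / 2)"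
      by (simp add: exp_add[symmetric] add_divide_distrib distrib_left)
    moreover have "(s^2 * (norm (x - a) * norm (y - a))) ^ Suc m = s ^ (2 * (m + 1)) * (norm (x - a) ^ (m + 1) * norm (y - a) ^ (m + 1))"
      by (simp only: power_mult_distrib power_mult Suc_eq_plus1)
    ultimately show ?thesis by (simp only: mult_ac)
  qed
  also have "\<dots> \<le> s ^ (2 * (m + 1)) * (((?h x)^2 + (?h y)^2) / 2)"
    by (intro mult_left_mono zero_le_power s_nonneg amgm)
  also have "\<dots> \<le> s ^ (2 * (m + 1)) * ((L ^ (2 * (m + 1)) * fact (m + 1) * 8 ^ (m + 1) * exp ((norm a)^2 / (2 * L^2)) * exp ((norm x)^2 / (2 * L^2))
      + L ^ (2 * (m + 1)) * fact (m + 1) * 8 ^ (m + 1) * exp ((norm a)^2 / (2 * L^2)) * exp ((norm y)^2 / (2 * L^2))) / 2)"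
    by (intro mult_left_mono divide_right_mono add_mono h2 zero_le_power s_nonneg) auto
  also have "\<dots> = rem_bound m * ((exp ((norm x)^2 / (2 * L^2)) + exp ((norm y)^2 / (2 * L^2))) / 2)"
    unfolding rem_bound_def power_mult_distrib[of s L] by (rule arrange)
  finally show ?thesis .
qed

lemma integrable_taylor_poly: "integrable (R \<Otimes>\<^sub>M S) (\<lambda>z. \<Sum>i\<le>m. u (fst z) (snd z) ^ i / fact i)"
  by (rule integrable_dominated) (auto simp: abs_exp_partial_sum_le)

lemma integrable_exp_u: "integrable (R \<Otimes>\<^sub>M S) (\<lambda>z. exp (u (fst z) (snd z)))"
  by (rule integrable_dominated) auto

lemma integral_taylor_rem_le:
  "\<bar>(\<integral>z. taylor_rem m (u (fst z) (snd z)) \<partial>(R \<Otimes>\<^sub>M S))\<bar>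
    \<le> rem_bound m * (((\<integral>x. exp ((norm x)^2 / (2 * L^2)) \<partial>R) + (\<integral>x. exp ((norm x)^2 / (2 * L^2)) \<partial>S)) / 2)"
proof -
  note i = integrable_pair_fst[OF S.prob_space_axioms R.integrable_exp_half]
    pair_snd_prob[OF R.prob_space_axioms S.prob_space_axioms S.integrable_exp_half]
    integral_pair_fst[OF S.prob_space_axioms borel_measurable_integrable[OF R.integrable_exp_half]]
  have t: "integrable (R \<Otimes>\<^sub>M S) (\<lambda>z. taylor_rem m (u (fst z) (snd z)))"
    unfolding taylor_rem_def by (intro Bochner_Integration.integrable_diff integrable_taylor_poly integrable_exp_u)
  have "\<bar>(\<integral>z. taylor_rem m (u (fst z) (snd z)) \<partial>(R \<Otimes>\<^sub>M S))\<bar> \<le> (\<integral>z. \<bar>taylor_rem m (u (fst z) (snd z))\<bar> \<partial>(R \<Otimes>\<^sub>M S))"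
    by (rule integral_abs_bound)
  also have "\<dots> \<le> (\<integral>z. rem_bound m * ((exp ((norm (fst z))^2 / (2 * L^2)) + exp ((norm (snd z))^2 / (2 * L^2))) / 2) \<partial>(R \<Otimes>\<^sub>M S))"
    using i t by (intro integral_mono taylor_rem_le integrable_abs) auto
  also have "\<dots> = rem_bound m * (((\<integral>x. exp ((norm x)^2 / (2 * L^2)) \<partial>R) + (\<integral>x. exp ((norm x)^2 / (2 * L^2)) \<partial>S)) / 2)"
    using i by simp
  finally show ?thesis .
qed

text \<open>The exponent is affine in \<open>g\<close> with slope \<open>s (x + y - a)\<close>, so
  the Gaussian moment generating function applies. The squares of \<open>x\<close> and
  \<open>y\<close> cancel against the tilts, leaving the cross term \<open>u\<close> and a constant
  in \<open>a\<close>.\<close>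

lemma nn_integral_gtilt_gtilt:
  "(\<integral>\<^sup>+g. ennreal (gtilt s x g * gtilt s y g * exp (- s * (a \<bullet> g))) \<partial>std_gaussian)
    = ennreal (exp (- (s^2) * (norm a)^2 / 2) * exp (u x y))"
proof -
  have "gtilt s x g * gtilt s y g * exp (- s * (a \<bullet> g))
      = exp (- (s^2) * ((norm x)^2 + (norm y)^2) / 2) * exp ((s *\<^sub>R (x + y - a)) \<bullet> g)" for g
    unfolding gtilt_def by (simp add: exp_add[symmetric] inner_add inner_diff algebra_simps add_divide_distrib diff_divide_distrib)
  then have "(\<integral>\<^sup>+g. ennreal (gtilt s x g * gtilt s y g * exp (- s * (a \<bullet> g))) \<partial>std_gaussian)
      = (\<integral>\<^sup>+g. ennreal (exp (- (s^2) * ((norm x)^2 + (norm y)^2) / 2)) * ennreal (exp ((s *\<^sub>R (x + y - a)) \<bullet> g)) \<partial>std_gaussian)"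
    by (simp only: ennreal_mult exp_ge_zero)
  also have "\<dots> = ennreal (exp (- (s^2) * ((norm x)^2 + (norm y)^2) / 2)) * ennreal (exp ((norm (s *\<^sub>R (x + y - a)))^2 / 2))"
    by (subst nn_integral_cmult, measurable) (simp only: nn_integral_std_gaussian_exp)
  also have "\<dots> = ennreal (exp (- (s^2) * ((norm x)^2 + (norm y)^2) / 2 + (norm (s *\<^sub>R (x + y - a)))^2 / 2))"
    by (simp only: ennreal_mult[symmetric] exp_ge_zero exp_add)
  also have "- (s^2) * ((norm x)^2 + (norm y)^2) / 2 + (norm (s *\<^sub>R (x + y - a)))^2 / 2 = - (s^2) * (norm a)^2 / 2 + u x y"
    unfolding power2_norm_eq_inner u_def
    by (simp add: inner_add inner_diff inner_commute power2_eq_square algebra_simps add_divide_distrib diff_divide_distrib)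
  finally show ?thesis by (simp only: exp_add)
qed

text \<open>Writing both \<open>glr\<close> factors as integrals gives a nonnegative triple
  integral, in which the Gaussian variable may be integrated first.\<close>

lemma has_integral_glr_glr:
  "has_bochner_integral std_gaussian (\<lambda>g. glr R s g * glr S s g * exp (- s * (a \<bullet> g)))
    (exp (- (s^2) * (norm a)^2 / 2) * (\<integral>z. exp (u (fst z) (snd z)) \<partial>(R \<Otimes>\<^sub>M S)))"
proof (rule has_bochner_integral_nn_integral)
  interpret G: pair_sigma_finite "R \<Otimes>\<^sub>M S" "std_gaussian :: (real^'d) measure"
    using prob_space_pair[OF R.prob_space_axioms S.prob_space_axioms]
    by (intro pair_sigma_finite.intro prob_space_imp_sigma_finite prob_space_std_gaussian)
  have "ennreal (glr R s g * glr S s g * exp (- s * (a \<bullet> g)))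
      = (\<integral>\<^sup>+z. ennreal (gtilt s (fst z) g * gtilt s (snd z) g * exp (- s * (a \<bullet> g))) \<partial>(R \<Otimes>\<^sub>M S))" for g
  proof -
    have "(\<integral>\<^sup>+z. ennreal (gtilt s (fst z) g * gtilt s (snd z) g * exp (- s * (a \<bullet> g))) \<partial>(R \<Otimes>\<^sub>M S))
      = (\<integral>\<^sup>+x. \<integral>\<^sup>+y. ennreal (gtilt s x g) * ennreal (gtilt s y g) * ennreal (exp (- s * (a \<bullet> g))) \<partial>S \<partial>R)"
      by (subst S.nn_integral_fst[symmetric]) (auto simp: ennreal_mult)
    also have "\<dots> = ennreal (glr R s g) * ennreal (glr S s g) * ennreal (exp (- s * (a \<bullet> g)))"
      by (simp add: nn_integral_multc nn_integral_cmult S.nn_integral_gtilt R.nn_integral_gtilt)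
    also have "\<dots> = ennreal (glr R s g * glr S s g * exp (- s * (a \<bullet> g)))"
      using R.glr_pos[of s g] S.glr_pos[of s g] by (simp add: ennreal_mult)
    finally show ?thesis by simp
  qed
  then have "(\<integral>\<^sup>+g. ennreal (glr R s g * glr S s g * exp (- s * (a \<bullet> g))) \<partial>std_gaussian)
     = (\<integral>\<^sup>+g. \<integral>\<^sup>+z. ennreal (gtilt s (fst z) g * gtilt s (snd z) g * exp (- s * (a \<bullet> g))) \<partial>(R \<Otimes>\<^sub>M S) \<partial>std_gaussian)"
    by simp
  also have "\<dots> = (\<integral>\<^sup>+z. \<integral>\<^sup>+g. ennreal (gtilt s (fst z) g * gtilt s (snd z) g * exp (- s * (a \<bullet> g))) \<partial>std_gaussian \<partial>(R \<Otimes>\<^sub>M S))"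
    by (rule G.Fubini') measurable
  also have "\<dots> = (\<integral>\<^sup>+z. ennreal (exp (- (s^2) * (norm a)^2 / 2) * exp (u (fst z) (snd z))) \<partial>(R \<Otimes>\<^sub>M S))"
    by (simp only: nn_integral_gtilt_gtilt)
  also have "\<dots> = ennreal (\<integral>z. exp (- (s^2) * (norm a)^2 / 2) * exp (u (fst z) (snd z)) \<partial>(R \<Otimes>\<^sub>M S))"
    using integrable_exp_u by (intro nn_integral_eq_integral) auto
  finally show "(\<integral>\<^sup>+g. ennreal (glr R s g * glr S s g * exp (- s * (a \<bullet> g))) \<partial>std_gaussian)
    = ennreal (exp (- (s^2) * (norm a)^2 / 2) * (\<integral>z. exp (u (fst z) (snd z)) \<partial>(R \<Otimes>\<^sub>M S)))"
    by simp
qed (use R.glr_pos S.glr_pos in \<open>auto intro!: AE_I2 mult_nonneg_nonneg less_imp_le\<close>)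

end

section \<open>Divergence of one transition\<close>

text \<open>The terms \<open>- p + q\<close> make the integrand nonnegative pointwise and cancel
  when both densities have integral \<open>1\<close>. Divergences can thus be estimated as extended
  nonnegative integrals before integrability is known.\<close>

definition kl_fun :: "real \<Rightarrow> real \<Rightarrow> real" where
  "kl_fun p q = p * ln (p / q) - p + q"

lemma kl_fun_nonneg:
  assumes "p > 0" "q > 0"
  shows "0 \<le> kl_fun p q"
proof -
  have "ln (q / p) \<le> q / p - 1" using assms by (intro ln_le_minus_one) auto
  then have "p * ln (q / p) \<le> p * (q / p - 1)" using assms by (intro mult_left_mono) auto
  also have "p * (q / p - 1) = q - p" using assms by (simp add: field_simps)
  finally show ?thesis using assms by (simp add: kl_fun_def ln_div right_diff_distrib)
qed

text \<open>The pointwise form of the bound of the divergence by the chi-square divergence, from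
  \<open>ln r <= r - 1\<close> at \<open>r = p / q\<close>.\<close>

lemma kl_fun_le_chi2:
  assumes "p > 0" "q > 0"
  shows "kl_fun p q \<le> (p - q)^2 / q"
proof -
  have "ln (p / q) \<le> p / q - 1" using assms by (intro ln_le_minus_one) auto
  then have "p * ln (p / q) \<le> p * (p / q - 1)" using assms by (intro mult_left_mono) auto
  also have "\<dots> - p + q = (p - q)^2 / q" using assms by (simp add: field_simps power2_eq_square)
  finally show ?thesis unfolding kl_fun_def by linarith
qed

lemma measurable_kl_fun [measurable]:
  assumes [measurable]: "f \<in> borel_measurable M" "g \<in> borel_measurable M"
  shows "(\<lambda>x. kl_fun (f x) (g x)) \<in> borel_measurable M"
  unfolding kl_fun_def by measurable

locale matched_pair = P: subgaussian_prob P L + Q: subgaussian_prob Q L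
  for P Q :: "(real^'d::finite) measure" and L :: real +
  fixes s :: real and m :: nat
  assumes s_pos: "0 < s"
    and matched: "\<And>\<alpha>. (\<Sum>i\<in>UNIV. \<alpha> i) \<le> m \<Longrightarrow> (\<integral>x. mono_pow \<alpha> x \<partial>P) = (\<integral>x. mono_pow \<alpha> x \<partial>Q)"
begin

definition "expP = (\<integral>x. exp ((norm x)^2 / L^2) \<partial>P)"
definition "expQ = (\<integral>x. exp ((norm x)^2 / L^2) \<partial>Q)"
definition "BP = (\<integral>x. exp ((norm x)^2 / (2 * L^2)) \<partial>P)"
definition "BQ = (\<integral>x. exp ((norm x)^2 / (2 * L^2)) \<partial>Q)"
definition "meanQ = (\<integral>x. x \<partial>Q)"
definition "momQ = (\<integral>x. (norm x)^2 \<partial>Q)"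

lemma poly_le_matched:
  "poly_le m f \<Longrightarrow> integrable P f \<and> integrable Q f \<and> (\<integral>x. f x \<partial>P) = (\<integral>x. f x \<partial>Q)"
  by (induction rule: poly_le.induct) (auto simp: matched P.integrable_mono_pow Q.integrable_mono_pow)

lemma expP_ge_1: "1 \<le> expP" and expQ_ge_1: "1 \<le> expQ"
proof -
  have "(\<integral>x. 1 \<partial>P) \<le> expP" unfolding expP_def
    by (intro integral_mono P.integrable_exp) auto
  then show "1 \<le> expP" by simp
  have "(\<integral>x. 1 \<partial>Q) \<le> expQ" unfolding expQ_def
    by (intro integral_mono Q.integrable_exp) auto
  then show "1 \<le> expQ" by simp
qed

section \<open>Small steps: the weighted chi-square bound\<close>

context
  assumes small: "s^2 * L^2 \<le> 1 / 8"
begin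

interpretation PP: tilted_pair P P L s meanQ
  using s_pos small by unfold_locales auto
interpretation PQ: tilted_pair P Q L s meanQ
  using s_pos small by unfold_locales auto
interpretation QQ: tilted_pair Q Q L s meanQ
  using s_pos small by unfold_locales auto

text \<open>The square expands into three double integrals with signs \<open>1, -2, 1\<close>.
  Moment matching, used in one variable at a time, makes their Taylor parts equal, so these cancel
  and only the three remainders are left.\<close>

lemma chi2_numerator_le:
  "has_bochner_integral std_gaussian (\<lambda>g. (glr P s g - glr Q s g)^2 * exp (- s * (meanQ \<bullet> g)))
    (\<integral>g. (glr P s g - glr Q s g)^2 * exp (- s * (meanQ \<bullet> g)) \<partial>std_gaussian)"
  "(\<integral>g. (glr P s g - glr Q s g)^2 * exp (- s * (meanQ \<bullet> g)) \<partial>std_gaussian)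
    \<le> exp (- (s^2) * (norm meanQ)^2 / 2) * (2 * PP.rem_bound m * (BP + BQ))"
proof -
  \<comment> \<open>\<open>u\<close>, \<open>taylor_rem\<close> and \<open>rem_bound\<close> do not
    depend on the two measures, so the three interpretations share them and the prefix
    \<open>PP.\<close> stands for all.\<close>
  let ?u = "PP.u" and ?p = "\<lambda>z. \<Sum>i\<le>m. PP.u (fst z) (snd z) ^ i / fact i"
  let ?r = "\<lambda>z. PP.taylor_rem m (PP.u (fst z) (snd z))"
  let ?e = "exp (- (s^2) * (norm meanQ)^2 / 2)"
  have poly: "integrable P (\<lambda>x. \<Sum>i\<le>m. PP.u x y ^ i / fact i) \<and> integrable Q (\<lambda>x. \<Sum>i\<le>m. PP.u x y ^ i / fact i)
     \<and> (\<integral>x. (\<Sum>i\<le>m. PP.u x y ^ i / fact i) \<partial>P) = (\<integral>x. (\<Sum>i\<le>m. PP.u x y ^ i / fact i) \<partial>Q)" for y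
  proof (rule poly_le_matched)
    have "poly_le m (\<lambda>x. \<Sum>i\<le>m. (s^2) ^ i / fact i * ((x - meanQ) \<bullet> (y - meanQ)) ^ i)"
      by (intro poly_le_sum poly_le_scale poly_le_trans[OF poly_le_affine_power]) auto
    then show "poly_le m (\<lambda>x. \<Sum>i\<le>m. PP.u x y ^ i / fact i)"
      by (simp add: PP.u_def power_mult_distrib)
  qed
  have sym: "(\<integral>x. ?p (x, y) \<partial>M) = (\<integral>x. ?p (y, x) \<partial>M)" for y M
    by (simp add: PP.u_def inner_commute)
  have poly1: "(\<integral>x. ?p (x, y) \<partial>P) = (\<integral>x. ?p (x, y) \<partial>Q)" for y
    using poly[of y] by simp
  \<comment> \<open>The second variable is changed here, by the symmetry of \<open>u\<close>; the
    first variable is changed in \<open>PQ_QQ\<close>, after exchanging the integrals.\<close>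
  have PQ_PP: "integral\<^sup>L (P \<Otimes>\<^sub>M Q) ?p = integral\<^sup>L (P \<Otimes>\<^sub>M P) ?p"
  proof -
    have "integral\<^sup>L (P \<Otimes>\<^sub>M Q) ?p = (\<integral>x. (\<integral>y. ?p (x, y) \<partial>Q) \<partial>P)"
      using PQ.integrable_taylor_poly[of m] by (rule PQ.RS.integral_fst'[symmetric])
    also have "\<dots> = (\<integral>x. (\<integral>y. ?p (x, y) \<partial>P) \<partial>P)"
      by (intro Bochner_Integration.integral_cong refl trans[OF trans[OF sym[symmetric] poly1[symmetric]] sym])
    also have "\<dots> = integral\<^sup>L (P \<Otimes>\<^sub>M P) ?p"
      using PP.integrable_taylor_poly[of m] by (rule PP.RS.integral_fst')
    finally show ?thesis .
  qed
  have PQ_QQ: "integral\<^sup>L (P \<Otimes>\<^sub>M Q) ?p = integral\<^sup>L (Q \<Otimes>\<^sub>M Q) ?p"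
  proof -
    have "integral\<^sup>L (P \<Otimes>\<^sub>M Q) ?p = (\<integral>x. (\<integral>y. ?p (x, y) \<partial>Q) \<partial>P)"
      using PQ.integrable_taylor_poly[of m] by (rule PQ.RS.integral_fst'[symmetric])
    also have "\<dots> = (\<integral>y. (\<integral>x. ?p (x, y) \<partial>P) \<partial>Q)"
      using PQ.integrable_taylor_poly[of m]
      by (intro PQ.RS.Fubini_integral[symmetric]) (simp add: case_prod_unfold)
    also have "\<dots> = (\<integral>y. (\<integral>x. ?p (y, x) \<partial>Q) \<partial>Q)"
      by (intro Bochner_Integration.integral_cong refl trans[OF poly1 sym])
    also have "\<dots> = integral\<^sup>L (Q \<Otimes>\<^sub>M Q) ?p"
      using QQ.integrable_taylor_poly[of m] by (rule QQ.RS.integral_fst')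
    finally show ?thesis .
  qed
  \<comment> \<open>The absolute bounds add up to \<open>k v + (k v + k w) + k w\<close>, the middle
    one counted twice for its factor \<open>2\<close>.\<close>
  have arrange: "x - 2 * y + z \<le> 2 * k * (v + w)"
    if "\<bar>x\<bar> \<le> k * ((v + v) / 2)" "\<bar>y\<bar> \<le> k * ((v + w) / 2)" "\<bar>z\<bar> \<le> k * ((w + w) / 2)" for x y z k v w :: real
  proof -
    have "k * ((v + v) / 2) = k * v" "k * ((v + w) / 2) = (k * v + k * w) / 2" "k * ((w + w) / 2) = k * w"
      "2 * k * (v + w) = 2 * (k * v) + 2 * (k * w)"
      by (simp_all add: algebra_simps)
    then show ?thesis using that by linarith
  qed
  have split: "(\<integral>z. exp (PP.u (fst z) (snd z)) \<partial>M) = integral\<^sup>L M ?p + integral\<^sup>L M ?r"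
    if "integrable M (\<lambda>z. exp (PP.u (fst z) (snd z)))" "integrable M ?p" for M
    using that by (simp add: PP.taylor_rem_def)
  note sPP = split[OF PP.integrable_exp_u PP.integrable_taylor_poly]
  note sPQ = split[OF PQ.integrable_exp_u PQ.integrable_taylor_poly[of m]]
  note sQQ = split[OF QQ.integrable_exp_u QQ.integrable_taylor_poly[of m]]
  have eq: "(glr P s g - glr Q s g)^2 * exp (- s * (meanQ \<bullet> g))
     = glr P s g * glr P s g * exp (- s * (meanQ \<bullet> g)) - 2 * (glr P s g * glr Q s g * exp (- s * (meanQ \<bullet> g)))
       + glr Q s g * glr Q s g * exp (- s * (meanQ \<bullet> g))" for g
    by (simp add: power2_eq_square algebra_simps)
  have hb: "has_bochner_integral std_gaussian (\<lambda>g. (glr P s g - glr Q s g)^2 * exp (- s * (meanQ \<bullet> g)))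
    (?e * integral\<^sup>L (P \<Otimes>\<^sub>M P) (\<lambda>z. exp (PP.u (fst z) (snd z))) - 2 * (?e * integral\<^sup>L (P \<Otimes>\<^sub>M Q) (\<lambda>z. exp (PP.u (fst z) (snd z))))
     + ?e * integral\<^sup>L (Q \<Otimes>\<^sub>M Q) (\<lambda>z. exp (PP.u (fst z) (snd z))))"
    unfolding eq
    by (intro has_bochner_integral_add has_bochner_integral_diff has_bochner_integral_mult_right
        PP.has_integral_glr_glr PQ.has_integral_glr_glr QQ.has_integral_glr_glr)
  show "has_bochner_integral std_gaussian (\<lambda>g. (glr P s g - glr Q s g)^2 * exp (- s * (meanQ \<bullet> g)))
    (\<integral>g. (glr P s g - glr Q s g)^2 * exp (- s * (meanQ \<bullet> g)) \<partial>std_gaussian)"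
    by (rule has_bochner_integral_integrable) (rule integrable.intros[OF hb])
  have "(\<integral>g. (glr P s g - glr Q s g)^2 * exp (- s * (meanQ \<bullet> g)) \<partial>std_gaussian)
    = ?e * (integral\<^sup>L (P \<Otimes>\<^sub>M P) ?r - 2 * integral\<^sup>L (P \<Otimes>\<^sub>M Q) ?r + integral\<^sup>L (Q \<Otimes>\<^sub>M Q) ?r)"
    unfolding has_bochner_integral_integral_eq[OF hb] sPP sPQ sQQ PQ_PP[symmetric] PQ_QQ[symmetric]
    by (simp add: algebra_simps)
  also have "\<dots> \<le> ?e * (2 * PP.rem_bound m * (BP + BQ))"
  proof (intro mult_left_mono)
    have "\<bar>integral\<^sup>L (P \<Otimes>\<^sub>M P) ?r\<bar> \<le> PP.rem_bound m * ((BP + BP) / 2)"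
      using PP.integral_taylor_rem_le[of m] by (simp add: BP_def)
    moreover have "\<bar>integral\<^sup>L (P \<Otimes>\<^sub>M Q) ?r\<bar> \<le> PP.rem_bound m * ((BP + BQ) / 2)"
      using PQ.integral_taylor_rem_le[of m] by (simp add: BP_def BQ_def)
    moreover have "\<bar>integral\<^sup>L (Q \<Otimes>\<^sub>M Q) ?r\<bar> \<le> PP.rem_bound m * ((BQ + BQ) / 2)"
      using QQ.integral_taylor_rem_le[of m] by (simp add: BQ_def)
    ultimately show "integral\<^sup>L (P \<Otimes>\<^sub>M P) ?r - 2 * integral\<^sup>L (P \<Otimes>\<^sub>M Q) ?r + integral\<^sup>L (Q \<Otimes>\<^sub>M Q) ?r
       \<le> 2 * PP.rem_bound m * (BP + BQ)"
      by (rule arrange)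
  qed simp
  finally show "(\<integral>g. (glr P s g - glr Q s g)^2 * exp (- s * (meanQ \<bullet> g)) \<partial>std_gaussian)
    \<le> ?e * (2 * PP.rem_bound m * (BP + BQ))" .
qed

lemma kl_small:
  "(\<integral>\<^sup>+g. ennreal (kl_fun (glr P s g) (glr Q s g)) \<partial>std_gaussian)
    \<le> ennreal (3 * fact (m + 1) * 8 ^ (m + 1) * (s * L) ^ (2 * (m + 1)) * (expP + expQ))"
proof -
  let ?h = "\<lambda>g. (glr P s g - glr Q s g)^2 * exp (- s * (meanQ \<bullet> g))"
  let ?K = "fact (m + 1) * 8 ^ (m + 1) * (s * L) ^ (2 * (m + 1))"
  have L: "L > 0" by (rule P.L_pos)
  have K: "0 \<le> ?K" using L s_pos by simp
  have "(\<integral>\<^sup>+g. ennreal (kl_fun (glr P s g) (glr Q s g)) \<partial>std_gaussian)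
    \<le> (\<integral>\<^sup>+g. ennreal (exp (s^2 * momQ / 2) * ?h g) \<partial>std_gaussian)"
  proof (intro nn_integral_mono ennreal_leI)
    fix g
    have "kl_fun (glr P s g) (glr Q s g) \<le> (glr P s g - glr Q s g)^2 / glr Q s g"
      by (intro kl_fun_le_chi2 P.glr_pos Q.glr_pos)
    also have "\<dots> \<le> (glr P s g - glr Q s g)^2 / exp (s * (meanQ \<bullet> g) - s^2 * momQ / 2)"
      using Q.glr_ge[of s g] Q.glr_pos[of s g] unfolding meanQ_def momQ_def by (intro divide_left_mono) auto
    also have "\<dots> = exp (s^2 * momQ / 2) * ?h g"
    proof -
      have "exp (s^2 * momQ / 2) * exp (- s * (meanQ \<bullet> g)) = inverse (exp (s * (meanQ \<bullet> g) - s^2 * momQ / 2))"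
        unfolding exp_minus[symmetric] by (simp add: exp_add[symmetric])
      moreover have "v * i = e * (v * f)" if "e * f = i" for e f i v :: real
        unfolding that[symmetric] by simp
      ultimately show ?thesis unfolding divide_inverse by blast
    qed
    finally show "kl_fun (glr P s g) (glr Q s g) \<le> exp (s^2 * momQ / 2) * ?h g" .
  qed
  also have "\<dots> = ennreal (\<integral>g. exp (s^2 * momQ / 2) * ?h g \<partial>std_gaussian)"
    using chi2_numerator_le(1) by (intro nn_integral_eq_integral) (auto simp: has_bochner_integral_iff)
  also have "\<dots> \<le> ennreal (3 * ?K * (expP + expQ))"
  proof (rule ennreal_leI)
    have "(\<integral>g. exp (s^2 * momQ / 2) * ?h g \<partial>std_gaussian)
      \<le> exp (s^2 * momQ / 2) * (exp (- (s^2) * (norm meanQ)^2 / 2) * (2 * PP.rem_bound m * (BP + BQ)))"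
      using chi2_numerator_le(2) by simp
    also have "\<dots> = 2 * ?K * exp (s^2 * momQ / 2 - s^2 * (norm meanQ)^2 / 2 + (norm meanQ)^2 / (2 * L^2)) * (BP + BQ)"
    proof -
      have "exp (s^2 * momQ / 2) * exp (- (s^2) * (norm meanQ)^2 / 2) * exp ((norm meanQ)^2 / (2 * L^2))
        = exp (s^2 * momQ / 2 - s^2 * (norm meanQ)^2 / 2 + (norm meanQ)^2 / (2 * L^2))"
        by (simp add: exp_add[symmetric])
      moreover have "v * (w * (2 * (k * f * e * n) * b)) = 2 * (f * e * k) * r * b" if "v * w * n = r"
        for v w k f e n b r :: real
        unfolding that[symmetric] by (simp only: mult_ac)
      ultimately show ?thesis unfolding PP.rem_bound_def by blast
    qed
    also have "\<dots> \<le> 2 * ?K * BQ * (BP + BQ)"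
    proof (intro mult_left_mono mult_right_mono)
      \<comment> \<open>Since \<open>M >= |a|^2\<close> for the second moment \<open>M\<close> and
        the mean \<open>a\<close>, the factor \<open>s^2\<close> in front of
        \<open>M - |a|^2\<close> may be raised to \<open>1 / L^2\<close>. The terms in
        \<open>a\<close> then cancel, and Jensen bounds the remaining
        \<open>exp (M / (2 L^2))\<close> by \<open>BQ\<close>.\<close>
      have sL: "s^2 \<le> 1 / L^2" using small L by (simp add: field_simps)
      have "s^2 * (momQ - (norm meanQ)^2) \<le> 1 / L^2 * (momQ - (norm meanQ)^2)"
        using Q.mean_norm_le unfolding momQ_def meanQ_def by (intro mult_right_mono sL[unfolded momQ_def]) auto
      then have "s^2 * momQ / 2 - s^2 * (norm meanQ)^2 / 2 + (norm meanQ)^2 / (2 * L^2) \<le> momQ / (2 * L^2)"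
        by (simp add: algebra_simps diff_divide_distrib)
      then have "exp (s^2 * momQ / 2 - s^2 * (norm meanQ)^2 / 2 + (norm meanQ)^2 / (2 * L^2)) \<le> exp (momQ / (2 * L^2))"
        by simp
      also have "\<dots> \<le> BQ" using Q.exp_second_moment_le by (simp add: BQ_def momQ_def)
      finally show "exp (s^2 * momQ / 2 - s^2 * (norm meanQ)^2 / 2 + (norm meanQ)^2 / (2 * L^2)) \<le> BQ" .
      show "0 \<le> 2 * ?K" using K by simp
      show "0 \<le> BP + BQ" by (simp add: BP_def BQ_def)
    qed
    also have "\<dots> = ?K * (2 * (BQ * (BP + BQ)))" by (simp only: mult_ac)
    also have "\<dots> \<le> ?K * (3 * (expP + expQ))"
    proof (intro mult_left_mono K)
      \<comment> \<open>Here the bound becomes linear: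
        \<open>2 BQ BP + 2 BQ^2 <= BP^2 + 3 BQ^2\<close>, and the squares lie below the full
        exponential moments.\<close>
      have "BP^2 \<le> expP" "BQ^2 \<le> expQ"
        using P.exp_half_square_le Q.exp_half_square_le by (simp_all add: BP_def BQ_def expP_def expQ_def)
      then show "2 * (BQ * (BP + BQ)) \<le> 3 * (expP + expQ)"
        using sum_squares_bound[of BP BQ] expP_ge_1 expQ_ge_1 by (simp add: power2_eq_square algebra_simps)
    qed
    finally show "(\<integral>g. exp (s^2 * momQ / 2) * ?h g \<partial>std_gaussian) \<le> 3 * ?K * (expP + expQ)"
      by (simp only: mult_ac)
  qed
  finally show ?thesis by (simp only: mult.assoc)
qed

end

end

section \<open>Large steps: the crude bound\<close>

lemma nn_integral_std_gaussian_norm2: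
  "(\<integral>\<^sup>+g. ennreal ((norm (g::real^'d))^2) \<partial>std_gaussian) \<le> ennreal (4 * sqrt 2 ^ CARD('d))"
proof -
  \<comment> \<open>The weight \<open>exp (|g|^2 / 4)\<close> turns variance \<open>1\<close> into
    variance \<open>2\<close>, whose unnormalised mass is \<open>sqrt 2 ^ d\<close>. Any bound
    depending on the dimension alone would do.\<close>
  have "(\<integral>\<^sup>+g. ennreal ((norm (g::real^'d))^2) \<partial>std_gaussian)
      \<le> (\<integral>\<^sup>+g. ennreal (4 * exp ((norm (g::real^'d))^2 / 4)) \<partial>std_gaussian)"
  proof (intro nn_integral_mono ennreal_leI)
    show "(norm g)^2 \<le> 4 * exp ((norm g)^2 / 4)" for g :: "real^'d"
      using power_le_fact_exp[of "(norm g)^2 / 4" 1] by simp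
  qed
  also have "\<dots> = (\<integral>\<^sup>+g. ennreal (gauss_dens g) * ennreal (4 * exp ((norm (g::real^'d))^2 / 4)) \<partial>lborel)"
    by (rule nn_integral_std_gaussian) measurable
  also have "\<dots> = (\<integral>\<^sup>+g. ennreal 4 * ennreal (gauss_dens ((g::real^'d) /\<^sub>R sqrt 2)) \<partial>lborel)"
  proof (intro nn_integral_cong)
    fix g :: "real^'d"
    have "(norm (g /\<^sub>R sqrt 2))^2 = (norm g)^2 / 2"
      by (simp add: power_mult_distrib power_inverse field_simps)
    then have "gauss_dens g * exp ((norm g)^2 / 4) = gauss_dens (g /\<^sub>R sqrt 2)"
      unfolding gauss_dens_def by (simp add: exp_add[symmetric] del: norm_scaleR)
    then show "ennreal (gauss_dens g) * ennreal (4 * exp ((norm g)^2 / 4)) = ennreal 4 * ennreal (gauss_dens (g /\<^sub>R sqrt 2))"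
      by (simp add: ennreal_mult[symmetric] mult.left_commute del: ennreal_numeral)
  qed
  also have "\<dots> = ennreal 4 * (\<integral>\<^sup>+g. ennreal (gauss_dens ((g::real^'d) /\<^sub>R sqrt 2)) \<partial>lborel)"
    by (rule nn_integral_cmult) measurable
  also have "(\<integral>\<^sup>+g. ennreal (gauss_dens ((g::real^'d) /\<^sub>R sqrt 2)) \<partial>lborel) = ennreal (sqrt 2 ^ CARD('d))"
  proof -
    have "ennreal (sqrt 2 ^ CARD('d)) * (ennreal (inverse (sqrt 2) ^ CARD('d)) * (\<integral>\<^sup>+g. ennreal (gauss_dens ((g::real^'d) /\<^sub>R sqrt 2)) \<partial>lborel))
       = ennreal (sqrt 2 ^ CARD('d)) * 1"
      using nn_integral_std_gaussian_scaled[of "\<lambda>_. 1" "sqrt 2" "0 :: real^'d"] by simp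
    moreover have "ennreal (sqrt 2 ^ CARD('d)) * ennreal (inverse (sqrt 2) ^ CARD('d)) = 1"
      by (subst ennreal_mult[symmetric]) (auto simp: power_mult_distrib[symmetric])
    ultimately show ?thesis by (simp add: mult.assoc[symmetric])
  qed
  finally show ?thesis by (simp add: ennreal_mult del: ennreal_numeral)
qed

context matched_pair
begin

text \<open>When \<open>s^2 L^2\<close> is bounded below, a bound of the form constant plus multiple
  of \<open>s^2 L^2\<close> is already of the required order \<open>(s L)^(2(m+1))\<close>. It comes
  from \<open>ln p <= |g|^2 / 2\<close> and the Jensen lower bound on \<open>ln q\<close>.\<close>

lemma kl_large:
  assumes large: "1 / 8 \<le> s^2 * L^2"
  shows "(\<integral>\<^sup>+g. ennreal (kl_fun (glr P s g) (glr Q s g)) \<partial>std_gaussian)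
    \<le> ennreal ((2 * (4 * sqrt 2 ^ CARD('d)) + 2) * 8 ^ (m + 1) * (s * L) ^ (2 * (m + 1)) * (expP + expQ))"
proof -
  let ?G = "4 * sqrt 2 ^ CARD('d)"
  have L: "L > 0" by (rule P.L_pos)
  have momQ: "0 \<le> momQ" by (simp add: momQ_def)
  have "(\<integral>\<^sup>+g. ennreal (kl_fun (glr P s g) (glr Q s g)) \<partial>std_gaussian)
    \<le> (\<integral>\<^sup>+g. ennreal (glr P s g) * ennreal ((norm g)^2) + ennreal (glr P s g) * ennreal (s^2 * momQ) + ennreal (glr Q s g) \<partial>std_gaussian)"
  proof (intro nn_integral_mono)
    fix g
    let ?p = "glr P s g" and ?q = "glr Q s g"
    have pq: "?p > 0" "?q > 0" by (intro P.glr_pos Q.glr_pos)+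
    have "ln ?p \<le> (norm g)^2 / 2"
      using ln_le_cancel_iff[of ?p "exp ((norm g)^2 / 2)"] P.glr_le[of s g] pq by simp
    moreover have "s * (meanQ \<bullet> g) - s^2 * momQ / 2 \<le> ln ?q"
      using Q.glr_ge[of s g] pq unfolding meanQ_def momQ_def by (simp add: ln_ge_iff)
    moreover have "- (s * (meanQ \<bullet> g)) \<le> s^2 * momQ / 2 + (norm g)^2 / 2"
    proof -
      have "0 \<le> (norm (g + s *\<^sub>R meanQ))^2" by simp
      also have "\<dots> = (norm g)^2 + 2 * (s * (meanQ \<bullet> g)) + s^2 * (norm meanQ)^2"
        unfolding power2_norm_eq_inner by (simp add: inner_add inner_commute power2_eq_square algebra_simps)
      also have "\<dots> \<le> (norm g)^2 + 2 * (s * (meanQ \<bullet> g)) + s^2 * momQ"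
        using Q.mean_norm_le unfolding meanQ_def momQ_def by (intro add_left_mono mult_left_mono) auto
      finally show ?thesis by simp
    qed
    ultimately have "ln (?p / ?q) \<le> (norm g)^2 + s^2 * momQ"
      using pq by (simp add: ln_div)
    then have "?p * ln (?p / ?q) \<le> ?p * ((norm g)^2 + s^2 * momQ)"
      using pq by (intro mult_left_mono) auto
    then have "kl_fun ?p ?q \<le> ?p * (norm g)^2 + ?p * (s^2 * momQ) + ?q"
      using pq unfolding kl_fun_def by (simp add: distrib_left)
    then have "ennreal (kl_fun ?p ?q) \<le> ennreal (?p * (norm g)^2 + ?p * (s^2 * momQ) + ?q)"
      by (rule ennreal_leI)
    also have "\<dots> = ennreal ?p * ennreal ((norm g)^2) + ennreal ?p * ennreal (s^2 * momQ) + ennreal ?q"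
      using pq momQ by (simp add: ennreal_plus ennreal_mult)
    finally show "ennreal (kl_fun ?p ?q) \<le> \<dots>" .
  qed
  also have "\<dots> = (\<integral>\<^sup>+g. ennreal (glr P s g) * ennreal ((norm g)^2) \<partial>std_gaussian) + ennreal (s^2 * momQ) + 1"
    by (simp add: nn_integral_add nn_integral_multc P.nn_integral_glr Q.nn_integral_glr)
  also have "\<dots> \<le> ennreal (2 * ?G + 2 * s^2 * (L^2 * expP)) + ennreal (s^2 * (L^2 * expQ)) + ennreal 1"
  proof (intro add_mono)
    \<comment> \<open>Under the weight \<open>glr P s\<close> the vector \<open>g\<close> has the
      law of \<open>s X + N\<close>, so its second moment splits into those of \<open>X\<close> and
      \<open>N\<close>. The mixture identity speaks of \<open>s g\<close>, hence the detour through
      division by \<open>s^2\<close>.\<close>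
    have "(\<integral>\<^sup>+g. ennreal (glr P s g) * ennreal ((norm g)^2) \<partial>std_gaussian)
      = (\<integral>\<^sup>+g. ennreal (glr P s g) * ennreal ((norm (s *\<^sub>R g))^2 / s^2) \<partial>std_gaussian)"
      using s_pos by (simp add: power_mult_distrib)
    also have "\<dots> = (\<integral>\<^sup>+x. \<integral>\<^sup>+g. ennreal ((norm (s^2 *\<^sub>R x + s *\<^sub>R g))^2 / s^2) \<partial>std_gaussian \<partial>P)"
      using s_pos by (intro P.nn_integral_gaussian_mixture[symmetric]) auto
    also have "\<dots> \<le> (\<integral>\<^sup>+x. \<integral>\<^sup>+g. ennreal (2 * (s^2 * (norm x)^2)) + ennreal 2 * ennreal ((norm (g::real^'d))^2) \<partial>std_gaussian \<partial>P)"
    proof (intro nn_integral_mono)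
      fix x g :: "real^'d"
      have "(norm (s^2 *\<^sub>R x + s *\<^sub>R g))^2 = s^2 * (norm (s *\<^sub>R x + g))^2"
      proof -
        have "s^2 *\<^sub>R x + s *\<^sub>R g = s *\<^sub>R (s *\<^sub>R x + g)" by (simp add: scaleR_add_right power2_eq_square)
        then show ?thesis by (simp add: power_mult_distrib)
      qed
      moreover have "(norm (s *\<^sub>R x + g))^2 \<le> 2 * (s^2 * (norm x)^2) + 2 * (norm g)^2"
      proof -
        have "0 \<le> (norm (s *\<^sub>R x - g))^2" by simp
        then show ?thesis unfolding power2_norm_eq_inner
          by (simp add: inner_add inner_diff inner_commute power2_eq_square algebra_simps)
      qed
      ultimately have "(norm (s^2 *\<^sub>R x + s *\<^sub>R g))^2 / s^2 \<le> 2 * (s^2 * (norm x)^2) + 2 * (norm g)^2"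
        using s_pos by simp
      then have "ennreal ((norm (s^2 *\<^sub>R x + s *\<^sub>R g))^2 / s^2) \<le> ennreal (2 * (s^2 * (norm x)^2) + 2 * (norm g)^2)"
        by (rule ennreal_leI)
      also have "\<dots> = ennreal (2 * (s^2 * (norm x)^2)) + ennreal 2 * ennreal ((norm g)^2)"
        by (simp add: ennreal_plus ennreal_mult del: ennreal_numeral)
      finally show "ennreal ((norm (s^2 *\<^sub>R x + s *\<^sub>R g))^2 / s^2) \<le> \<dots>" .
    qed
    also have "\<dots> = (\<integral>\<^sup>+x. ennreal (2 * s^2 * (norm x)^2) \<partial>P) + ennreal 2 * (\<integral>\<^sup>+g. ennreal ((norm (g::real^'d))^2) \<partial>std_gaussian)"
      by (simp add: nn_integral_add nn_integral_cmult mult.assoc del: ennreal_numeral)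
    also have "(\<integral>\<^sup>+x. ennreal (2 * s^2 * (norm x)^2) \<partial>P) = ennreal (\<integral>x. 2 * s^2 * (norm x)^2 \<partial>P)"
      using P.integrable_norm_power[of 2] by (intro nn_integral_eq_integral) auto
    also have "(\<integral>x. 2 * s^2 * (norm x)^2 \<partial>P) = 2 * s^2 * (\<integral>x. (norm x)^2 \<partial>P)" by simp
    also have "ennreal (2 * s^2 * (\<integral>x. (norm x)^2 \<partial>P)) + ennreal 2 * (\<integral>\<^sup>+g. ennreal ((norm (g::real^'d))^2) \<partial>std_gaussian)
        \<le> ennreal (2 * s^2 * (L^2 * expP)) + ennreal 2 * ennreal ?G"
      using P.second_moment_le
      by (intro add_mono mult_left_mono ennreal_leI nn_integral_std_gaussian_norm2) (auto simp: expP_def)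
    also have "\<dots> = ennreal (2 * ?G + 2 * s^2 * (L^2 * expP))"
    proof -
      have "ennreal 2 * ennreal ?G = ennreal (2 * ?G)" by (subst ennreal_mult) auto
      then show ?thesis using expP_ge_1 by (simp only: add.commute) (subst ennreal_plus, auto)
    qed
    finally show "(\<integral>\<^sup>+g. ennreal (glr P s g) * ennreal ((norm g)^2) \<partial>std_gaussian) \<le> \<dots>" .
    show "ennreal (s^2 * momQ) \<le> ennreal (s^2 * (L^2 * expQ))"
      using Q.second_moment_le by (intro ennreal_leI mult_left_mono) (auto simp: momQ_def expQ_def)
  qed simp
  also have "\<dots> = ennreal (2 * ?G + 2 * s^2 * (L^2 * expP) + s^2 * (L^2 * expQ) + 1)"
    using expP_ge_1 expQ_ge_1 by (simp add: ennreal_plus)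
  also have "\<dots> \<le> ennreal ((2 * ?G + 2) * 8 ^ (m + 1) * (s * L) ^ (2 * (m + 1)) * (expP + expQ))"
  proof (rule ennreal_leI)
    \<comment> \<open>Normalised so that the case assumption reads \<open>w >= 1\<close>; then
      \<open>w <= w^(m+1)\<close>, and \<open>w^(m+1)\<close> is where the factor
      \<open>8^(m+1)\<close> comes from.\<close>
    define w where "w = 8 * (s^2 * L^2)"
    have w: "1 \<le> w" using large by (simp add: w_def)
    have W: "w \<le> w ^ (m + 1)" using w self_le_power[of w "m + 1"] by simp
    have W': "8 ^ (m + 1) * (s * L) ^ (2 * (m + 1)) = w ^ (m + 1)"
      by (simp only: w_def power_mult power_mult_distrib)
    have sL: "s^2 * L^2 = w / 8" by (simp add: w_def)
    have G: "?G \<ge> 0" by simp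
    have E: "1 \<le> expP + expQ" using expP_ge_1 expQ_ge_1 by simp
    have "2 * ?G + 2 * s^2 * (L^2 * expP) + s^2 * (L^2 * expQ) + 1 = (2 * ?G + 1) + (w / 8) * (2 * expP + expQ)"
      by (simp add: sL[symmetric] algebra_simps)
    also have "\<dots> \<le> (2 * ?G + 1) * (w * (expP + expQ)) + w * (expP + expQ)"
    proof (intro add_mono)
      have "1 * 1 \<le> w * (expP + expQ)" using w E by (intro mult_mono) auto
      then show "2 * ?G + 1 \<le> (2 * ?G + 1) * (w * (expP + expQ))"
        using mult_left_mono[of 1 "w * (expP + expQ)" "2 * ?G + 1"] G by (simp only: mult_1_right)
      have "(2 * expP + expQ) / 8 \<le> expP + expQ" using expP_ge_1 expQ_ge_1 by simp
      then have "w * ((2 * expP + expQ) / 8) \<le> w * (expP + expQ)" using w by (intro mult_left_mono) auto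
      then show "(w / 8) * (2 * expP + expQ) \<le> w * (expP + expQ)" by simp
    qed
    also have "\<dots> = (2 * ?G + 2) * w * (expP + expQ)" by (simp add: algebra_simps)
    also have "\<dots> \<le> (2 * ?G + 2) * w ^ (m + 1) * (expP + expQ)"
      using W G E by (intro mult_right_mono mult_left_mono) auto
    finally show "2 * ?G + 2 * s^2 * (L^2 * expP) + s^2 * (L^2 * expQ) + 1
      \<le> (2 * ?G + 2) * 8 ^ (m + 1) * (s * L) ^ (2 * (m + 1)) * (expP + expQ)"
      by (simp only: W'[symmetric] mult.assoc)
  qed
  finally show ?thesis .
qed

end

text \<open>The sum of the constants of \<open>kl_small\<close> and \<open>kl_large\<close>, so that
  it dominates both. The dimension enters through the bound on the second moment of the
  Gaussian.\<close>

definition step_const :: "'d::finite itself \<Rightarrow> nat \<Rightarrow> real" where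
  "step_const _ m = (3 * fact (m + 1) + (2 * (4 * sqrt 2 ^ CARD('d)) + 2)) * 8 ^ (m + 1)"

lemma step_const_pos: "0 < step_const TYPE('d::finite) m"
  unfolding step_const_def by (intro mult_pos_pos add_pos_pos) auto

text \<open>Stated with extended integrals because the exponential moments may be infinite at
  particular starting points; there the right-hand side is infinite. Its linearity in the two
  moments allows it to be averaged along the path.\<close>

lemma kl_step:
  fixes P Q :: "(real^'d::finite) measure"
  assumes "borel_prob P" "borel_prob Q" and L: "L > 0" and s: "s > 0"
    and matched: "\<And>\<alpha>. (\<Sum>i\<in>UNIV. \<alpha> i) \<le> m \<Longrightarrow> (\<integral>x. mono_pow \<alpha> x \<partial>P) = (\<integral>x. mono_pow \<alpha> x \<partial>Q)"
  shows "(\<integral>\<^sup>+g. ennreal (kl_fun (glr P s g) (glr Q s g)) \<partial>std_gaussian)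
    \<le> ennreal (step_const TYPE('d) m * (s * L) ^ (2 * (m + 1))) *
      ((\<integral>\<^sup>+x. ennreal (exp ((norm x)^2 / L^2)) \<partial>P) + (\<integral>\<^sup>+x. ennreal (exp ((norm x)^2 / L^2)) \<partial>Q))"
    (is "_ \<le> ennreal ?C * (?P + ?Q)")
proof (cases "?P + ?Q = \<infinity>")
  case True
  moreover have "?C > 0" using L s by (intro mult_pos_pos step_const_pos zero_less_power) auto
  then have "ennreal ?C \<noteq> 0" by (simp only: ennreal_eq_0_iff not_le)
  then have "ennreal ?C * \<infinity> = \<infinity>" by (simp only: ennreal_mult_top infinity_ennreal_def if_False)
  ultimately have "ennreal ?C * (?P + ?Q) = \<infinity>" by (simp only:)
  then show ?thesis by simp
next
  case False
  interpret P: borel_prob P by fact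
  interpret Q: borel_prob Q by fact
  have fin: "?P < \<infinity>" "?Q < \<infinity>" using False by (auto simp: less_top)
  interpret P: subgaussian_prob P L
    using L fin by unfold_locales (auto intro!: integrableI_bounded)
  interpret Q: subgaussian_prob Q L
    using L fin by unfold_locales (auto intro!: integrableI_bounded)
  interpret matched_pair P Q L s m
    using s matched by unfold_locales auto
  have P: "?P = ennreal expP" unfolding expP_def by (intro nn_integral_eq_integral P.integrable_exp) auto
  have Q: "?Q = ennreal expQ" unfolding expQ_def by (intro nn_integral_eq_integral Q.integrable_exp) auto
  let ?w = "(s * L) ^ (2 * (m + 1))"
  have w: "0 \<le> ?w" using L s by simp
  have C: "ennreal ?C * (?P + ?Q) = ennreal (?C * (expP + expQ))"
    unfolding P Q using expP_ge_1 expQ_ge_1 L s step_const_pos[where 'd='d, of m]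
    by (subst ennreal_plus[symmetric]) (auto simp: ennreal_mult)
  have le: "c * 8 ^ (m + 1) * ?w * (expP + expQ) \<le> ?C * (expP + expQ)"
    if "c \<le> 3 * fact (m + 1) + (2 * (4 * sqrt 2 ^ CARD('d)) + 2)" for c
    unfolding step_const_def using that expP_ge_1 expQ_ge_1 w by (intro mult_right_mono) auto
  show ?thesis
  proof (cases "s^2 * L^2 \<le> 1 / 8")
    case True
    show ?thesis unfolding C
      by (rule order_trans[OF kl_small[OF True] ennreal_leI], rule le) simp
  next
    case False
    show ?thesis unfolding C
      by (rule order_trans[OF kl_large ennreal_leI]) (use False in simp, rule le, simp)
  qed
qed

section \<open>Chain rule for densities\<close>

text \<open>\<open>RN_deriv\<close> is determined only almost everywhere: uniqueness identifies it
  with \<open>f\<close> for \<open>Q\<close>, and absolute continuity carries this to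
  \<open>P\<close>, where the logarithm is integrated. As \<open>f\<close> is finite and positive,
  \<open>enn2real\<close> loses nothing.\<close>

lemma KL_div_density_le:
  assumes Q: "prob_space Q" and P: "prob_space P"
    and [measurable]: "f \<in> borel_measurable Q" and pos: "\<And>x. x \<in> space Q \<Longrightarrow> f x > 0"
    and PQ: "P = density Q (\<lambda>x. ennreal (f x))"
    and int: "integrable P (\<lambda>x. ln (f x))" and le: "(\<integral>x. ln (f x) \<partial>P) \<le> b"
  shows "KL_div P Q \<le> ereal b"
proof -
  interpret Q: prob_space Q by fact
  interpret P: prob_space P by fact
  have sets: "sets P = sets Q" by (simp add: PQ)
  have ac: "absolutely_continuous Q P"
    unfolding PQ by (rule absolutely_continuousI_density) measurable
  have "AE x in Q. ennreal (f x) = RN_deriv Q P x"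
    by (rule Q.RN_deriv_unique) (auto simp: PQ)
  then have "AE x in P. ennreal (f x) = RN_deriv Q P x"
    by (rule absolutely_continuous_AE[OF sets ac])
  then have AE: "AE x in P. ln (f x) = ln (enn2real (RN_deriv Q P x))"
  proof (rule AE_mp, intro AE_I2 impI)
    fix x assume "x \<in> space P" and eq: "ennreal (f x) = RN_deriv Q P x"
    then have "f x > 0" using pos sets_eq_imp_space_eq[OF sets] by auto
    then show "ln (f x) = ln (enn2real (RN_deriv Q P x))" unfolding eq[symmetric] by simp
  qed
  have [measurable]: "f \<in> borel_measurable P" "RN_deriv Q P \<in> borel_measurable P"
    by (simp_all add: measurable_cong_sets[OF sets refl])
  have 1: "integrable P (\<lambda>x. ln (enn2real (RN_deriv Q P x)))"
    by (rule integrable_cong_AE_imp[OF int]) (measurable, use AE in auto)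
  have 2: "(\<integral>x. ln (enn2real (RN_deriv Q P x)) \<partial>P) = (\<integral>x. ln (f x) \<partial>P)"
    by (rule integral_cong_AE) (measurable, use AE in auto)
  show ?thesis using ac 1 2 le by (simp add: KL_div_def)
qed

text \<open>A longer path is an old path \<open>y\<close> together with fresh noise
  \<open>g\<close>, encoded by \<open>ext\<close> and decoded by \<open>dec\<close>. Relative to
  this common noise both transitions have densities, \<open>p\<close> and \<open>q\<close>, so the
  density ratio is multiplied by \<open>p / q\<close> and its logarithm becomes a sum.\<close>

lemma kl_chain_step:
  fixes A B \<Omega> :: "'a measure" and G :: "'b measure" and \<Omega>' :: "'c measure"
    and p q :: "'a \<times> 'b \<Rightarrow> real" and f :: "'a \<Rightarrow> real"
  assumes A: "prob_space A" and B: "prob_space B" and G: "prob_space G"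
    and sets_A [measurable_cong]: "sets A = sets \<Omega>" and sets_B [measurable_cong]: "sets B = sets \<Omega>"
    and p [measurable]: "p \<in> borel_measurable (\<Omega> \<Otimes>\<^sub>M G)" and q [measurable]: "q \<in> borel_measurable (\<Omega> \<Otimes>\<^sub>M G)"
    and p_pos: "\<And>z. z \<in> space (\<Omega> \<Otimes>\<^sub>M G) \<Longrightarrow> 0 < p z" and q_pos: "\<And>z. z \<in> space (\<Omega> \<Otimes>\<^sub>M G) \<Longrightarrow> 0 < q z"
    and p_1: "\<And>y. y \<in> space \<Omega> \<Longrightarrow> (\<integral>\<^sup>+g. ennreal (p (y, g)) \<partial>G) = 1"
    and q_1: "\<And>y. y \<in> space \<Omega> \<Longrightarrow> (\<integral>\<^sup>+g. ennreal (q (y, g)) \<partial>G) = 1"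
    and ext [measurable]: "ext \<in> (\<Omega> \<Otimes>\<^sub>M G) \<rightarrow>\<^sub>M \<Omega>'" and dec [measurable]: "dec \<in> \<Omega>' \<rightarrow>\<^sub>M (\<Omega> \<Otimes>\<^sub>M G)"
    and dec_ext: "\<And>z. z \<in> space (\<Omega> \<Otimes>\<^sub>M G) \<Longrightarrow> dec (ext z) = z"
    and f [measurable]: "f \<in> borel_measurable \<Omega>" and f_pos: "\<And>y. y \<in> space \<Omega> \<Longrightarrow> 0 < f y"
    and AB: "A = density B (\<lambda>y. ennreal (f y))" and f_int: "integrable A (\<lambda>y. ln (f y))"
    and A': "A' = distr (density (A \<Otimes>\<^sub>M G) (\<lambda>z. ennreal (p z))) \<Omega>' ext"
    and B': "B' = distr (density (B \<Otimes>\<^sub>M G) (\<lambda>z. ennreal (q z))) \<Omega>' ext"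
    and b: "0 \<le> b" and kl: "(\<integral>\<^sup>+y. \<integral>\<^sup>+g. ennreal (kl_fun (p (y, g)) (q (y, g))) \<partial>G \<partial>A) \<le> ennreal b"
  shows "\<exists>f'. f' \<in> borel_measurable \<Omega>' \<and> (\<forall>w\<in>space \<Omega>'. 0 < f' w) \<and> A' = density B' (\<lambda>w. ennreal (f' w))
    \<and> integrable A' (\<lambda>w. ln (f' w)) \<and> (\<integral>w. ln (f' w) \<partial>A') \<le> (\<integral>y. ln (f y) \<partial>A) + b"
proof -
  interpret A: prob_space A by fact
  interpret B: prob_space B by fact
  interpret G: prob_space G by fact
  interpret AG: pair_sigma_finite A G ..
  interpret BG: pair_sigma_finite B G ..
  have space_A: "space A = space \<Omega>" and space_B: "space B = space \<Omega>"
    using sets_eq_imp_space_eq[OF sets_A] sets_eq_imp_space_eq[OF sets_B] .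
  have space_AG: "space (A \<Otimes>\<^sub>M G) = space (\<Omega> \<Otimes>\<^sub>M G)" "space (B \<Otimes>\<^sub>M G) = space (\<Omega> \<Otimes>\<^sub>M G)"
    by (simp_all add: space_pair_measure space_A space_B)
  \<comment> \<open>The new density ratio in the coordinates \<open>(y, g)\<close>;
    \<open>dec\<close> carries it over to paths.\<close>
  define h where "h z = f (fst z) * p z / q z" for z
  define f' where "f' w = h (dec w)" for w
  have h [measurable]: "h \<in> borel_measurable (\<Omega> \<Otimes>\<^sub>M G)" unfolding h_def[abs_def] by measurable
  have h_pos: "0 < h z" if "z \<in> space (\<Omega> \<Otimes>\<^sub>M G)" for z
    using that f_pos[of "fst z"] p_pos[of z] q_pos[of z] by (auto simp: h_def space_pair_measure)
  have f' [measurable]: "f' \<in> borel_measurable \<Omega>'" unfolding f'_def[abs_def] by measurable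
  have f'_pos: "0 < f' w" if "w \<in> space \<Omega>'" for w
    unfolding f'_def using measurable_space[OF dec that] by (rule h_pos)
  have f'_ext: "f' (ext z) = h z" if "z \<in> space (\<Omega> \<Otimes>\<^sub>M G)" for z
    using dec_ext[OF that] by (simp add: f'_def)

  have dens: "A' = density B' (\<lambda>w. ennreal (f' w))"
  proof -
    have AGd: "A \<Otimes>\<^sub>M G = density (B \<Otimes>\<^sub>M G) (\<lambda>z. ennreal (f (fst z)))"
    proof -
      have "density B (\<lambda>y. ennreal (f y)) \<Otimes>\<^sub>M density G (\<lambda>_. 1) = density (B \<Otimes>\<^sub>M G) (\<lambda>(y, g). ennreal (f y) * 1)"
        by (rule pair_measure_density)
           (use A.sigma_finite_measure_axioms G.sigma_finite_measure_axioms in \<open>auto simp: AB[symmetric] density_1\<close>)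
      then show ?thesis by (simp add: AB[symmetric] density_1 case_prod_unfold)
    qed
    have "density B' (\<lambda>w. ennreal (f' w))
        = distr (density (density (B \<Otimes>\<^sub>M G) (\<lambda>z. ennreal (q z))) ((\<lambda>w. ennreal (f' w)) \<circ> ext)) \<Omega>' ext"
      unfolding B' by (subst density_distr) (auto simp: comp_def)
    also have "density (density (B \<Otimes>\<^sub>M G) (\<lambda>z. ennreal (q z))) ((\<lambda>w. ennreal (f' w)) \<circ> ext)
        = density (B \<Otimes>\<^sub>M G) (\<lambda>z. ennreal (q z) * ennreal (f' (ext z)))"
      unfolding comp_def by (subst density_density_eq) auto
    also have "\<dots> = density (B \<Otimes>\<^sub>M G) (\<lambda>z. ennreal (f (fst z)) * ennreal (p z))"
    proof (rule density_cong)
      show "AE z in B \<Otimes>\<^sub>M G. ennreal (q z) * ennreal (f' (ext z)) = ennreal (f (fst z)) * ennreal (p z)"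
      proof (intro AE_I2)
        fix z assume "z \<in> space (B \<Otimes>\<^sub>M G)"
        then have z: "z \<in> space (\<Omega> \<Otimes>\<^sub>M G)" by (simp add: space_AG)
        then have "0 < f (fst z)" using f_pos by (auto simp: space_pair_measure)
        then have "q z * h z = f (fst z) * p z" "0 \<le> f (fst z)"
          using q_pos[OF z] by (simp_all add: h_def)
        then show "ennreal (q z) * ennreal (f' (ext z)) = ennreal (f (fst z)) * ennreal (p z)"
          using f'_ext[OF z] q_pos[OF z] p_pos[OF z] h_pos[OF z] by (simp add: ennreal_mult[symmetric])
      qed
    qed measurable
    also have "\<dots> = density (A \<Otimes>\<^sub>M G) (\<lambda>z. ennreal (p z))"
      unfolding AGd by (subst density_density_eq) auto
    finally show ?thesis unfolding A' by simp
  qed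

  have p_int: "has_bochner_integral (A \<Otimes>\<^sub>M G) p 1"
  proof (rule has_bochner_integral_nn_integral)
    have "(\<integral>\<^sup>+z. ennreal (p z) \<partial>(A \<Otimes>\<^sub>M G)) = (\<integral>\<^sup>+y. \<integral>\<^sup>+g. ennreal (p (y, g)) \<partial>G \<partial>A)"
      by (subst G.nn_integral_fst[symmetric]) auto
    also have "\<dots> = (\<integral>\<^sup>+y. 1 \<partial>A)" by (intro nn_integral_cong p_1) (simp add: space_A)
    finally show "(\<integral>\<^sup>+z. ennreal (p z) \<partial>(A \<Otimes>\<^sub>M G)) = ennreal 1" by (simp add: A.emeasure_space_1)
  qed (use p_pos in \<open>auto intro!: AE_I2 simp: space_AG less_imp_le\<close>)
  \<comment> \<open>\<open>q\<close> is integrated against \<open>A\<close> here, not against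
    \<open>B\<close>: it is normalised for every \<open>y\<close>, so \<open>- p + q\<close> still
    cancels under the measure in which the divergence is taken.\<close>
  have q_int: "has_bochner_integral (A \<Otimes>\<^sub>M G) q 1"
  proof (rule has_bochner_integral_nn_integral)
    have "(\<integral>\<^sup>+z. ennreal (q z) \<partial>(A \<Otimes>\<^sub>M G)) = (\<integral>\<^sup>+y. \<integral>\<^sup>+g. ennreal (q (y, g)) \<partial>G \<partial>A)"
      by (subst G.nn_integral_fst[symmetric]) auto
    also have "\<dots> = (\<integral>\<^sup>+y. 1 \<partial>A)" by (intro nn_integral_cong q_1) (simp add: space_A)
    finally show "(\<integral>\<^sup>+z. ennreal (q z) \<partial>(A \<Otimes>\<^sub>M G)) = ennreal 1" by (simp add: A.emeasure_space_1)
  qed (use q_pos in \<open>auto intro!: AE_I2 simp: space_AG less_imp_le\<close>)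

  let ?k = "\<lambda>z. kl_fun (p z) (q z)"
  have k_nn: "0 \<le> ?k z" if "z \<in> space (A \<Otimes>\<^sub>M G)" for z
    using that by (intro kl_fun_nonneg p_pos q_pos) (simp_all add: space_AG)
  have k_le: "(\<integral>\<^sup>+z. ennreal (?k z) \<partial>(A \<Otimes>\<^sub>M G)) \<le> ennreal b"
    using kl by (subst G.nn_integral_fst[symmetric]) auto
  \<comment> \<open>The nonnegativity of \<open>kl_fun\<close> pays off: a finite extended integral
    gives Bochner integrability.\<close>
  have k_int: "integrable (A \<Otimes>\<^sub>M G) ?k"
  proof (rule integrableI_bounded)
    have "(\<integral>\<^sup>+z. ennreal (norm (?k z)) \<partial>(A \<Otimes>\<^sub>M G)) = (\<integral>\<^sup>+z. ennreal (?k z) \<partial>(A \<Otimes>\<^sub>M G))"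
      by (intro nn_integral_cong) (simp add: k_nn)
    also have "\<dots> < \<infinity>" using k_le by (rule order_le_less_trans) simp
    finally show "(\<integral>\<^sup>+z. ennreal (norm (?k z)) \<partial>(A \<Otimes>\<^sub>M G)) < \<infinity>" .
  qed measurable
  have "ennreal (integral\<^sup>L (A \<Otimes>\<^sub>M G) ?k) \<le> ennreal b"
    using k_le k_nn nn_integral_eq_integral[OF k_int] by (simp add: AE_I2)
  then have k_b: "integral\<^sup>L (A \<Otimes>\<^sub>M G) ?k \<le> b" using b by simp

  \<comment> \<open>The contribution of the old path. Since \<open>p (y, .)\<close> integrates to
    \<open>1\<close>, integrating out \<open>g\<close> leaves \<open>ln (f y)\<close>.\<close>
  let ?l = "\<lambda>z. p z * ln (f (fst z))"
  have l_int: "integrable (A \<Otimes>\<^sub>M G) ?l"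
  proof (rule integrableI_bounded)
    have "(\<integral>\<^sup>+z. ennreal (norm (?l z)) \<partial>(A \<Otimes>\<^sub>M G)) = (\<integral>\<^sup>+z. ennreal (p z) * ennreal (norm (ln (f (fst z)))) \<partial>(A \<Otimes>\<^sub>M G))"
      using p_pos by (intro nn_integral_cong) (simp add: space_AG abs_mult ennreal_mult less_imp_le)
    also have "\<dots> = (\<integral>\<^sup>+y. \<integral>\<^sup>+g. ennreal (p (y, g)) * ennreal (norm (ln (f y))) \<partial>G \<partial>A)"
      by (subst G.nn_integral_fst[symmetric]) auto
    also have "\<dots> = (\<integral>\<^sup>+y. ennreal (norm (ln (f y))) \<partial>A)"
    proof (intro nn_integral_cong)
      fix y assume "y \<in> space A"
      then have y: "y \<in> space \<Omega>" by (simp add: space_A)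
      have [measurable]: "(\<lambda>g. p (y, g)) \<in> borel_measurable G"
        using y by measurable
      show "(\<integral>\<^sup>+g. ennreal (p (y, g)) * ennreal (norm (ln (f y))) \<partial>G) = ennreal (norm (ln (f y)))"
        by (subst nn_integral_multc) (auto simp: p_1[OF y])
    qed
    also have "\<dots> < \<infinity>" using f_int by (simp add: integrable_iff_bounded)
    finally show "(\<integral>\<^sup>+z. ennreal (norm (?l z)) \<partial>(A \<Otimes>\<^sub>M G)) < \<infinity>" .
  qed measurable
  have l_eq: "integral\<^sup>L (A \<Otimes>\<^sub>M G) ?l = (\<integral>y. ln (f y) \<partial>A)"
  proof -
    have "integral\<^sup>L (A \<Otimes>\<^sub>M G) ?l = (\<integral>y. (\<integral>g. ?l (y, g) \<partial>G) \<partial>A)"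
      using l_int by (rule AG.integral_fst'[symmetric])
    also have "\<dots> = (\<integral>y. ln (f y) \<partial>A)"
    proof (intro Bochner_Integration.integral_cong refl)
      fix y assume "y \<in> space A"
      then have y: "y \<in> space \<Omega>" by (simp add: space_A)
      have "has_bochner_integral G (\<lambda>g. p (y, g)) 1"
        by (rule has_bochner_integral_nn_integral)
           (use y p_pos p_1[OF y] in \<open>auto intro!: AE_I2 simp: space_pair_measure less_imp_le\<close>)
      then show "(\<integral>g. ?l (y, g) \<partial>G) = ln (f y)"
        by (simp add: has_bochner_integral_iff)
    qed
    finally show ?thesis .
  qed

  have key: "p z * ln (h z) = ?l z + (?k z + p z - q z)" if "z \<in> space (A \<Otimes>\<^sub>M G)" for z
  proof -
    have z: "z \<in> space (\<Omega> \<Otimes>\<^sub>M G)" using that by (simp add: space_AG)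
    then have "0 < f (fst z)" using f_pos by (auto simp: space_pair_measure)
    then have "ln (h z) = ln (f (fst z)) + ln (p z / q z)"
      using p_pos[OF z] q_pos[OF z] ln_mult[of "f (fst z)" "p z / q z"] by (simp add: h_def)
    then show ?thesis by (simp add: kl_fun_def algebra_simps)
  qed
  have hb: "has_bochner_integral (A \<Otimes>\<^sub>M G) (\<lambda>z. ?l z + (?k z + p z - q z)) ((\<integral>y. ln (f y) \<partial>A) + (integral\<^sup>L (A \<Otimes>\<^sub>M G) ?k + 1 - 1))"
    unfolding l_eq[symmetric]
    by (intro has_bochner_integral_add has_bochner_integral_diff has_bochner_integral_integrable l_int k_int p_int q_int)
  have hb': "has_bochner_integral (A \<Otimes>\<^sub>M G) (\<lambda>z. p z * ln (h z)) ((\<integral>y. ln (f y) \<partial>A) + integral\<^sup>L (A \<Otimes>\<^sub>M G) ?k)"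
    using hb by (subst has_bochner_integral_cong[OF refl key]) auto
  have p_AE: "AE z in A \<Otimes>\<^sub>M G. 0 \<le> p z"
    using p_pos by (intro AE_I2) (simp add: space_AG less_imp_le)
  have hd: "integrable (density (A \<Otimes>\<^sub>M G) (\<lambda>z. ennreal (p z))) (\<lambda>z. ln (h z))"
    "integral\<^sup>L (density (A \<Otimes>\<^sub>M G) (\<lambda>z. ennreal (p z))) (\<lambda>z. ln (h z)) = (\<integral>y. ln (f y) \<partial>A) + integral\<^sup>L (A \<Otimes>\<^sub>M G) ?k"
    using hb' by (auto simp: integrable_density[OF _ _ p_AE] integral_density[OF _ _ p_AE] has_bochner_integral_iff)
  let ?D = "density (A \<Otimes>\<^sub>M G) (\<lambda>z. ennreal (p z))"
  have eq: "ln (f' (ext z)) = ln (h z)" if "z \<in> space ?D" for z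
    using that f'_ext[of z] by (simp add: space_AG)
  have "integrable ?D (\<lambda>z. ln (f' (ext z)))"
    using hd(1) by (subst Bochner_Integration.integrable_cong[OF refl eq])
  then have "integrable A' (\<lambda>w. ln (f' w))"
    unfolding A' by (subst integrable_distr_eq) auto
  moreover have "(\<integral>w. ln (f' w) \<partial>A') = (\<integral>y. ln (f y) \<partial>A) + integral\<^sup>L (A \<Otimes>\<^sub>M G) ?k"
  proof -
    have "(\<integral>w. ln (f' w) \<partial>A') = (\<integral>z. ln (f' (ext z)) \<partial>?D)"
      unfolding A' by (subst integral_distr) auto
    also have "\<dots> = (\<integral>z. ln (h z) \<partial>?D)"
      by (rule Bochner_Integration.integral_cong[OF refl eq])
    finally show ?thesis unfolding hd(2) .
  qed
  ultimately show ?thesis using f' f'_pos dens k_b by (intro exI[of _ f']) auto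
qed

section \<open>Driftless and drifted walks\<close>

abbreviation path_space :: "nat \<Rightarrow> (nat \<Rightarrow> real^'d) measure" where
  "path_space k \<equiv> \<Pi>\<^sub>M j\<in>{1..k}. borel"

abbreviation noise :: "nat \<Rightarrow> (nat \<Rightarrow> real^'d) measure" where
  "noise k \<equiv> \<Pi>\<^sub>M j\<in>{1..k}. std_gaussian"

text \<open>For \<open>k = 0\<close> the index set is empty and a path stores no point, so the
  starting value \<open>0\<close> is supplied here, in agreement with \<open>law_Z\<close>.\<close>

definition path_end :: "nat \<Rightarrow> (nat \<Rightarrow> real^'d) \<Rightarrow> real^'d" where
  "path_end k y = (if k = 0 then 0 else y k)"

definition walk :: "(nat \<Rightarrow> real) \<Rightarrow> nat \<Rightarrow> real^'d \<Rightarrow> (nat \<Rightarrow> real^'d) \<Rightarrow> nat \<Rightarrow> real^'d" where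
  "walk \<delta> k x N = (\<lambda>j\<in>{1..k}. (\<Sum>i=1..j. \<delta> i) *\<^sub>R x + (\<Sum>i=1..j. sqrt (\<delta> i) *\<^sub>R N i))"

lemma atLeastAtMost_Suc_insert: "{1..Suc k} = insert (Suc k) {1..k}"
  by auto

lemma measurable_path_end [measurable]: "path_end k \<in> borel_measurable (path_space k)"
  unfolding path_end_def[abs_def] by (cases "k = 0") auto

lemma measurable_path_upd [measurable (raw)]:
  assumes "f \<in> M \<rightarrow>\<^sub>M path_space k" "g \<in> borel_measurable M"
  shows "(\<lambda>x. (f x)(Suc k := g x)) \<in> M \<rightarrow>\<^sub>M path_space (Suc k)"
  using assms by (intro measurable_fun_upd[where J="{1..k}"]) (auto simp: atLeastAtMost_Suc_insert)

lemma measurable_noise_component: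
  assumes "f \<in> M \<rightarrow>\<^sub>M noise k" "i \<in> {1..k}"
  shows "(\<lambda>x. f x i) \<in> borel_measurable M"
proof -
  have "(\<lambda>N. N i) \<in> noise k \<rightarrow>\<^sub>M (std_gaussian :: (real^'d) measure)"
    using assms(2) by (rule measurable_component_singleton)
  then have "(\<lambda>N. N i) \<in> borel_measurable (noise k :: (nat \<Rightarrow> real^'d) measure)"
    by (simp add: measurable_cong_sets[OF refl sets_std_gaussian])
  from measurable_compose[OF assms(1) this] show ?thesis by simp
qed

lemma measurable_walk [measurable]:
  "(\<lambda>(x, N). walk \<delta> k x N) \<in> borel \<Otimes>\<^sub>M noise k \<rightarrow>\<^sub>M path_space k"
  unfolding walk_def case_prod_unfold
  by (intro measurable_restrict borel_measurable_add borel_measurable_scaleR borel_measurable_sum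
      measurable_noise_component[OF measurable_snd]) auto

lemma measurable_walk' [measurable (raw)]:
  assumes "f \<in> borel_measurable M" "g \<in> M \<rightarrow>\<^sub>M noise k"
  shows "(\<lambda>z. walk \<delta> k (f z) (g z)) \<in> M \<rightarrow>\<^sub>M path_space k"
  using measurable_compose[OF measurable_Pair[OF assms] measurable_walk] by simp

lemma prob_space_noise: "prob_space (noise k :: (nat \<Rightarrow> real^'d) measure)"
  by (intro prob_space_PiM prob_space_std_gaussian)

interpretation noise: prob_space "noise k :: (nat \<Rightarrow> real^'d) measure"
  by (rule prob_space_noise)

lemma path_end_walk:
  "path_end k (walk \<delta> k x N) = (\<Sum>i=1..k. \<delta> i) *\<^sub>R x + (\<Sum>i=1..k. sqrt (\<delta> i) *\<^sub>R N i)"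
  by (simp add: path_end_def walk_def)

lemma walk_Suc:
  "walk \<delta> (Suc k) x (N(Suc k := g)) =
    (walk \<delta> k x N)(Suc k := path_end k (walk \<delta> k x N) + \<delta> (Suc k) *\<^sub>R x + sqrt (\<delta> (Suc k)) *\<^sub>R g)"
  unfolding path_end_walk
  by (rule ext) (auto simp: walk_def scaleR_add_left intro!: sum.cong)

lemma nn_integral_noise_Suc:
  assumes "F \<in> borel_measurable (noise (Suc k))"
  shows "(\<integral>\<^sup>+N. F N \<partial>noise (Suc k)) = (\<integral>\<^sup>+N. \<integral>\<^sup>+g. F (N(Suc k := g)) \<partial>std_gaussian \<partial>noise k)"
proof -
  interpret product_sigma_finite "\<lambda>_::nat. std_gaussian :: (real^'d) measure" ..
  show ?thesis using assms unfolding atLeastAtMost_Suc_insert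
    by (intro product_nn_integral_insert) auto
qed

lemma nn_integral_walk_Suc:
  assumes [measurable]: "F \<in> borel_measurable (path_space (Suc k))"
  shows "(\<integral>\<^sup>+N. F (walk \<delta> (Suc k) x N) \<partial>noise (Suc k)) =
    (\<integral>\<^sup>+N. \<integral>\<^sup>+g. F ((walk \<delta> k x N)(Suc k := path_end k (walk \<delta> k x N) + \<delta> (Suc k) *\<^sub>R x + sqrt (\<delta> (Suc k)) *\<^sub>R g))
      \<partial>std_gaussian \<partial>noise k)"
  by (subst nn_integral_noise_Suc) (measurable, simp only: walk_Suc)

text \<open>Cameron--Martin: adding the drift \<open>x\<close> to the driftless walk reweights it by a function of its
  endpoint only. This is why the posterior depends on the path only through \<open>Y\<^sub>k\<close>.\<close>

lemma nn_integral_walk_drift: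
  fixes x :: "real^'d"
  assumes "F \<in> borel_measurable (path_space k)" "\<And>j. j \<in> {1..k} \<Longrightarrow> 0 \<le> \<delta> j"
  shows "(\<integral>\<^sup>+N. F (walk \<delta> k x N) \<partial>noise k) =
    (\<integral>\<^sup>+N. ennreal (exp (x \<bullet> path_end k (walk \<delta> k 0 N) - (\<Sum>i=1..k. \<delta> i) * (norm x)^2 / 2))
      * F (walk \<delta> k 0 N) \<partial>noise k)"
  using assms
proof (induction k arbitrary: F)
  case 0
  have "walk \<delta> 0 x N = walk \<delta> 0 0 N" for N by (simp add: walk_def restrict_def)
  then show ?case by (simp add: path_end_def)
next
  case (Suc k)
  note [measurable] = Suc.prems(1)
  define s where "s = sqrt (\<delta> (Suc k))"
  have s2: "s^2 = \<delta> (Suc k)" using Suc.prems(2)[of "Suc k"] by (simp add: s_def)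
  let ?w = "walk \<delta> k 0" and ?t = "\<Sum>i=1..k. \<delta> i"
  let ?F' = "\<lambda>y. \<integral>\<^sup>+g. F (y(Suc k := path_end k y + \<delta> (Suc k) *\<^sub>R x + s *\<^sub>R g)) \<partial>std_gaussian"
  have F'_meas: "?F' \<in> borel_measurable (path_space k)" by measurable
  \<comment> \<open>Shifting the last noise by \<open>s x\<close> removes its drift. The resulting
    weight multiplies that of the induction hypothesis, because the endpoint grows by
    \<open>s g\<close> and the time by \<open>s^2\<close>.\<close>
  have F': "?F' y = (\<integral>\<^sup>+g. ennreal (exp (x \<bullet> (s *\<^sub>R g) - \<delta> (Suc k) * (norm x)^2 / 2)) * F (y(Suc k := path_end k y + s *\<^sub>R g)) \<partial>std_gaussian)"
    if "y \<in> space (path_space k)" for y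
  proof -
    have "(\<lambda>g. F (y(Suc k := path_end k y + s *\<^sub>R g))) \<in> borel_measurable borel"
      using that by measurable
    from nn_integral_std_gaussian_shift[OF this, of "s *\<^sub>R x"] show ?thesis
      by (simp add: scaleR_add_right power_mult_distrib s2 add_ac flip: power2_eq_square)
  qed
  have ws: "?w N \<in> space (path_space k)" for N :: "nat \<Rightarrow> real^'d" by (simp add: walk_def space_PiM)
  have "(\<integral>\<^sup>+N. F (walk \<delta> (Suc k) x N) \<partial>noise (Suc k)) = (\<integral>\<^sup>+N. ?F' (walk \<delta> k x N) \<partial>noise k)"
    unfolding s_def by (rule nn_integral_walk_Suc) measurable
  also have "\<dots> = (\<integral>\<^sup>+N. ennreal (exp (x \<bullet> path_end k (?w N) - ?t * (norm x)^2 / 2)) * ?F' (?w N) \<partial>noise k)"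
    by (rule Suc.IH[OF F'_meas]) (use Suc.prems(2) in auto)
  also have "\<dots> = (\<integral>\<^sup>+N. \<integral>\<^sup>+g. ennreal (exp (x \<bullet> path_end k (?w N) - ?t * (norm x)^2 / 2)) *
      (ennreal (exp (x \<bullet> (s *\<^sub>R g) - \<delta> (Suc k) * (norm x)^2 / 2)) * F ((?w N)(Suc k := path_end k (?w N) + s *\<^sub>R g))) \<partial>std_gaussian \<partial>noise k)"
  proof (intro nn_integral_cong)
    fix N :: "nat \<Rightarrow> real^'d"
    have [measurable]: "(\<lambda>g. F ((?w N)(Suc k := path_end k (?w N) + s *\<^sub>R g))) \<in> borel_measurable borel"
      using ws by measurable
    show "ennreal (exp (x \<bullet> path_end k (?w N) - ?t * (norm x)^2 / 2)) * ?F' (?w N) =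
      (\<integral>\<^sup>+g. ennreal (exp (x \<bullet> path_end k (?w N) - ?t * (norm x)^2 / 2)) *
      (ennreal (exp (x \<bullet> (s *\<^sub>R g) - \<delta> (Suc k) * (norm x)^2 / 2)) * F ((?w N)(Suc k := path_end k (?w N) + s *\<^sub>R g))) \<partial>std_gaussian)"
      unfolding F'[OF ws] by (rule nn_integral_cmult[symmetric]) measurable
  qed
  also have "\<dots> = (\<integral>\<^sup>+N. \<integral>\<^sup>+g. ennreal (exp (x \<bullet> path_end (Suc k) ((?w N)(Suc k := path_end k (?w N) + s *\<^sub>R g)) - (\<Sum>i=1..Suc k. \<delta> i) * (norm x)^2 / 2))
      * F ((?w N)(Suc k := path_end k (?w N) + s *\<^sub>R g)) \<partial>std_gaussian \<partial>noise k)"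
    unfolding mult.assoc[symmetric]
  proof (intro nn_integral_cong arg_cong2[where f="(*)"] refl)
    fix N :: "nat \<Rightarrow> real^'d" and g :: "real^'d"
    show "ennreal (exp (x \<bullet> path_end k (?w N) - ?t * (norm x)^2 / 2)) * ennreal (exp (x \<bullet> (s *\<^sub>R g) - \<delta> (Suc k) * (norm x)^2 / 2))
      = ennreal (exp (x \<bullet> path_end (Suc k) ((?w N)(Suc k := path_end k (?w N) + s *\<^sub>R g)) - (\<Sum>i=1..Suc k. \<delta> i) * (norm x)^2 / 2))"
      by (simp add: ennreal_mult[symmetric] exp_add[symmetric] path_end_def inner_add_right algebra_simps add_divide_distrib)
  qed
  also have "\<dots> = (\<integral>\<^sup>+N. ennreal (exp (x \<bullet> path_end (Suc k) (walk \<delta> (Suc k) 0 N) - (\<Sum>i=1..Suc k. \<delta> i) * (norm x)^2 / 2))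
      * F (walk \<delta> (Suc k) 0 N) \<partial>noise (Suc k))"
    by (subst nn_integral_walk_Suc[where F="\<lambda>w. ennreal (exp (x \<bullet> path_end (Suc k) w - (\<Sum>i=1..Suc k. \<delta> i) * (norm x)^2 / 2)) * F w"])
       (measurable, simp add: s_def)
  finally show ?case .
qed

text \<open>Collapses the accumulated noise into one Gaussian. The averaged hypothesis on
  \<open>Q\<close> is phrased with the single vector in \<open>t X + sqrt t N\<close>, whereas the
  chain adds up many.\<close>

lemma nn_integral_noise_sum:
  assumes "F \<in> borel_measurable borel" "\<And>j. j \<in> {1..k} \<Longrightarrow> 0 < \<delta> j"
  shows "(\<integral>\<^sup>+N. F (v + (\<Sum>i=1..k. sqrt (\<delta> i) *\<^sub>R N i)) \<partial>noise k)
    = (\<integral>\<^sup>+g. F (v + sqrt (\<Sum>i=1..k. \<delta> i) *\<^sub>R (g::real^'d)) \<partial>std_gaussian)"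
  using assms
proof (induction k arbitrary: F)
  case 0
  then show ?case by (simp add: noise.emeasure_space_1[of 0, simplified])
next
  case (Suc k)
  note [measurable] = Suc.prems(1)
  have pos: "0 < \<delta> (Suc k)" using Suc.prems(2) by simp
  have nn: "0 \<le> (\<Sum>i=1..k. \<delta> i)"
    by (rule sum_nonneg) (use Suc.prems(2) in \<open>simp add: less_imp_le\<close>)
  let ?F' = "\<lambda>y. \<integral>\<^sup>+g. F (y + sqrt (\<delta> (Suc k)) *\<^sub>R g) \<partial>std_gaussian"
  have "(\<integral>\<^sup>+N. F (v + (\<Sum>i=1..Suc k. sqrt (\<delta> i) *\<^sub>R N i)) \<partial>noise (Suc k))
    = (\<integral>\<^sup>+N. \<integral>\<^sup>+g. F (v + (\<Sum>i=1..Suc k. sqrt (\<delta> i) *\<^sub>R (N(Suc k := g)) i)) \<partial>std_gaussian \<partial>noise k)"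
    by (intro nn_integral_noise_Suc measurable_compose[OF _ Suc.prems(1)] borel_measurable_add borel_measurable_sum
        borel_measurable_scaleR measurable_noise_component[OF measurable_ident]) auto
  also have "\<dots> = (\<integral>\<^sup>+N. ?F' (v + (\<Sum>i=1..k. sqrt (\<delta> i) *\<^sub>R N i)) \<partial>noise k)"
  proof -
    have "(\<Sum>i=1..k. sqrt (\<delta> i) *\<^sub>R (if i = Suc k then g else N i)) = (\<Sum>i=1..k. sqrt (\<delta> i) *\<^sub>R N i)" for N g
      by (intro sum.cong) auto
    then show ?thesis by (simp add: add.assoc)
  qed
  also have "\<dots> = (\<integral>\<^sup>+g. ?F' (v + sqrt (\<Sum>i=1..k. \<delta> i) *\<^sub>R g) \<partial>std_gaussian)"
    by (rule Suc.IH) (use Suc.prems(2) in auto)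
  also have "\<dots> = (\<integral>\<^sup>+g. F (v + sqrt ((sqrt (\<Sum>i=1..k. \<delta> i))^2 + (sqrt (\<delta> (Suc k)))^2) *\<^sub>R g) \<partial>std_gaussian)"
    using pos nn by (intro nn_integral_std_gaussian_add) auto
  also have "(sqrt (\<Sum>i=1..k. \<delta> i))^2 + (sqrt (\<delta> (Suc k)))^2 = (\<Sum>i=1..Suc k. \<delta> i)"
    using pos nn by simp
  finally show ?case .
qed

section \<open>Transition structure of the two path laws\<close>

lemma measurable_glr_kernel:
  assumes K [measurable]: "K \<in> borel \<rightarrow>\<^sub>M prob_algebra (borel :: (real^'d) measure)"
  shows "(\<lambda>z. glr (K (fst z)) s (snd z)) \<in> borel_measurable (borel \<Otimes>\<^sub>M borel)"
proof -
  have "glr (K (fst z)) s (snd z) = enn2real (\<integral>\<^sup>+x. ennreal (gtilt s x (snd z)) \<partial>K (fst z))" for z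
  proof -
    interpret borel_prob "K (fst z)"
      using measurable_space[OF K, of "fst z"] by (auto simp: space_prob_algebra borel_prob_def borel_prob_axioms_def)
    show ?thesis using nn_integral_gtilt[of s "snd z"] glr_pos[of s "snd z"] by simp
  qed
  moreover have "(\<lambda>z. \<integral>\<^sup>+x. ennreal (gtilt s x (snd z)) \<partial>K (fst z)) \<in> borel_measurable (borel \<Otimes>\<^sub>M borel)"
    by (rule nn_integral_measurable_subprob_algebra2[where N=borel])
       (measurable, rule measurable_prob_algebraD, measurable)
  ultimately show ?thesis by simp
qed

section \<open>The posterior and the path law of \<open>Y\<close>\<close>

context subgaussian_prob
begin

text \<open>The normalising constant of \<open>posterior\<close>. Taken at the endpoint of a path,
  it is also the density of the law of \<open>Y\<close> relative to the driftless walk.\<close>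

definition "tilt_mass y t = (\<integral>x. exp (x \<bullet> y - t * (norm x)^2 / 2) \<partial>P)"

text \<open>At \<open>t = 0\<close> the quadratic term gives no damping, so \<open><x, y>\<close> is
  absorbed by the sub-Gaussian tail: \<open><x, y> <= |x|^2 / L^2 + L^2 |y|^2 / 4\<close>.\<close>

lemma integrable_tilt: "0 \<le> t \<Longrightarrow> integrable P (\<lambda>x. exp (x \<bullet> y - t * (norm x)^2 / 2))"
proof (rule Bochner_Integration.integrable_bound)
  assume t: "0 \<le> t"
  show "integrable P (\<lambda>x. exp (L^2 * (norm y)^2 / 4) * exp ((norm x)^2 / L^2))"
    using integrable_exp by simp
  have "x \<bullet> y - t * (norm x)^2 / 2 \<le> L^2 * (norm y)^2 / 4 + (norm x)^2 / L^2" for x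
  proof -
    have "0 \<le> (norm (x /\<^sub>R L - (L / 2) *\<^sub>R y))^2" by simp
    also have "\<dots> = (norm x)^2 / L^2 - x \<bullet> y + L^2 * (norm y)^2 / 4"
      unfolding power2_norm_eq_inner using L_pos
      by (simp add: inner_diff inner_commute power2_eq_square field_simps)
    moreover have "0 \<le> t * (norm x)^2 / 2" using t by simp
    ultimately show ?thesis by linarith
  qed
  then show "AE x in P. norm (exp (x \<bullet> y - t * (norm x)^2 / 2)) \<le> norm (exp (L^2 * (norm y)^2 / 4) * exp ((norm x)^2 / L^2))"
    by (simp add: exp_add[symmetric])
qed measurable

lemma tilt_mass_pos:
  assumes "0 \<le> t"
  shows "0 < tilt_mass y t"
proof -
  have "tilt_mass y t \<noteq> 0"
  proof
    assume "tilt_mass y t = 0"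
    then have "AE x in P. exp (x \<bullet> y - t * (norm x)^2 / 2) = 0"
      unfolding tilt_mass_def using integral_nonneg_eq_0_iff_AE[OF integrable_tilt[OF assms, of y]] by simp
    then show False by simp
  qed
  moreover have "0 \<le> tilt_mass y t" unfolding tilt_mass_def by simp
  ultimately show ?thesis by simp
qed

lemma nn_integral_tilt:
  "0 \<le> t \<Longrightarrow> (\<integral>\<^sup>+x. ennreal (exp (x \<bullet> y - t * (norm x)^2 / 2)) \<partial>P) = ennreal (tilt_mass y t)"
  unfolding tilt_mass_def by (intro nn_integral_eq_integral integrable_tilt) auto

lemma measurable_tilt_mass [measurable (raw)]:
  assumes [measurable]: "f \<in> borel_measurable M"
  shows "(\<lambda>z. tilt_mass (f z) t) \<in> borel_measurable M"
  unfolding tilt_mass_def by measurable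

lemma nn_integral_posterior:
  assumes [measurable]: "F \<in> borel_measurable borel"
  shows "(\<integral>\<^sup>+x. F x \<partial>posterior P y t)
    = (\<integral>\<^sup>+x. ennreal (exp (x \<bullet> y - t * (norm x)^2 / 2) / tilt_mass y t) * F x \<partial>P)"
  unfolding posterior_def tilt_mass_def by (subst nn_integral_density) auto

lemma tilt_mass_mult_nn_integral_posterior:
  assumes [measurable]: "F \<in> borel_measurable borel" and t: "0 \<le> t"
  shows "ennreal (tilt_mass y t) * (\<integral>\<^sup>+x. F x \<partial>posterior P y t)
    = (\<integral>\<^sup>+x. ennreal (exp (x \<bullet> y - t * (norm x)^2 / 2)) * F x \<partial>P)"
proof -
  have "ennreal (tilt_mass y t) * (\<integral>\<^sup>+x. F x \<partial>posterior P y t)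
    = (\<integral>\<^sup>+x. ennreal (tilt_mass y t) * (ennreal (exp (x \<bullet> y - t * (norm x)^2 / 2) / tilt_mass y t) * F x) \<partial>P)"
    unfolding nn_integral_posterior[OF assms(1)] by (rule nn_integral_cmult[symmetric]) measurable
  also have "\<dots> = (\<integral>\<^sup>+x. ennreal (exp (x \<bullet> y - t * (norm x)^2 / 2)) * F x \<partial>P)"
    using tilt_mass_pos[OF t, of y]
    by (intro nn_integral_cong) (simp add: mult.assoc[symmetric] ennreal_mult[symmetric])
  finally show ?thesis .
qed

lemma borel_prob_posterior:
  assumes t: "0 \<le> t"
  shows "borel_prob (posterior P y t)"
proof -
  have "ennreal (tilt_mass y t) * emeasure (posterior P y t) (space (posterior P y t))
      = ennreal (tilt_mass y t) * (\<integral>\<^sup>+x. 1 \<partial>posterior P y t)" by simp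
  also have "\<dots> = ennreal (tilt_mass y t) * 1"
    using tilt_mass_mult_nn_integral_posterior[of "\<lambda>_. 1" t y] t by (simp add: nn_integral_tilt)
  finally have "emeasure (posterior P y t) (space (posterior P y t)) = 1"
    using tilt_mass_pos[OF t, of y] by (subst (asm) ennreal_mult_cancel_left) (auto simp: ennreal_eq_0_iff)
  then interpret post: prob_space "posterior P y t" by (rule prob_spaceI)
  show ?thesis by unfold_locales (simp add: posterior_def)
qed

lemma measurable_glr_posterior:
  assumes t: "0 \<le> t"
  shows "(\<lambda>z. glr (posterior P (fst z) t) s (snd z)) \<in> borel_measurable (borel \<Otimes>\<^sub>M borel)"
proof -
  have "glr (posterior P (fst z) t) s (snd z) =
    enn2real (\<integral>\<^sup>+x. ennreal (exp (x \<bullet> fst z - t * (norm x)^2 / 2) / tilt_mass (fst z) t) * ennreal (gtilt s x (snd z)) \<partial>P)" for z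
  proof -
    interpret post: borel_prob "posterior P (fst z) t" by (rule borel_prob_posterior[OF t])
    show ?thesis
      using post.nn_integral_gtilt[of s "snd z"] post.glr_pos[of s "snd z"]
      by (subst nn_integral_posterior[symmetric]) auto
  qed
  then show ?thesis by simp
qed

lemma sets_law_Y [simp, measurable_cong]: "sets (law_Y P \<delta> k) = sets (path_space k)"
  by (simp add: law_Y_def)

lemma law_Y_eq: "law_Y P \<delta> k = distr (P \<Otimes>\<^sub>M noise k) (path_space k) (\<lambda>z. walk \<delta> k (fst z) (snd z))"
  unfolding law_Y_def walk_def by (simp add: case_prod_unfold)

lemma prob_space_law_Y: "prob_space (law_Y P \<delta> k)"
  unfolding law_Y_eq
  by (intro prob_space.prob_space_distr prob_space_pair prob_space_axioms prob_space_noise) measurable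

lemma nn_integral_law_Y:
  assumes [measurable]: "F \<in> borel_measurable (path_space k)"
  shows "(\<integral>\<^sup>+y. F y \<partial>law_Y P \<delta> k) = (\<integral>\<^sup>+x. \<integral>\<^sup>+N. F (walk \<delta> k x N) \<partial>noise k \<partial>P)"
proof -
  have "(\<integral>\<^sup>+y. F y \<partial>law_Y P \<delta> k) = (\<integral>\<^sup>+z. F (walk \<delta> k (fst z) (snd z)) \<partial>(P \<Otimes>\<^sub>M noise k))"
    unfolding law_Y_eq by (rule nn_integral_distr) measurable
  also have "\<dots> = (\<integral>\<^sup>+x. \<integral>\<^sup>+N. F (walk \<delta> k (fst (x, N)) (snd (x, N))) \<partial>noise k \<partial>P)"
    by (rule noise.nn_integral_fst[symmetric]) measurable
  finally show ?thesis by (simp only: prod.sel)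
qed

text \<open>Given the whole path, \<open>X\<close> follows the posterior at the endpoint. The drift
  is traded for a weight on the driftless walk, averaging the weight over \<open>x\<close> gives
  \<open>tilt_mass\<close>, which cancels the normalisation of the posterior, and the drift is then
  restored.\<close>

lemma nn_integral_law_Y_disintegrate:
  assumes [measurable]: "F \<in> borel_measurable (path_space k \<Otimes>\<^sub>M borel)" and \<delta>: "\<And>j. j \<in> {1..k} \<Longrightarrow> 0 \<le> \<delta> j"
  shows "(\<integral>\<^sup>+y. \<integral>\<^sup>+x. F (y, x) \<partial>posterior P (path_end k y) (\<Sum>i=1..k. \<delta> i) \<partial>law_Y P \<delta> k)
    = (\<integral>\<^sup>+x. \<integral>\<^sup>+N. F (walk \<delta> k x N, x) \<partial>noise k \<partial>P)"
proof -
  interpret PN: pair_sigma_finite P "noise k :: (nat \<Rightarrow> real^'d) measure" ..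
  let ?t = "\<Sum>i=1..k. \<delta> i" and ?w = "walk \<delta> k 0"
  let ?e = "\<lambda>x y. ennreal (exp (x \<bullet> path_end k y - ?t * (norm x)^2 / 2))"
  have t: "0 \<le> ?t" using \<delta> by (rule sum_nonneg)
  let ?G = "\<lambda>y. \<integral>\<^sup>+x. F (y, x) \<partial>posterior P (path_end k y) ?t"
  have slice: "(\<lambda>x. F (y, x)) \<in> borel_measurable borel" if "y \<in> space (path_space k)" for y
    using that by measurable
  have G [measurable]: "?G \<in> borel_measurable (path_space k)"
  proof (subst measurable_cong)
    show "?G y = (\<integral>\<^sup>+x. ennreal (exp (x \<bullet> path_end k y - ?t * (norm x)^2 / 2) / tilt_mass (path_end k y) ?t) * F (y, x) \<partial>P)"
      if "y \<in> space (path_space k)" for y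
      by (rule nn_integral_posterior[OF slice[OF that]])
  qed measurable
  have ws: "?w N \<in> space (path_space k)" for N :: "nat \<Rightarrow> real^'d" by (simp add: walk_def space_PiM)
  have "(\<integral>\<^sup>+y. ?G y \<partial>law_Y P \<delta> k) = (\<integral>\<^sup>+x. \<integral>\<^sup>+N. ?G (walk \<delta> k x N) \<partial>noise k \<partial>P)"
    by (rule nn_integral_law_Y) measurable
  also have "\<dots> = (\<integral>\<^sup>+x. \<integral>\<^sup>+N. ?e x (?w N) * ?G (?w N) \<partial>noise k \<partial>P)"
    by (intro nn_integral_cong nn_integral_walk_drift G \<delta>)
  also have "\<dots> = (\<integral>\<^sup>+N. \<integral>\<^sup>+x. ?e x (?w N) * ?G (?w N) \<partial>P \<partial>noise k)"
    by (rule PN.Fubini'[symmetric]) measurable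
  also have "\<dots> = (\<integral>\<^sup>+N. ennreal (tilt_mass (path_end k (?w N)) ?t) * ?G (?w N) \<partial>noise k)"
    by (intro nn_integral_cong, subst nn_integral_multc, measurable, simp only: nn_integral_tilt[OF t])
  also have "\<dots> = (\<integral>\<^sup>+N. \<integral>\<^sup>+x. ?e x (?w N) * F (?w N, x) \<partial>P \<partial>noise k)"
    by (intro nn_integral_cong tilt_mass_mult_nn_integral_posterior slice ws t)
  also have "\<dots> = (\<integral>\<^sup>+x. \<integral>\<^sup>+N. ?e x (?w N) * F (?w N, x) \<partial>noise k \<partial>P)"
    by (rule PN.Fubini') measurable
  also have "\<dots> = (\<integral>\<^sup>+x. \<integral>\<^sup>+N. F (walk \<delta> k x N, x) \<partial>noise k \<partial>P)"
    by (intro nn_integral_cong nn_integral_walk_drift[symmetric] \<delta>) measurable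
  finally show ?thesis .
qed

text \<open>Identifies the law of \<open>Y_k\<close> with that of \<open>t X + sqrt t N\<close>, the
  form in which the exponential moments of \<open>Q\<close> are controlled.\<close>

lemma nn_integral_law_Y_end:
  assumes [measurable]: "h \<in> borel_measurable borel" and \<delta>: "\<And>j. j \<in> {1..k} \<Longrightarrow> 0 < \<delta> j"
  shows "(\<integral>\<^sup>+y. h (path_end k y) \<partial>law_Y P \<delta> k)
    = (\<integral>\<^sup>+z. h ((\<Sum>i=1..k. \<delta> i) *\<^sub>R fst z + sqrt (\<Sum>i=1..k. \<delta> i) *\<^sub>R snd z) \<partial>(P \<Otimes>\<^sub>M std_gaussian))"
proof -
  have "(\<integral>\<^sup>+y. h (path_end k y) \<partial>law_Y P \<delta> k)
     = (\<integral>\<^sup>+x. \<integral>\<^sup>+N. h ((\<Sum>i=1..k. \<delta> i) *\<^sub>R x + (\<Sum>i=1..k. sqrt (\<delta> i) *\<^sub>R N i)) \<partial>noise k \<partial>P)"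
    by (subst nn_integral_law_Y) (measurable, simp only: path_end_walk)
  also have "\<dots> = (\<integral>\<^sup>+x. \<integral>\<^sup>+g. h ((\<Sum>i=1..k. \<delta> i) *\<^sub>R x + sqrt (\<Sum>i=1..k. \<delta> i) *\<^sub>R g) \<partial>std_gaussian \<partial>P)"
    by (intro nn_integral_cong nn_integral_noise_sum \<delta>) measurable
  also have "\<dots> = (\<integral>\<^sup>+z. h ((\<Sum>i=1..k. \<delta> i) *\<^sub>R fst z + sqrt (\<Sum>i=1..k. \<delta> i) *\<^sub>R snd z) \<partial>(P \<Otimes>\<^sub>M std_gaussian))"
    by (subst std_gaussian.nn_integral_fst[symmetric]) auto
  finally show ?thesis .
qed

end

text \<open>The path is extended by noise without drift; in both laws the drift is carried by the
  density \<open>glr\<close> relative to this noise.\<close>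

definition path_ext :: "nat \<Rightarrow> real \<Rightarrow> (nat \<Rightarrow> real^'d) \<times> (real^'d) \<Rightarrow> nat \<Rightarrow> real^'d" where
  "path_ext k s z = (fst z)(Suc k := path_end k (fst z) + s *\<^sub>R snd z)"

definition path_dec :: "nat \<Rightarrow> real \<Rightarrow> (nat \<Rightarrow> real^'d) \<Rightarrow> (nat \<Rightarrow> real^'d) \<times> (real^'d)" where
  "path_dec k s w = (restrict w {1..k}, (w (Suc k) - path_end k (restrict w {1..k})) /\<^sub>R s)"

lemma measurable_path_ext [measurable]: "path_ext k s \<in> path_space k \<Otimes>\<^sub>M borel \<rightarrow>\<^sub>M path_space (Suc k)"
  unfolding path_ext_def[abs_def] by measurable

lemma measurable_path_end_pair:
  "(\<lambda>z. (path_end k (fst z), snd z)) \<in> path_space k \<Otimes>\<^sub>M borel \<rightarrow>\<^sub>M borel \<Otimes>\<^sub>M borel"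
  by measurable

lemma measurable_path_dec [measurable]: "path_dec k s \<in> path_space (Suc k) \<rightarrow>\<^sub>M path_space k \<Otimes>\<^sub>M borel"
proof -
  have [measurable]: "(\<lambda>w. restrict w {1..k}) \<in> path_space (Suc k) \<rightarrow>\<^sub>M path_space k"
    by (rule measurable_restrict_subset) auto
  have [measurable]: "(\<lambda>w. w (Suc k)) \<in> borel_measurable (path_space (Suc k))"
    by (rule measurable_component_singleton) auto
  show ?thesis unfolding path_dec_def[abs_def] by measurable
qed

lemma path_dec_ext:
  assumes "z \<in> space (path_space k \<Otimes>\<^sub>M borel)" "s \<noteq> 0"
  shows "path_dec k s (path_ext k s z) = z"
proof -
  \<comment> \<open>Overwriting index \<open>Suc k\<close> leaves the old indices alone, and outside
    \<open>{1..k}\<close> the old path is undefined, exactly as its restriction is.\<close>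
  have "restrict ((fst z)(Suc k := v)) {1..k} = fst z" for v
  proof
    fix j show "restrict ((fst z)(Suc k := v)) {1..k} j = fst z j"
      using assms(1) by (auto simp: space_pair_measure space_PiM PiE_def extensional_def restrict_def)
  qed
  then show ?thesis using assms(2) by (simp add: path_dec_def path_ext_def prod_eq_iff)
qed

lemma measure_eqI_nn_integral:
  assumes "sets A = sets \<Omega>" "sets B = sets \<Omega>"
    and "\<And>F. F \<in> borel_measurable \<Omega> \<Longrightarrow> (\<integral>\<^sup>+x. F x \<partial>A) = (\<integral>\<^sup>+x. F x \<partial>B)"
  shows "A = B"
proof (rule measure_eqI)
  fix X assume X: "X \<in> sets A"
  then have "X \<in> sets \<Omega>" "X \<in> sets B" using assms by auto
  then show "emeasure A X = emeasure B X"
    using assms(3)[of "indicator X"] X by simp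
qed (use assms in simp)

lemma nn_integral_step_law:
  assumes [measurable_cong]: "sets M = sets (path_space k)"
    and [measurable]: "p \<in> borel_measurable (path_space k \<Otimes>\<^sub>M borel)" "F \<in> borel_measurable (path_space (Suc k))"
  shows "(\<integral>\<^sup>+w. F w \<partial>distr (density (M \<Otimes>\<^sub>M std_gaussian) (\<lambda>z. ennreal (p z))) (path_space (Suc k)) (path_ext k s))
    = (\<integral>\<^sup>+y. \<integral>\<^sup>+g. ennreal (p (y, g)) * F (y(Suc k := path_end k y + s *\<^sub>R g)) \<partial>std_gaussian \<partial>M)"
proof -
  have "(\<integral>\<^sup>+w. F w \<partial>distr (density (M \<Otimes>\<^sub>M std_gaussian) (\<lambda>z. ennreal (p z))) (path_space (Suc k)) (path_ext k s))
    = (\<integral>\<^sup>+z. ennreal (p z) * F (path_ext k s z) \<partial>(M \<Otimes>\<^sub>M std_gaussian))"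
    by (subst nn_integral_distr, measurable, subst nn_integral_density, measurable)
  also have "\<dots> = (\<integral>\<^sup>+y. \<integral>\<^sup>+g. ennreal (p (y, g)) * F (path_ext k s (y, g)) \<partial>std_gaussian \<partial>M)"
    by (subst std_gaussian.nn_integral_fst[symmetric]) auto
  finally show ?thesis by (simp add: path_ext_def)
qed

text \<open>\<open>Y\<close> uses one common \<open>X\<close> for all steps, yet it moves like a
  chain that redraws \<open>X\<close> from the posterior: disintegration averages the last step over
  \<open>X\<close> given the past, and the mixture identity turns this into a density.\<close>

lemma (in subgaussian_prob) law_Y_Suc:
  assumes \<delta>: "\<And>j. j \<in> {1..Suc k} \<Longrightarrow> 0 < \<delta> j"
  defines "s \<equiv> sqrt (\<delta> (Suc k))" and "t \<equiv> (\<Sum>i=1..k. \<delta> i)"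
  shows "law_Y P \<delta> (Suc k) = distr (density (law_Y P \<delta> k \<Otimes>\<^sub>M std_gaussian)
      (\<lambda>z. ennreal (glr (posterior P (path_end k (fst z)) t) s (snd z)))) (path_space (Suc k)) (path_ext k s)"
proof (rule measure_eqI_nn_integral)
  fix F :: "(nat \<Rightarrow> real^'d) \<Rightarrow> ennreal" assume F [measurable]: "F \<in> borel_measurable (path_space (Suc k))"
  have s2: "s^2 = \<delta> (Suc k)" using \<delta>[of "Suc k"] by (simp add: s_def)
  have t: "0 \<le> t" unfolding t_def by (rule sum_nonneg) (use \<delta> in \<open>simp add: less_imp_le\<close>)
  have \<delta>': "0 \<le> \<delta> j" if "j \<in> {1..k}" for j using \<delta>[of j] that by simp
  have pm: "(\<lambda>z. glr (posterior P (path_end k (fst z)) t) s (snd z)) \<in> borel_measurable (path_space k \<Otimes>\<^sub>M borel)"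
    using measurable_compose[OF measurable_path_end_pair measurable_glr_posterior[OF t, of s]] by (simp only: prod.sel)
  let ?F' = "\<lambda>z. \<integral>\<^sup>+g. F ((fst z)(Suc k := path_end k (fst z) + \<delta> (Suc k) *\<^sub>R snd z + s *\<^sub>R g)) \<partial>std_gaussian"
  have "(\<integral>\<^sup>+w. F w \<partial>law_Y P \<delta> (Suc k)) = (\<integral>\<^sup>+x. \<integral>\<^sup>+N. F (walk \<delta> (Suc k) x N) \<partial>noise (Suc k) \<partial>P)"
    by (rule nn_integral_law_Y) measurable
  also have "\<dots> = (\<integral>\<^sup>+x. \<integral>\<^sup>+N. ?F' (walk \<delta> k x N, x) \<partial>noise k \<partial>P)"
    by (subst nn_integral_walk_Suc, measurable, simp only: s_def prod.sel)
  also have "\<dots> = (\<integral>\<^sup>+y. \<integral>\<^sup>+x. ?F' (y, x) \<partial>posterior P (path_end k y) t \<partial>law_Y P \<delta> k)"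
    unfolding t_def by (rule nn_integral_law_Y_disintegrate[symmetric]) (measurable, rule \<delta>')
  also have "\<dots> = (\<integral>\<^sup>+y. \<integral>\<^sup>+g. ennreal (glr (posterior P (path_end k y) t) s g) * F (y(Suc k := path_end k y + s *\<^sub>R g)) \<partial>std_gaussian \<partial>law_Y P \<delta> k)"
  proof (intro nn_integral_cong)
    fix y :: "nat \<Rightarrow> real^'d" assume "y \<in> space (law_Y P \<delta> k)"
    then have y [measurable]: "y \<in> space (path_space k)" using sets_eq_imp_space_eq[OF sets_law_Y[of \<delta> k]] by simp
    interpret post: borel_prob "posterior P (path_end k y) t" by (rule borel_prob_posterior[OF t])
    have "(\<lambda>v. F (y(Suc k := path_end k y + v))) \<in> borel_measurable borel" by measurable
    from post.nn_integral_gaussian_mixture[OF this, of s]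
    show "(\<integral>\<^sup>+x. ?F' (y, x) \<partial>posterior P (path_end k y) t)
      = (\<integral>\<^sup>+g. ennreal (glr (posterior P (path_end k y) t) s g) * F (y(Suc k := path_end k y + s *\<^sub>R g)) \<partial>std_gaussian)"
      by (simp add: s2 add.assoc)
  qed
  also have "\<dots> = (\<integral>\<^sup>+w. F w \<partial>distr (density (law_Y P \<delta> k \<Otimes>\<^sub>M std_gaussian)
      (\<lambda>z. ennreal (glr (posterior P (path_end k (fst z)) t) s (snd z)))) (path_space (Suc k)) (path_ext k s))"
    using nn_integral_step_law[OF sets_law_Y[of \<delta> k] pm F, of s] by (simp only: prod.sel)
  finally show "(\<integral>\<^sup>+w. F w \<partial>law_Y P \<delta> (Suc k)) = \<dots>" .
qed simp_all

lemma measurable_z_step: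
  assumes Q: "(\<lambda>z. Q z (\<Sum>j=1..k. \<delta> j)) \<in> borel \<rightarrow>\<^sub>M prob_algebra (borel :: (real^'d) measure)"
  shows "z_step Q \<delta> (Suc k) \<in> borel \<rightarrow>\<^sub>M prob_algebra borel"
proof -
  have g: "(\<lambda>z :: real^'d. std_gaussian :: (real^'d) measure) \<in> borel \<rightarrow>\<^sub>M prob_algebra borel"
    by (rule measurable_const) (simp add: space_prob_algebra prob_space_std_gaussian)
  show ?thesis unfolding z_step_def[abs_def]
    by (rule measurable_distr_prob_space2[where M="borel \<Otimes>\<^sub>M borel"])
       (use measurable_pair_prob[OF Q g] in \<open>auto simp: case_prod_unfold\<close>)
qed

lemma law_Z_step:
  fixes Q :: "real^'d \<Rightarrow> real \<Rightarrow> (real^'d) measure"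
  assumes Z: "law_Z Q \<delta> k \<in> space (prob_algebra (path_space k))"
    and Q: "(\<lambda>z. Q z (\<Sum>j=1..k. \<delta> j)) \<in> borel \<rightarrow>\<^sub>M prob_algebra borel"
    and \<delta>: "0 \<le> \<delta> (Suc k)"
  defines "s \<equiv> sqrt (\<delta> (Suc k))" and "t \<equiv> (\<Sum>j=1..k. \<delta> j)"
  shows law_Z_Suc_prob: "law_Z Q \<delta> (Suc k) \<in> space (prob_algebra (path_space (Suc k)))"
    and law_Z_Suc: "law_Z Q \<delta> (Suc k) = distr (density (law_Z Q \<delta> k \<Otimes>\<^sub>M std_gaussian)
      (\<lambda>z. ennreal (glr (Q (path_end k (fst z)) t) s (snd z)))) (path_space (Suc k)) (path_ext k s)"
proof -
  let ?K = "\<lambda>z. distr (z_step Q \<delta> (Suc k) (path_end k z)) (path_space (Suc k)) (\<lambda>w. z(Suc k := w))"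
  have [measurable]: "z_step Q \<delta> (Suc k) \<in> borel \<rightarrow>\<^sub>M prob_algebra borel" by (rule measurable_z_step[where Q=Q and \<delta>=\<delta> and k=k, OF Q])
  have K: "?K \<in> path_space k \<rightarrow>\<^sub>M prob_algebra (path_space (Suc k))"
  proof (rule measurable_distr_prob_space2[where M=borel])
    show "(\<lambda>z. z_step Q \<delta> (Suc k) (path_end k z)) \<in> path_space k \<rightarrow>\<^sub>M prob_algebra borel"
      by (rule measurable_compose[OF measurable_path_end]) fact
    show "(\<lambda>(z, w). z(Suc k := w)) \<in> path_space k \<Otimes>\<^sub>M borel \<rightarrow>\<^sub>M path_space (Suc k)"
      unfolding case_prod_unfold by measurable
  qed
  have eq: "law_Z Q \<delta> (Suc k) = law_Z Q \<delta> k \<bind> ?K" by (simp add: path_end_def)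
  have setsZ [measurable_cong]: "sets (law_Z Q \<delta> k) = sets (path_space k)"
    using Z by (simp add: space_prob_algebra)
  \<comment> \<open>A bind of kernels is evaluated at an arbitrary point: the constant kernel with
    value \<open>law_Z Q \<delta> k\<close> on a discrete space stands in for the single
    measure.\<close>
  show "law_Z Q \<delta> (Suc k) \<in> space (prob_algebra (path_space (Suc k)))"
    unfolding eq by (rule measurable_space[OF measurable_bind_prob_space[OF measurable_const[OF Z] K], of undefined "count_space UNIV"]) simp
  then have sets_Suc: "sets (law_Z Q \<delta> (Suc k)) = sets (path_space (Suc k))"
    by (simp add: space_prob_algebra)
  have s2: "s^2 = \<delta> (Suc k)" using \<delta> by (simp add: s_def)
  have pm: "(\<lambda>z. glr (Q (path_end k (fst z)) t) s (snd z)) \<in> borel_measurable (path_space k \<Otimes>\<^sub>M borel)"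
    using measurable_compose[OF measurable_path_end_pair measurable_glr_kernel[where K="\<lambda>z. Q z (\<Sum>j=1..k. \<delta> j)", OF Q, of s]]
    by (simp only: prod.sel t_def)
  have zs: "z_step Q \<delta> (Suc k) v = distr (Q v t \<Otimes>\<^sub>M std_gaussian) borel (\<lambda>z. v + \<delta> (Suc k) *\<^sub>R fst z + s *\<^sub>R snd z)" for v
    by (simp add: z_step_def s_def t_def case_prod_unfold)
  show "law_Z Q \<delta> (Suc k) = distr (density (law_Z Q \<delta> k \<Otimes>\<^sub>M std_gaussian)
      (\<lambda>z. ennreal (glr (Q (path_end k (fst z)) t) s (snd z)))) (path_space (Suc k)) (path_ext k s)"
  proof (rule measure_eqI_nn_integral[OF sets_Suc])
    fix F :: "(nat \<Rightarrow> real^'d) \<Rightarrow> ennreal" assume F [measurable]: "F \<in> borel_measurable (path_space (Suc k))"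
    have "(\<integral>\<^sup>+w. F w \<partial>law_Z Q \<delta> (Suc k)) = (\<integral>\<^sup>+y. \<integral>\<^sup>+w. F w \<partial>?K y \<partial>law_Z Q \<delta> k)"
      unfolding eq using measurable_prob_algebraD[OF K]
      by (intro nn_integral_bind[OF F]) (simp add: measurable_cong_sets[OF setsZ refl])
    also have "\<dots> = (\<integral>\<^sup>+y. \<integral>\<^sup>+g. ennreal (glr (Q (path_end k y) t) s g) * F (y(Suc k := path_end k y + s *\<^sub>R g)) \<partial>std_gaussian \<partial>law_Z Q \<delta> k)"
    proof (intro nn_integral_cong)
      fix y :: "nat \<Rightarrow> real^'d" assume "y \<in> space (law_Z Q \<delta> k)"
      then have y [measurable]: "y \<in> space (path_space k)" using sets_eq_imp_space_eq[OF setsZ] by simp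
      interpret Qy: borel_prob "Q (path_end k y) t"
        using measurable_space[OF Q, of "path_end k y"]
        by (auto simp: space_prob_algebra borel_prob_def borel_prob_axioms_def t_def)
      have H [measurable]: "(\<lambda>v. F (y(Suc k := path_end k y + v))) \<in> borel_measurable borel" by measurable
      have [measurable_cong]: "sets (z_step Q \<delta> (Suc k) (path_end k y)) = sets borel" by (simp add: z_step_def)
      have "(\<integral>\<^sup>+w. F w \<partial>?K y) = (\<integral>\<^sup>+v. F (y(Suc k := v)) \<partial>z_step Q \<delta> (Suc k) (path_end k y))"
        by (subst nn_integral_distr) measurable
      also have "\<dots> = (\<integral>\<^sup>+z. F (y(Suc k := path_end k y + \<delta> (Suc k) *\<^sub>R fst z + s *\<^sub>R snd z)) \<partial>(Q (path_end k y) t \<Otimes>\<^sub>M std_gaussian))"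
        unfolding zs by (rule nn_integral_distr) measurable
      also have "\<dots> = (\<integral>\<^sup>+x. \<integral>\<^sup>+g. F (y(Suc k := path_end k y + (s^2 *\<^sub>R x + s *\<^sub>R g))) \<partial>std_gaussian \<partial>Q (path_end k y) t)"
        by (subst std_gaussian.nn_integral_fst[symmetric]) (auto simp: s2 add.assoc)
      also have "\<dots> = (\<integral>\<^sup>+g. ennreal (glr (Q (path_end k y) t) s g) * F (y(Suc k := path_end k y + s *\<^sub>R g)) \<partial>std_gaussian)"
        by (rule Qy.nn_integral_gaussian_mixture[OF H])
      finally show "(\<integral>\<^sup>+w. F w \<partial>?K y) = \<dots>" .
    qed
    also have "\<dots> = (\<integral>\<^sup>+w. F w \<partial>distr (density (law_Z Q \<delta> k \<Otimes>\<^sub>M std_gaussian)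
      (\<lambda>z. ennreal (glr (Q (path_end k (fst z)) t) s (snd z)))) (path_space (Suc k)) (path_ext k s))"
      using nn_integral_step_law[OF setsZ pm F, of s] by (simp only: prod.sel)
    finally show "(\<integral>\<^sup>+w. F w \<partial>law_Z Q \<delta> (Suc k)) = \<dots>" .
  qed simp
qed

section \<open>The path divergence\<close>

text \<open>The factor \<open>4\<close> is \<open>2 + 2\<close>, the averaged exponential moments of
  the posterior and of \<open>Q\<close>. The induction carries a positive density with integrable
  logarithm, from which the divergence is read off only at the end.\<close>

lemma KL_path_le:
  fixes \<mu> :: "(real^'d::finite) measure"
  assumes L: "L > 0" and hyps: "thm3_hyps \<mu> Q T L m"
    and \<delta>: "\<And>k. k \<in> {1..n} \<Longrightarrow> 0 < \<delta> k" and T: "(\<Sum>k=1..n-1. \<delta> k) \<le> T"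
  shows "KL_div (law_Y \<mu> \<delta> n) (law_Z Q \<delta> n)
    \<le> ereal (4 * step_const TYPE('d) m * L ^ (2 * (m + 1)) * (\<Sum>k=1..n. \<delta> k ^ (m + 1)))"
proof -
  define c where "c = 4 * step_const TYPE('d) m * L ^ (2 * (m + 1))"
  have c: "0 \<le> c" using step_const_pos[where 'd='d, of m] L by (simp add: c_def)
  have \<mu>: "prob_space \<mu>" "sets \<mu> = sets borel"
    and Q: "(\<lambda>(z, t). Q z t) \<in> borel \<Otimes>\<^sub>M restrict_space borel {0..} \<rightarrow>\<^sub>M prob_algebra borel"
    and \<mu>_exp: "(\<integral>\<^sup>+x. ennreal (exp ((norm x)^2 / L^2)) \<partial>\<mu>) \<le> 2"
    and Q_exp: "\<And>t. t \<in> {0..T} \<Longrightarrow> (\<integral>\<^sup>+p. (\<integral>\<^sup>+x'. ennreal (exp ((norm x')^2 / L^2))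
          \<partial>(Q (t *\<^sub>R fst p + sqrt t *\<^sub>R snd p) t)) \<partial>(\<mu> \<Otimes>\<^sub>M std_gaussian)) \<le> 2"
    and moments: "\<And>\<alpha> y t. (\<Sum>i\<in>UNIV. \<alpha> i) \<le> m \<Longrightarrow> t \<in> {0..T} \<Longrightarrow>
        (\<integral>x. mono_pow \<alpha> x \<partial>posterior \<mu> y t) = (\<integral>x. mono_pow \<alpha> x \<partial>Q y t)"
    using hyps unfolding thm3_hyps_def by blast+
  interpret \<mu>: borel_prob \<mu> using \<mu> by (simp add: borel_prob_def borel_prob_axioms_def)
  interpret \<mu>: subgaussian_prob \<mu> L
  proof
    have "(\<integral>\<^sup>+x. ennreal (norm (exp ((norm x)^2 / L^2))) \<partial>\<mu>) < \<infinity>"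
      using \<mu>_exp by (simp add: order_le_less_trans)
    then show "integrable \<mu> (\<lambda>x. exp ((norm x)^2 / L^2))" by (intro integrableI_bounded) auto
  qed fact

  have "law_Z Q \<delta> k \<in> space (prob_algebra (path_space k)) \<and>
    (\<exists>f. f \<in> borel_measurable (path_space k) \<and> (\<forall>y\<in>space (path_space k). 0 < f y)
      \<and> law_Y \<mu> \<delta> k = density (law_Z Q \<delta> k) (\<lambda>y. ennreal (f y))
      \<and> integrable (law_Y \<mu> \<delta> k) (\<lambda>y. ln (f y)) \<and> (\<integral>y. ln (f y) \<partial>law_Y \<mu> \<delta> k) \<le> c * (\<Sum>j=1..k. \<delta> j ^ (m + 1)))"
    if "k \<le> n" for k
    using that
  proof (induction k)
    case 0
    let ?\<Omega> = "path_space 0 :: (nat \<Rightarrow> real^'d) measure"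
    have u: "(\<lambda>_. undefined) \<in> space ?\<Omega>" by (simp add: space_PiM)
    have Z: "law_Z Q \<delta> 0 \<in> space (prob_algebra ?\<Omega>)"
      by (simp only: law_Z.simps space_prob_algebra) (use prob_space_return[OF u] in auto)
    have "law_Y \<mu> \<delta> 0 = law_Z Q \<delta> 0"
    proof (rule measure_eqI_nn_integral)
      fix F :: "(nat \<Rightarrow> real^'d) \<Rightarrow> ennreal" assume F: "F \<in> borel_measurable ?\<Omega>"
      have "walk \<delta> 0 x N = (\<lambda>_. undefined)" for x :: "real^'d" and N by (simp add: walk_def restrict_def)
      then have "(\<integral>\<^sup>+y. F y \<partial>law_Y \<mu> \<delta> 0) = F (\<lambda>_. undefined)"
        by (simp only: \<mu>.nn_integral_law_Y[OF F] nn_integral_const noise.emeasure_space_1 \<mu>.emeasure_space_1 mult_1_right)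
      then show "(\<integral>\<^sup>+y. F y \<partial>law_Y \<mu> \<delta> 0) = (\<integral>\<^sup>+y. F y \<partial>law_Z Q \<delta> 0)"
        by (simp only: law_Z.simps nn_integral_return[OF u F])
    qed simp_all
    then show ?case using Z by (intro conjI exI[of _ "\<lambda>_. 1"]) (simp_all add: density_1)
  next
    case (Suc k)
    define s where "s = sqrt (\<delta> (Suc k))"
    define t where "t = (\<Sum>i=1..k. \<delta> i)"
    let ?\<Omega> = "path_space k :: (nat \<Rightarrow> real^'d) measure"
    let ?post = "\<lambda>y. posterior \<mu> (path_end k y) t" and ?Q = "\<lambda>y. Q (path_end k y) t"
    have \<delta>_pos: "0 < \<delta> j" if "j \<in> {1..Suc k}" for j using \<delta>[of j] that Suc.prems by simp
    have s: "0 < s" using \<delta>_pos[of "Suc k"] by (simp add: s_def)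
    have s2: "s^2 = \<delta> (Suc k)" using \<delta>_pos[of "Suc k"] by (simp add: s_def)
    have t0: "0 \<le> t" unfolding t_def by (rule sum_nonneg) (use \<delta>_pos in \<open>simp add: less_imp_le\<close>)
    \<comment> \<open>A step from \<open>k\<close> to \<open>Suc k <= n\<close> starts at time
      \<open>t_k <= t_(n-1)\<close>. Only starting times must lie in \<open>[0, T]\<close>; the
      final time may exceed \<open>T\<close>.\<close>
    have "t \<le> (\<Sum>i=1..n-1. \<delta> i)" unfolding t_def
      by (rule sum_mono2) (use Suc.prems \<delta> in \<open>auto simp: less_imp_le\<close>)
    then have t: "t \<in> {0..T}" using t0 T by simp
    have Qt: "(\<lambda>z. Q z t) \<in> borel \<rightarrow>\<^sub>M prob_algebra borel"
      using measurable_compose[OF _ Q, of "\<lambda>z. (z, t)" borel] t0 by (simp add: space_restrict_space)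
    have bQ: "borel_prob (Q y t)" for y
      using measurable_space[OF Qt, of y] by (auto simp: space_prob_algebra borel_prob_def borel_prob_axioms_def)
    have bP: "borel_prob (posterior \<mu> y t)" for y by (rule \<mu>.borel_prob_posterior[OF t0])
    from Suc obtain f where Z: "law_Z Q \<delta> k \<in> space (prob_algebra ?\<Omega>)"
      and f: "f \<in> borel_measurable ?\<Omega>" "\<And>y. y \<in> space ?\<Omega> \<Longrightarrow> 0 < f y"
        "law_Y \<mu> \<delta> k = density (law_Z Q \<delta> k) (\<lambda>y. ennreal (f y))" "integrable (law_Y \<mu> \<delta> k) (\<lambda>y. ln (f y))"
      and le: "(\<integral>y. ln (f y) \<partial>law_Y \<mu> \<delta> k) \<le> c * (\<Sum>j=1..k. \<delta> j ^ (m + 1))"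
      by auto
    have pm: "(\<lambda>z. glr (?post (fst z)) s (snd z)) \<in> borel_measurable (?\<Omega> \<Otimes>\<^sub>M std_gaussian)"
      using measurable_compose[OF measurable_path_end_pair \<mu>.measurable_glr_posterior[OF t0, of s]]
      by (simp only: prod.sel measurable_cong_sets[OF sets_pair_measure_cong[OF refl sets_std_gaussian] refl])
    have qm: "(\<lambda>z. glr (?Q (fst z)) s (snd z)) \<in> borel_measurable (?\<Omega> \<Otimes>\<^sub>M std_gaussian)"
      using measurable_compose[OF measurable_path_end_pair measurable_glr_kernel[OF Qt, of s]]
      by (simp only: prod.sel measurable_cong_sets[OF sets_pair_measure_cong[OF refl sets_std_gaussian] refl])
    have sets_pair: "sets (?\<Omega> \<Otimes>\<^sub>M std_gaussian) = sets (?\<Omega> \<Otimes>\<^sub>M borel)"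
      by (rule sets_pair_measure_cong[OF refl sets_std_gaussian])
    have setsY: "sets (law_Y \<mu> \<delta> k) = sets ?\<Omega>" by (rule \<mu>.sets_law_Y)
    let ?E = "\<lambda>x :: real^'d. ennreal (exp ((norm x)^2 / L^2))"
    let ?C = "step_const TYPE('d) m * (s * L) ^ (2 * (m + 1))"
    let ?b = "c * \<delta> (Suc k) ^ (m + 1)"
    have C: "0 \<le> ?C" using step_const_pos[where 'd='d, of m] s L by simp
    \<comment> \<open>With \<open>s^2 = \<delta> (Suc k)\<close>, the factor
      \<open>(s L)^(2(m+1))\<close> of the one-step bound is \<open>L^(2(m+1))\<close> times the
      \<open>(m+1)\<close>-st power of the step size.\<close>
    have b: "?b = ?C * 4"
      unfolding c_def s2[symmetric] by (simp only: power_mult_distrib power_mult[symmetric] mult_ac)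
    have h [measurable]: "(\<lambda>v. \<integral>\<^sup>+x. ?E x \<partial>Q v t) \<in> borel_measurable borel"
      by (rule measurable_compose[OF measurable_prob_algebraD[OF Qt] nn_integral_measurable_subprob_algebra]) measurable
    have hP: "(\<lambda>y. \<integral>\<^sup>+x. ?E x \<partial>?post y) \<in> borel_measurable ?\<Omega>"
      unfolding \<mu>.nn_integral_posterior[of ?E, simplified] by measurable
    have kl: "(\<integral>\<^sup>+y. \<integral>\<^sup>+g. ennreal (kl_fun (glr (?post y) s g) (glr (?Q y) s g)) \<partial>std_gaussian \<partial>law_Y \<mu> \<delta> k) \<le> ennreal ?b"
    proof -
      have "(\<integral>\<^sup>+y. \<integral>\<^sup>+g. ennreal (kl_fun (glr (?post y) s g) (glr (?Q y) s g)) \<partial>std_gaussian \<partial>law_Y \<mu> \<delta> k)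
        \<le> (\<integral>\<^sup>+y. ennreal ?C * ((\<integral>\<^sup>+x. ?E x \<partial>?post y) + (\<integral>\<^sup>+x. ?E x \<partial>?Q y)) \<partial>law_Y \<mu> \<delta> k)"
        by (intro nn_integral_mono kl_step bP bQ L s moments t)
      also have "\<dots> = ennreal ?C * ((\<integral>\<^sup>+y. \<integral>\<^sup>+x. ?E x \<partial>?post y \<partial>law_Y \<mu> \<delta> k) + (\<integral>\<^sup>+y. \<integral>\<^sup>+x. ?E x \<partial>?Q y \<partial>law_Y \<mu> \<delta> k))"
      proof -
        have 1: "(\<lambda>y. \<integral>\<^sup>+x. ?E x \<partial>?post y) \<in> borel_measurable (law_Y \<mu> \<delta> k)"
          "(\<lambda>y. \<integral>\<^sup>+x. ?E x \<partial>?Q y) \<in> borel_measurable (law_Y \<mu> \<delta> k)"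
          unfolding measurable_cong_sets[OF setsY refl]
          using hP measurable_compose[OF measurable_path_end h] by auto
        show ?thesis by (subst nn_integral_cmult[OF borel_measurable_add[OF 1]]) (simp only: nn_integral_add[OF 1])
      qed
      also have "\<dots> \<le> ennreal ?C * (2 + 2)"
      proof (intro mult_left_mono add_mono)
        \<comment> \<open>The tower property: averaged over the paths of \<open>Y\<close>, the
          posterior is \<open>\<mu>\<close> again.\<close>
        have "(\<integral>\<^sup>+y. \<integral>\<^sup>+x. ?E x \<partial>?post y \<partial>law_Y \<mu> \<delta> k) = (\<integral>\<^sup>+x. \<integral>\<^sup>+N. ?E x \<partial>(noise k :: (nat \<Rightarrow> real^'d) measure) \<partial>\<mu>)"
          using \<mu>.nn_integral_law_Y_disintegrate[of "\<lambda>z. ?E (snd z)" k \<delta>] \<delta>_pos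
          unfolding t_def by (simp add: less_imp_le)
        also have "\<dots> = (\<integral>\<^sup>+x. ?E x \<partial>\<mu>)"
          by (simp only: nn_integral_const noise.emeasure_space_1 mult_1_right)
        finally show "(\<integral>\<^sup>+y. \<integral>\<^sup>+x. ?E x \<partial>?post y \<partial>law_Y \<mu> \<delta> k) \<le> 2" using \<mu>_exp by simp
        have "(\<integral>\<^sup>+y. \<integral>\<^sup>+x. ?E x \<partial>?Q y \<partial>law_Y \<mu> \<delta> k)
            = (\<integral>\<^sup>+p. (\<integral>\<^sup>+x. ?E x \<partial>Q (t *\<^sub>R fst p + sqrt t *\<^sub>R snd p) t) \<partial>(\<mu> \<Otimes>\<^sub>M std_gaussian))"
          unfolding t_def by (rule \<mu>.nn_integral_law_Y_end[OF h[unfolded t_def]]) (use \<delta>_pos in simp)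
        then show "(\<integral>\<^sup>+y. \<integral>\<^sup>+x. ?E x \<partial>?Q y \<partial>law_Y \<mu> \<delta> k) \<le> 2" using Q_exp[OF t] by simp
      qed simp
      also have "\<dots> = ennreal ?b" unfolding b using C by (subst ennreal_mult) auto
      finally show ?thesis .
    qed
    have Zp: "prob_space (law_Z Q \<delta> k)" "sets (law_Z Q \<delta> k) = sets ?\<Omega>"
      using Z by (simp_all add: space_prob_algebra)
    have \<delta>Suc: "0 \<le> \<delta> (Suc k)" using \<delta>_pos[of "Suc k"] by simp
    have Ys: "law_Y \<mu> \<delta> (Suc k) = distr (density (law_Y \<mu> \<delta> k \<Otimes>\<^sub>M std_gaussian)
      (\<lambda>z. ennreal (glr (?post (fst z)) s (snd z)))) (path_space (Suc k)) (path_ext k s)"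
      unfolding s_def t_def by (rule \<mu>.law_Y_Suc) (rule \<delta>_pos)
    note Zs = law_Z_step[OF Z Qt[unfolded t_def] \<delta>Suc, folded s_def t_def]
    have "\<exists>f'. f' \<in> borel_measurable (path_space (Suc k)) \<and> (\<forall>w\<in>space (path_space (Suc k)). 0 < f' w)
      \<and> law_Y \<mu> \<delta> (Suc k) = density (law_Z Q \<delta> (Suc k)) (\<lambda>w. ennreal (f' w))
      \<and> integrable (law_Y \<mu> \<delta> (Suc k)) (\<lambda>w. ln (f' w))
      \<and> (\<integral>w. ln (f' w) \<partial>law_Y \<mu> \<delta> (Suc k)) \<le> (\<integral>y. ln (f y) \<partial>law_Y \<mu> \<delta> k) + ?b"
    proof (rule kl_chain_step[OF \<mu>.prob_space_law_Y Zp(1) prob_space_std_gaussian setsY Zp(2) pm qm _ _ _ _ _ _ _ f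
          Ys Zs(2)])
      show "0 < glr (?post (fst z)) s (snd z)" "0 < glr (?Q (fst z)) s (snd z)" for z
        by (rule borel_prob.glr_pos[OF bP] borel_prob.glr_pos[OF bQ])+
      show "(\<integral>\<^sup>+g. ennreal (glr (?post (fst (y, g))) s (snd (y, g))) \<partial>std_gaussian) = 1"
        "(\<integral>\<^sup>+g. ennreal (glr (?Q (fst (y, g))) s (snd (y, g))) \<partial>std_gaussian) = 1" for y
        unfolding prod.sel by (rule borel_prob.nn_integral_glr[OF bP] borel_prob.nn_integral_glr[OF bQ])+
      show "path_ext k s \<in> ?\<Omega> \<Otimes>\<^sub>M std_gaussian \<rightarrow>\<^sub>M path_space (Suc k)"
        unfolding measurable_cong_sets[OF sets_pair refl] by (rule measurable_path_ext)
      show "path_dec k s \<in> path_space (Suc k) \<rightarrow>\<^sub>M ?\<Omega> \<Otimes>\<^sub>M std_gaussian"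
        unfolding measurable_cong_sets[OF refl sets_pair] by (rule measurable_path_dec)
      show "path_dec k s (path_ext k s z) = z" if "z \<in> space (?\<Omega> \<Otimes>\<^sub>M std_gaussian)" for z
        using that s sets_eq_imp_space_eq[OF sets_pair] by (intro path_dec_ext) auto
      show "0 \<le> ?b" using c \<delta>Suc by simp
      show "(\<integral>\<^sup>+y. \<integral>\<^sup>+g. ennreal (kl_fun (glr (?post (fst (y, g))) s (snd (y, g))) (glr (?Q (fst (y, g))) s (snd (y, g)))) \<partial>std_gaussian \<partial>law_Y \<mu> \<delta> k) \<le> ennreal ?b"
        using kl by (simp only: prod.sel)
    qed
    moreover have "(\<integral>y. ln (f y) \<partial>law_Y \<mu> \<delta> k) + ?b \<le> c * (\<Sum>j=1..Suc k. \<delta> j ^ (m + 1))"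
      using le by (simp add: distrib_left)
    ultimately show ?case using Zs(1) by (meson order_trans)
  qed
  from this[OF order_refl] obtain f where Z: "law_Z Q \<delta> n \<in> space (prob_algebra (path_space n))"
    and f: "f \<in> borel_measurable (path_space n)" "\<And>y. y \<in> space (path_space n) \<Longrightarrow> 0 < f y"
      "law_Y \<mu> \<delta> n = density (law_Z Q \<delta> n) (\<lambda>y. ennreal (f y))" "integrable (law_Y \<mu> \<delta> n) (\<lambda>y. ln (f y))"
    and le: "(\<integral>y. ln (f y) \<partial>law_Y \<mu> \<delta> n) \<le> c * (\<Sum>j=1..n. \<delta> j ^ (m + 1))"
    by auto
  have Zp: "prob_space (law_Z Q \<delta> n)" "sets (law_Z Q \<delta> n) = sets (path_space n)"
    using Z by (simp_all add: space_prob_algebra)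
  have "KL_div (law_Y \<mu> \<delta> n) (law_Z Q \<delta> n) \<le> ereal (c * (\<Sum>j=1..n. \<delta> j ^ (m + 1)))"
  proof (rule KL_div_density_le[OF Zp(1) \<mu>.prob_space_law_Y _ _ f(3,4) le])
    show "f \<in> borel_measurable (law_Z Q \<delta> n)"
      unfolding measurable_cong_sets[OF Zp(2) refl] by (rule f(1))
    show "0 < f y" if "y \<in> space (law_Z Q \<delta> n)" for y
      using that f(2) sets_eq_imp_space_eq[OF Zp(2)] by simp
  qed
  then show ?thesis by (simp only: c_def mult.assoc)
qed

theorem theorem3:
  fixes m :: nat
  shows "(\<exists>c>0. \<forall>(\<mu>::(real^'d::finite) measure) Q T L n (\<delta>::nat \<Rightarrow> real).
            T > 0 \<and> L > 0 \<and> thm3_hyps \<mu> Q T L m \<and>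
            (\<forall>k\<in>{1..n}. \<delta> k > 0) \<and> (\<Sum>k=1..n-1. \<delta> k) \<le> T \<longrightarrow>
            KL_div (law_Y \<mu> \<delta> n) (law_Z Q \<delta> n)
              \<le> ereal (c * L ^ (2*(m+1)) * (\<Sum>k=1..n. \<delta> k ^ (m+1))))
       \<and> (\<forall>T L. T > 0 \<and> L > 0 \<longrightarrow>
            (\<exists>C. \<forall>(\<mu>::(real^'d) measure) Q n.
               n \<ge> 1 \<and> thm3_hyps \<mu> Q T L m \<longrightarrow>
               KL_div (law_Y \<mu> (\<lambda>_. T / real n) n) (law_Z Q (\<lambda>_. T / real n) n)
                 \<le> ereal (C / real n ^ m)))"
proof (intro conjI allI impI)
  let ?c = "4 * step_const TYPE('d) m"
  show "\<exists>c>0. \<forall>(\<mu>::(real^'d::finite) measure) Q T L n (\<delta>::nat \<Rightarrow> real).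
            T > 0 \<and> L > 0 \<and> thm3_hyps \<mu> Q T L m \<and>
            (\<forall>k\<in>{1..n}. \<delta> k > 0) \<and> (\<Sum>k=1..n-1. \<delta> k) \<le> T \<longrightarrow>
            KL_div (law_Y \<mu> \<delta> n) (law_Z Q \<delta> n)
              \<le> ereal (c * L ^ (2*(m+1)) * (\<Sum>k=1..n. \<delta> k ^ (m+1)))"
    using step_const_pos[where 'd='d, of m] by (intro exI[of _ ?c] conjI allI impI KL_path_le) auto
  fix T L :: real assume TL: "T > 0 \<and> L > 0"
  show "\<exists>C. \<forall>(\<mu>::(real^'d) measure) Q n. n \<ge> 1 \<and> thm3_hyps \<mu> Q T L m \<longrightarrow>
               KL_div (law_Y \<mu> (\<lambda>_. T / real n) n) (law_Z Q (\<lambda>_. T / real n) n) \<le> ereal (C / real n ^ m)"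
  \<comment> \<open>The \<open>n\<close> summands \<open>(T / n)^(m+1)\<close> add up to
    \<open>T^(m+1) / n^m\<close>, which fixes the witness.\<close>
  proof (intro exI[of _ "?c * L ^ (2 * (m + 1)) * T ^ (m + 1)"] allI impI)
    fix \<mu> :: "(real^'d) measure" and Q and n :: nat
    assume n: "n \<ge> 1 \<and> thm3_hyps \<mu> Q T L m"
    have "KL_div (law_Y \<mu> (\<lambda>_. T / real n) n) (law_Z Q (\<lambda>_. T / real n) n)
      \<le> ereal (?c * L ^ (2 * (m + 1)) * (\<Sum>k=1..n. (T / real n) ^ (m + 1)))"
    proof (rule KL_path_le)
      have "(\<Sum>k=1..n-1. T / real n) = (real n - 1) / real n * T"
        using n by (simp add: of_nat_diff)
      also have "\<dots> \<le> 1 * T" using n TL by (intro mult_right_mono) auto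
      finally show "(\<Sum>k=1..n-1. T / real n) \<le> T" by simp
    qed (use n TL in auto)
    also have "(\<Sum>k=1..n. (T / real n) ^ (m + 1)) = T ^ (m + 1) / real n ^ m"
      using n by (simp add: power_divide)
    finally show "KL_div (law_Y \<mu> (\<lambda>_. T / real n) n) (law_Z Q (\<lambda>_. T / real n) n)
      \<le> ereal (?c * L ^ (2 * (m + 1)) * T ^ (m + 1) / real n ^ m)" by simp
  qed
qed

end
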